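(* Let $R$ be a commutative Noetherian complete local domain of Krull dimension $d$, and let $R\subset S$ be an extension of commutative rings such that $S$ is a finitely generated torsion-free $R$-module. Suppose that $S$ is Cohen-Macaulay and of finite CM type, and let $M$ be a CM generator over $S$. Suppose that the extension $R\subset S$ is pure and that $\mathrm{Hom}_R(S,M)$ is CM. Then $$\mathrm{gl.dim}\,\mathrm{End}_R(M)\le \max\{d,2\}.$$ In particular, $\mathrm{End}_R(M)$ is an NCR. Moreover, if $d\ge 2$, then $$\mathrm{gl.dim}\,\mathrm{End}_R(M)=d.$$
   Context: All modules are finitely generated. A module (or ring finite over $R$) is called CM if it is a maximal Cohen-Macaulay $R$-module. $S$ is of finite CM type if there are, up to isomorphism, only finitely many indecomposable CM $S$-modules. A CM generator over $S$ is a CM $S$-module $M$ containing every indecomposable CM $S$-module as a direct summand; equivalently, the category of CM $S$-modules equals $\mathrm{add}({}_SM)$, the category of modules isomorphic to a direct summand of $M^{\oplus l}$ for some $l\ge 0$. The module-finite extension $R\subset S$ is pure if the inclusion $R\hookrightarrow S$ splits as a map of $R$-modules. For a torsion-free $R$-module $M$, the ring $\mathrm{End}_R(M)$ is called an NCR (noncommutative resolution) if it has finite global dimension. *)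

theory Defs
  imports "HOL-Algebra.Algebra" "HOL-Library.Extended_Nat"
begin

section \<open>Complete local rings and Krull dimension\<close>

definition local_ring :: "('a, 'c) ring_scheme \<Rightarrow> bool" where
  "local_ring R \<longleftrightarrow> cring R \<and> (\<exists>!m. maximalideal m R)"

definition max_ideal :: "('a, 'c) ring_scheme \<Rightarrow> 'a set" where
  "max_ideal R = (THE m. maximalideal m R)"

primrec ideal_power :: "('a, 'c) ring_scheme \<Rightarrow> 'a set \<Rightarrow> nat \<Rightarrow> 'a set" where
  "ideal_power R I 0 = carrier R"
| "ideal_power R I (Suc n) = ideal_prod R I (ideal_power R I n)"

text \<open>
  Bijectivity of the canonical map from \<open>R\<close> to the inverse limit of the rings \<open>R / m^n\<close>: an
  element of the limit is given by a sequence with \<open>x (n+1) \<equiv> x n\<close> modulo \<open>m^n\<close>, and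
  \<open>y\<close> is mapped to it iff \<open>y \<equiv> x n\<close> modulo \<open>m^n\<close> for all \<open>n\<close>.
\<close>
definition complete_local_ring :: "('a, 'c) ring_scheme \<Rightarrow> bool" where
  "complete_local_ring R \<longleftrightarrow> local_ring R \<and>
     (\<forall>x \<in> UNIV \<rightarrow> carrier R.
        (\<forall>n. x (Suc n) \<ominus>\<^bsub>R\<^esub> x n \<in> ideal_power R (max_ideal R) n) \<longrightarrow>
        (\<exists>!y. y \<in> carrier R \<and> (\<forall>n. y \<ominus>\<^bsub>R\<^esub> x n \<in> ideal_power R (max_ideal R) n)))"

definition krull_dim :: "('a, 'c) ring_scheme \<Rightarrow> enat" where
  "krull_dim R = Sup {enat n | n. \<exists>p :: nat \<Rightarrow> 'a set.
     (\<forall>i\<le>n. primeideal (p i) R) \<and> (\<forall>i<n. p i \<subset> p (Suc i))}"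

section \<open>Modules\<close>

text \<open>
  Right modules over a not necessarily commutative ring use the record of the library's modules;
  \<open>a \<odot> x\<close> then stands for \<open>x\<close> acted upon by \<open>a\<close> from the right. The notions below that only
  mention the record (finite generation, linear maps, \<dots>) serve for both kinds of modules.
\<close>
locale right_module = R?: ring R + M?: abelian_group M
  for R :: "('a, 'c) ring_scheme" (structure) and M :: "('a, 'm, 'd) module_scheme" (structure) +
  assumes smult_closed:
      "\<lbrakk>a \<in> carrier R; x \<in> carrier M\<rbrakk> \<Longrightarrow> a \<odot>\<^bsub>M\<^esub> x \<in> carrier M"
    and smult_l_distr:
      "\<lbrakk>a \<in> carrier R; b \<in> carrier R; x \<in> carrier M\<rbrakk> \<Longrightarrow>
       (a \<oplus> b) \<odot>\<^bsub>M\<^esub> x = a \<odot>\<^bsub>M\<^esub> x \<oplus>\<^bsub>M\<^esub> b \<odot>\<^bsub>M\<^esub> x"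
    and smult_r_distr:
      "\<lbrakk>a \<in> carrier R; x \<in> carrier M; y \<in> carrier M\<rbrakk> \<Longrightarrow>
       a \<odot>\<^bsub>M\<^esub> (x \<oplus>\<^bsub>M\<^esub> y) = a \<odot>\<^bsub>M\<^esub> x \<oplus>\<^bsub>M\<^esub> a \<odot>\<^bsub>M\<^esub> y"
    and smult_assoc:
      "\<lbrakk>a \<in> carrier R; b \<in> carrier R; x \<in> carrier M\<rbrakk> \<Longrightarrow>
       (a \<otimes> b) \<odot>\<^bsub>M\<^esub> x = b \<odot>\<^bsub>M\<^esub> (a \<odot>\<^bsub>M\<^esub> x)"
    and smult_one: "x \<in> carrier M \<Longrightarrow> \<one> \<odot>\<^bsub>M\<^esub> x = x"

definition fin_gen :: "('a, 'c) ring_scheme \<Rightarrow> ('a, 'm) module \<Rightarrow> bool" where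
  "fin_gen R M \<longleftrightarrow> (\<exists>A \<subseteq> carrier M. finite A \<and>
     (\<forall>x \<in> carrier M. \<exists>c \<in> A \<rightarrow> carrier R. x = (\<Oplus>\<^bsub>M\<^esub>a\<in>A. c a \<odot>\<^bsub>M\<^esub> a)))"

text \<open>
  Up to isomorphism every finitely generated module over a ring on \<open>'a\<close> is a set of cosets of a
  submodule of some finite power of the ring, so it can be realised with elements of the following
  type. Quantifying over all modules on this type is quantifying over all isomorphism classes
  of finitely generated modules; see \<open>fin_gen_embeds\<close>.
\<close>
type_synonym 'a coset_type = "(nat \<Rightarrow> 'a) set"

lemma fin_gen_embeds:
  fixes R :: "('a, 'c) ring_scheme" and M :: "('a, 'm) module"
  assumes "abelian_group M"
    and closed: "\<And>a x. a \<in> carrier R \<Longrightarrow> x \<in> carrier M \<Longrightarrow> a \<odot>\<^bsub>M\<^esub> x \<in> carrier M"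
    and "fin_gen R M"
  shows "\<exists>\<phi> :: 'm \<Rightarrow> 'a coset_type. inj_on \<phi> (carrier M)"
proof -
  interpret abelian_group M by fact
  obtain A where A: "finite A" "A \<subseteq> carrier M"
    and gen: "\<forall>x \<in> carrier M. \<exists>c \<in> A \<rightarrow> carrier R. x = (\<Oplus>\<^bsub>M\<^esub>a\<in>A. c a \<odot>\<^bsub>M\<^esub> a)"
    using assms(3) unfolding fin_gen_def by blast
  obtain h :: "'m \<Rightarrow> nat" where h: "inj_on h A"
    using A(1) finite_imp_inj_to_nat_seg by blast
  define val where "val f = (\<Oplus>\<^bsub>M\<^esub>a\<in>A. f (h a) \<odot>\<^bsub>M\<^esub> a)" for f
  have "\<exists>f. val f = x" if x: "x \<in> carrier M" for x
  proof -
    obtain c where c: "c \<in> A \<rightarrow> carrier R" "x = (\<Oplus>\<^bsub>M\<^esub>a\<in>A. c a \<odot>\<^bsub>M\<^esub> a)" using gen x by blast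
    have "val (\<lambda>n. c (inv_into A h n)) = x"
      unfolding val_def c(2) using h A(2) c(1) by (intro finsum_cong') (auto intro!: closed)
    then show ?thesis by blast
  qed
  then have "inj_on (\<lambda>x. {f. val f = x}) (carrier M)"
    by (fastforce simp: inj_on_def)
  then show ?thesis by blast
qed

definition is_zero :: "('a, 'm) module \<Rightarrow> bool" where
  "is_zero M \<longleftrightarrow> carrier M = {\<zero>\<^bsub>M\<^esub>}"

definition torsion_free :: "('a, 'c) ring_scheme \<Rightarrow> ('a, 'm) module \<Rightarrow> bool" where
  "torsion_free R M \<longleftrightarrow> (\<forall>a \<in> carrier R. \<forall>x \<in> carrier M.
     a \<odot>\<^bsub>M\<^esub> x = \<zero>\<^bsub>M\<^esub> \<longrightarrow> a = \<zero>\<^bsub>R\<^esub> \<or> x = \<zero>\<^bsub>M\<^esub>)"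

text \<open>
  Maps are extensional, i.e. equal to \<open>undefined\<close> outside the carrier, so that equality of maps is
  equality on the carrier.
\<close>
definition linear_maps ::
  "('a, 'c) ring_scheme \<Rightarrow> ('a, 'm) module \<Rightarrow> ('a, 'n) module \<Rightarrow> ('m \<Rightarrow> 'n) set" where
  "linear_maps R M N = {f \<in> carrier M \<rightarrow>\<^sub>E carrier N.
     (\<forall>x \<in> carrier M. \<forall>y \<in> carrier M. f (x \<oplus>\<^bsub>M\<^esub> y) = f x \<oplus>\<^bsub>N\<^esub> f y) \<and>
     (\<forall>a \<in> carrier R. \<forall>x \<in> carrier M. f (a \<odot>\<^bsub>M\<^esub> x) = a \<odot>\<^bsub>N\<^esub> f x)}"

definition module_iso :: "('a, 'c) ring_scheme \<Rightarrow> ('a, 'm) module \<Rightarrow> ('a, 'n) module \<Rightarrow> bool" where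
  "module_iso R M N \<longleftrightarrow> (\<exists>f \<in> linear_maps R M N. bij_betw f (carrier M) (carrier N))"

definition internal_direct_sum ::
  "('a, 'c) ring_scheme \<Rightarrow> ('a, 'm) module \<Rightarrow> 'm set \<Rightarrow> 'm set \<Rightarrow> bool" where
  "internal_direct_sum R M A B \<longleftrightarrow> submodule A R M \<and> submodule B R M \<and>
     A \<inter> B = {\<zero>\<^bsub>M\<^esub>} \<and> A <+>\<^bsub>M\<^esub> B = carrier M"

definition iso_direct_summand ::
  "('a, 'c) ring_scheme \<Rightarrow> ('a, 'n) module \<Rightarrow> ('a, 'm) module \<Rightarrow> bool" where
  "iso_direct_summand R N M \<longleftrightarrow>
     (\<exists>A B. internal_direct_sum R M A B \<and> module_iso R N (M\<lparr>carrier := A\<rparr>))"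

definition indecomposable :: "('a, 'c) ring_scheme \<Rightarrow> ('a, 'm) module \<Rightarrow> bool" where
  "indecomposable R M \<longleftrightarrow> \<not> is_zero M \<and>
     (\<forall>A B. internal_direct_sum R M A B \<longrightarrow> A = {\<zero>\<^bsub>M\<^esub>} \<or> B = {\<zero>\<^bsub>M\<^esub>})"

definition regular_module :: "'a ring \<Rightarrow> ('a, 'a) module" where
  "regular_module S = \<lparr>carrier = carrier S, monoid.mult = monoid.mult S, one = one S,
     ring.zero = ring.zero S, ring.add = ring.add S, smult = monoid.mult S\<rparr>"

text \<open>
  The record type of modules extends that of rings; the fields \<open>mult\<close> and \<open>one\<close> play no role in a
  module and are left unspecified here.
\<close>
definition hom_module ::
  "('a, 'c) ring_scheme \<Rightarrow> ('a, 'm) module \<Rightarrow> ('a, 'n) module \<Rightarrow> ('a, 'm \<Rightarrow> 'n) module" where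
  "hom_module R M N = \<lparr>carrier = linear_maps R M N, monoid.mult = undefined, one = undefined,
     ring.zero = (\<lambda>x\<in>carrier M. \<zero>\<^bsub>N\<^esub>),
     ring.add = (\<lambda>f g. \<lambda>x\<in>carrier M. f x \<oplus>\<^bsub>N\<^esub> g x),
     smult = (\<lambda>a f. \<lambda>x\<in>carrier M. a \<odot>\<^bsub>N\<^esub> f x)\<rparr>"

definition End_ring :: "('a, 'c) ring_scheme \<Rightarrow> ('a, 'm) module \<Rightarrow> ('m \<Rightarrow> 'm) ring" where
  "End_ring R M = \<lparr>carrier = linear_maps R M M, monoid.mult = compose (carrier M),
     one = (\<lambda>x\<in>carrier M. x), ring.zero = (\<lambda>x\<in>carrier M. \<zero>\<^bsub>M\<^esub>),
     ring.add = (\<lambda>f g. \<lambda>x\<in>carrier M. f x \<oplus>\<^bsub>M\<^esub> g x)\<rparr>"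

section \<open>Depth and maximal Cohen-Macaulay modules\<close>

text \<open>The submodule \<open>(x\<^sub>1, \<dots>, x\<^sub>n) M\<close>.\<close>
definition seq_submodule :: "('a, 'm) module \<Rightarrow> 'a list \<Rightarrow> 'm set" where
  "seq_submodule M xs =
     {\<Oplus>\<^bsub>M\<^esub>i\<in>{..<length xs}. (xs ! i) \<odot>\<^bsub>M\<^esub> v i | v. v \<in> {..<length xs} \<rightarrow> carrier M}"

text \<open>
  The last condition says that \<open>x\<^sub>i\<close> is a nonzerodivisor on
  \<open>M / (x\<^sub>1, \<dots>, x\<^sub>i\<^sub>-\<^sub>1) M\<close>.
\<close>
definition regular_sequence ::
  "('a, 'c) ring_scheme \<Rightarrow> ('a, 'm) module \<Rightarrow> 'a list \<Rightarrow> bool" where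
  "regular_sequence R M xs \<longleftrightarrow> set xs \<subseteq> carrier R \<and> seq_submodule M xs \<noteq> carrier M \<and>
     (\<forall>i < length xs. \<forall>y \<in> carrier M.
        (xs ! i) \<odot>\<^bsub>M\<^esub> y \<in> seq_submodule M (take i xs) \<longrightarrow> y \<in> seq_submodule M (take i xs))"

definition depth :: "('a, 'c) ring_scheme \<Rightarrow> ('a, 'm) module \<Rightarrow> enat" where
  "depth R M = Sup {enat (length xs) | xs. set xs \<subseteq> max_ideal R \<and> regular_sequence R M xs}"

text \<open>
  Maximal Cohen-Macaulay modules over a local ring. The zero module counts as one, so that these
  modules are closed under direct summands.
\<close>
definition MCM :: "('a, 'c) ring_scheme \<Rightarrow> ('a, 'm) module \<Rightarrow> bool" where
  "MCM R M \<longleftrightarrow> module R M \<and> fin_gen R M \<and> (is_zero M \<or> depth R M = krull_dim R)"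

section \<open>Ring extensions and Cohen-Macaulay type\<close>

text \<open>
  An extension is a subring inclusion. An \<open>S\<close>-module, as a record, is then also its own restriction
  of scalars to \<open>R\<close>.
\<close>
definition ring_extension :: "'a ring \<Rightarrow> 'a ring \<Rightarrow> bool" where
  "ring_extension R S \<longleftrightarrow> cring S \<and> subring (carrier R) S \<and> R = S\<lparr>carrier := carrier R\<rparr>"

definition pure_extension :: "'a ring \<Rightarrow> 'a ring \<Rightarrow> bool" where
  "pure_extension R S \<longleftrightarrow>
     (\<exists>\<rho> \<in> linear_maps R (regular_module S) (regular_module R). \<forall>r \<in> carrier R. \<rho> r = r)"

definition CM_module :: "'a ring \<Rightarrow> 'a ring \<Rightarrow> ('a, 'm) module \<Rightarrow> bool" where
  "CM_module R S N \<longleftrightarrow> module S N \<and> MCM R N"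

definition finite_CM_type :: "'a ring \<Rightarrow> 'a ring \<Rightarrow> bool" where
  "finite_CM_type R S \<longleftrightarrow> (\<exists>F :: ('a, 'a coset_type) module set. finite F \<and>
     (\<forall>N :: ('a, 'a coset_type) module. CM_module R S N \<and> indecomposable S N \<longrightarrow>
        (\<exists>N' \<in> F. module_iso S N N')))"

definition CM_generator :: "'a ring \<Rightarrow> 'a ring \<Rightarrow> ('a, 'm) module \<Rightarrow> bool" where
  "CM_generator R S M \<longleftrightarrow> CM_module R S M \<and>
     (\<forall>N :: ('a, 'a coset_type) module. CM_module R S N \<and> indecomposable S N \<longrightarrow>
        iso_direct_summand S N M)"

section \<open>Global dimension\<close>

text \<open>
  All modules are finitely generated, so projectivity, resolutions and global dimension are taken
  within the finitely generated right modules. Over a two-sided Noetherian ring, such as the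
  endomorphism ring of a finitely generated module over a commutative Noetherian ring, the
  resulting global dimension is the usual one, and is the same for left modules.
\<close>
definition fg_right_module :: "('a, 'c) ring_scheme \<Rightarrow> ('a, 'm) module \<Rightarrow> bool" where
  "fg_right_module \<Lambda> N \<longleftrightarrow> right_module \<Lambda> N \<and> fin_gen \<Lambda> N"

definition projective :: "('a, 'c) ring_scheme \<Rightarrow> ('a, 'm) module \<Rightarrow> bool" where
  "projective \<Lambda> P \<longleftrightarrow> fg_right_module \<Lambda> P \<and>
     (\<forall>(N :: ('a, 'a coset_type) module) (L :: ('a, 'a coset_type) module).
        \<forall>g \<in> linear_maps \<Lambda> N L. \<forall>f \<in> linear_maps \<Lambda> P L.
          fg_right_module \<Lambda> N \<and> fg_right_module \<Lambda> L \<and> g ` carrier N = carrier L \<longrightarrow>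
          (\<exists>h \<in> linear_maps \<Lambda> P N. \<forall>x \<in> carrier P. g (h x) = f x))"

definition ker_of :: "('a, 'm) module \<Rightarrow> ('a, 'n) module \<Rightarrow> ('m \<Rightarrow> 'n) \<Rightarrow> 'm set" where
  "ker_of M N f = {x \<in> carrier M. f x = \<zero>\<^bsub>N\<^esub>}"

text \<open>\<open>\<dots> \<rightarrow> P 2 \<rightarrow> P 1 \<rightarrow> P 0 \<rightarrow> N \<rightarrow> 0\<close> with \<open>\<delta> i : P (i+1) \<rightarrow> P i\<close> and augmentation \<open>\<epsilon>\<close>.\<close>
definition projective_resolution ::
  "('a, 'c) ring_scheme \<Rightarrow> ('a, 'm) module \<Rightarrow> (nat \<Rightarrow> ('a, 'n) module) \<Rightarrow>
   (nat \<Rightarrow> 'n \<Rightarrow> 'n) \<Rightarrow> ('n \<Rightarrow> 'm) \<Rightarrow> bool" where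
  "projective_resolution \<Lambda> N P \<delta> \<epsilon> \<longleftrightarrow>
     (\<forall>i. projective \<Lambda> (P i)) \<and>
     \<epsilon> \<in> linear_maps \<Lambda> (P 0) N \<and> (\<forall>i. \<delta> i \<in> linear_maps \<Lambda> (P (Suc i)) (P i)) \<and>
     \<epsilon> ` carrier (P 0) = carrier N \<and>
     \<delta> 0 ` carrier (P 1) = ker_of (P 0) N \<epsilon> \<and>
     (\<forall>i. \<delta> (Suc i) ` carrier (P (Suc (Suc i))) = ker_of (P (Suc i)) (P i) (\<delta> i))"

definition proj_dim :: "('a, 'c) ring_scheme \<Rightarrow> ('a, 'm) module \<Rightarrow> enat" where
  "proj_dim \<Lambda> N = Inf {enat n | n. \<exists>(P :: nat \<Rightarrow> ('a, 'a coset_type) module) \<delta> \<epsilon>.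
     projective_resolution \<Lambda> N P \<delta> \<epsilon> \<and> (\<forall>i > n. is_zero (P i))}"

definition gl_dim :: "('a, 'c) ring_scheme \<Rightarrow> enat" where
  "gl_dim \<Lambda> = Sup {proj_dim \<Lambda> N | N :: ('a, 'a coset_type) module. fg_right_module \<Lambda> N}"

definition is_NCR :: "('a, 'c) ring_scheme \<Rightarrow> ('a, 'm) module \<Rightarrow> bool" where
  "is_NCR R M \<longleftrightarrow> module R M \<and> fin_gen R M \<and> torsion_free R M \<and> gl_dim (End_ring R M) < \<infinity>"

end

theory Submission
  imports Defs
begin

text \<open>
  Write \<open>E = End\<^sub>R(M)\<close> and let \<open>add M\<close> consist of the modules whose identity is a finite sum of maps
  factoring through \<open>M\<close>. A partial free resolution \<open>E\<^sup>b\<^sup>' \<rightarrow> \<dots> \<rightarrow> E\<^sup>b\<close> of length \<open>n = max d 2\<close> comes from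
  a complex of \<open>R\<close>-linear maps between powers of \<open>M\<close>. Since \<open>S\<close> lies in \<open>add M\<close>, this complex stays
  exact under \<open>Hom\<^sub>R(S, -)\<close>. A sequence that is regular on \<open>M\<close> is regular on all of \<open>add M\<close>, in
  particular on \<open>Hom\<^sub>R(S, M)\<close>, and counting syzygies shows that \<open>Hom\<^sub>R(S, K)\<close> is CM, where \<open>K\<close> is the
  last kernel. So \<open>Hom\<^sub>R(S, K)\<close> lies in \<open>add M\<close>, and by purity \<open>K\<close> is a direct summand of it over \<open>R\<close>.
  Hence the last syzygy \<open>Hom\<^sub>R(M, K)\<close> is projective.

  For the lower bound, \<open>R\<close> is a summand of \<open>M\<close>, given by an idempotent \<open>e\<close> of \<open>E\<close>. A projective
  resolution of a right module \<open>Q\<close> yields a resolution of \<open>Qe\<close> by modules in \<open>add M\<close>, and for a suitable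
  \<open>Q\<close> the maximal ideal kills a nonzero element of \<open>Qe\<close>, which forces the length to be at least \<open>d\<close>.
\<close>

section \<open>Submodules and linear maps\<close>

text \<open>Depth is counted by hand: one sequence \<open>x\<close> of length \<open>d\<close> that
  is regular on \<open>M\<close> is fixed and used on all modules that occur, so only the behaviour
  of a fixed sequence along short exact sequences has to be understood. The last kernel K is just an
  R-module, while the generator hypothesis speaks of S-modules; Hom_R(S, K) is an S-module through
  its source, and the hypothesis that Hom_R(S, M) is CM supplies the regular elements on the terms
  Hom_R(S, M^b). The constant 2 comes from left exactness. A kernel of a map between free modules is
  Hom_R(M, K) with K the kernel of a matrix, and kernels of this kind start at the second syzygy.
  Before the first of them stands an image inside Hom_R(S, M^b), which inherits one regular element;
  every further kernel gains one. Describing add M by sums of factorizations makes every transfer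
  (of regularity, along Hom functors, along the corner functor) an induction over the summands. For
  the lower bound the killed element acts like a generator of the residue field: it is handed on
  from syzygy to syzygy, up to degree \<open>d\<close>.\<close>

definition is_linear ::
  "('a, 'c) ring_scheme \<Rightarrow> ('a, 'm) module \<Rightarrow> ('a, 'n) module \<Rightarrow> ('m \<Rightarrow> 'n) \<Rightarrow> bool" where
  "is_linear \<Lambda> N L f \<longleftrightarrow> f \<in> carrier N \<rightarrow> carrier L \<and>
     (\<forall>x \<in> carrier N. \<forall>y \<in> carrier N. f (x \<oplus>\<^bsub>N\<^esub> y) = f x \<oplus>\<^bsub>L\<^esub> f y) \<and>
     (\<forall>a \<in> carrier \<Lambda>. \<forall>x \<in> carrier N. f (a \<odot>\<^bsub>N\<^esub> x) = a \<odot>\<^bsub>L\<^esub> f x)"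

definition is_sub :: "('a, 'c) ring_scheme \<Rightarrow> ('a, 'm) module \<Rightarrow> 'm set \<Rightarrow> bool" where
  "is_sub \<Lambda> N W \<longleftrightarrow> W \<subseteq> carrier N \<and> \<zero>\<^bsub>N\<^esub> \<in> W \<and>
     (\<forall>x \<in> W. \<forall>y \<in> W. x \<oplus>\<^bsub>N\<^esub> y \<in> W) \<and> (\<forall>a \<in> carrier \<Lambda>. \<forall>x \<in> W. a \<odot>\<^bsub>N\<^esub> x \<in> W)"

text \<open>The submodule generated by \<open>A\<close>. Rule induction takes the place of
  coefficient sums; \<open>fin_gen_iff_lspan\<close> leads back to the sums of
  \<open>fin_gen\<close>.\<close>

inductive_set lspan :: "('a, 'c) ring_scheme \<Rightarrow> ('a, 'm) module \<Rightarrow> 'm set \<Rightarrow> 'm set"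
  for \<Lambda> N A where
  lspan_zero: "\<zero>\<^bsub>N\<^esub> \<in> lspan \<Lambda> N A"
| lspan_base: "a \<in> A \<Longrightarrow> a \<in> lspan \<Lambda> N A"
| lspan_add: "\<lbrakk>x \<in> lspan \<Lambda> N A; y \<in> lspan \<Lambda> N A\<rbrakk> \<Longrightarrow> x \<oplus>\<^bsub>N\<^esub> y \<in> lspan \<Lambda> N A"
| lspan_smult: "\<lbrakk>c \<in> carrier \<Lambda>; x \<in> lspan \<Lambda> N A\<rbrakk> \<Longrightarrow> c \<odot>\<^bsub>N\<^esub> x \<in> lspan \<Lambda> N A"

lemma is_linearI [intro?]:
  assumes "\<And>x. x \<in> carrier N \<Longrightarrow> f x \<in> carrier L"
    and "\<And>x y. x \<in> carrier N \<Longrightarrow> y \<in> carrier N \<Longrightarrow> f (x \<oplus>\<^bsub>N\<^esub> y) = f x \<oplus>\<^bsub>L\<^esub> f y"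
    and "\<And>a x. a \<in> carrier \<Lambda> \<Longrightarrow> x \<in> carrier N \<Longrightarrow> f (a \<odot>\<^bsub>N\<^esub> x) = a \<odot>\<^bsub>L\<^esub> f x"
  shows "is_linear \<Lambda> N L f"
  using assms by (auto simp: is_linear_def)

lemma is_linearD:
  assumes "is_linear \<Lambda> N L f"
  shows "x \<in> carrier N \<Longrightarrow> f x \<in> carrier L"
    and "x \<in> carrier N \<Longrightarrow> y \<in> carrier N \<Longrightarrow> f (x \<oplus>\<^bsub>N\<^esub> y) = f x \<oplus>\<^bsub>L\<^esub> f y"
    and "a \<in> carrier \<Lambda> \<Longrightarrow> x \<in> carrier N \<Longrightarrow> f (a \<odot>\<^bsub>N\<^esub> x) = a \<odot>\<^bsub>L\<^esub> f x"
  using assms by (auto simp: is_linear_def)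

lemma is_linear_comp:
  assumes "is_linear \<Lambda> N L f" "is_linear \<Lambda> L K g"
  shows "is_linear \<Lambda> N K (\<lambda>x. g (f x))"
  using assms by (auto simp: is_linear_def Pi_def)

lemma is_linear_id: "is_linear \<Lambda> N N (\<lambda>x. x)"
  by (auto simp: is_linear_def)

lemma is_linear_mono:
  "is_linear \<Lambda> N L f \<Longrightarrow> carrier \<Lambda>' \<subseteq> carrier \<Lambda> \<Longrightarrow> is_linear \<Lambda>' N L f"
  by (auto simp: is_linear_def)

text \<open>\<open>is_linear\<close> leaves the values off the carrier free, so lambda terms compose
  without restriction; extensionality is added where \<open>linear_maps\<close> asks for it.\<close>

lemma linear_maps_iff: "f \<in> linear_maps \<Lambda> N L \<longleftrightarrow> is_linear \<Lambda> N L f \<and> f \<in> extensional (carrier N)"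
  by (auto simp: linear_maps_def is_linear_def PiE_def)

lemma linear_maps_linear: "f \<in> linear_maps \<Lambda> N L \<Longrightarrow> is_linear \<Lambda> N L f"
  by (simp add: linear_maps_iff)

lemma is_subI [intro?]:
  assumes "W \<subseteq> carrier N" "\<zero>\<^bsub>N\<^esub> \<in> W" "\<And>x y. x \<in> W \<Longrightarrow> y \<in> W \<Longrightarrow> x \<oplus>\<^bsub>N\<^esub> y \<in> W"
    "\<And>a x. a \<in> carrier \<Lambda> \<Longrightarrow> x \<in> W \<Longrightarrow> a \<odot>\<^bsub>N\<^esub> x \<in> W"
  shows "is_sub \<Lambda> N W"
  using assms by (auto simp: is_sub_def)

lemma is_subD:
  assumes "is_sub \<Lambda> N W"
  shows "W \<subseteq> carrier N" "\<zero>\<^bsub>N\<^esub> \<in> W" "x \<in> W \<Longrightarrow> y \<in> W \<Longrightarrow> x \<oplus>\<^bsub>N\<^esub> y \<in> W"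
    "a \<in> carrier \<Lambda> \<Longrightarrow> x \<in> W \<Longrightarrow> a \<odot>\<^bsub>N\<^esub> x \<in> W" "x \<in> W \<Longrightarrow> x \<in> carrier N"
  using assms by (auto simp: is_sub_def)

lemma is_sub_mono: "is_sub \<Lambda> N W \<Longrightarrow> carrier \<Lambda>' \<subseteq> carrier \<Lambda> \<Longrightarrow> is_sub \<Lambda>' N W"
  by (auto simp: is_sub_def)

lemma is_linear_sub_dom:
  "is_linear \<Lambda> N L f \<Longrightarrow> W \<subseteq> carrier N \<Longrightarrow> is_linear \<Lambda> (N\<lparr>carrier := W\<rparr>) L f"
  unfolding is_linear_def by (simp add: subset_eq Pi_iff)

lemma is_linear_sub_cod:
  "is_linear \<Lambda> N L f \<Longrightarrow> f ` carrier N \<subseteq> W \<Longrightarrow> is_linear \<Lambda> N (L\<lparr>carrier := W\<rparr>) f"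
  by (auto simp: is_linear_def)

lemma is_linear_sub_incl: "is_sub \<Lambda> N W \<Longrightarrow> is_linear \<Lambda> (N\<lparr>carrier := W\<rparr>) N (\<lambda>x. x)"
  by (auto simp: is_linear_def is_sub_def)

lemma restrict_linear_maps:
  assumes "is_linear \<Lambda> N L f"
    and "\<And>x y. x \<in> carrier N \<Longrightarrow> y \<in> carrier N \<Longrightarrow> x \<oplus>\<^bsub>N\<^esub> y \<in> carrier N"
    and "\<And>a x. a \<in> carrier \<Lambda> \<Longrightarrow> x \<in> carrier N \<Longrightarrow> a \<odot>\<^bsub>N\<^esub> x \<in> carrier N"
  shows "restrict f (carrier N) \<in> linear_maps \<Lambda> N L"
  using assms by (auto simp: linear_maps_def is_linear_def)

section \<open>Right modules: submodules, spans, kernels and images\<close>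

locale rmodule = right_module R M
  for R :: "('a, 'c) ring_scheme" (structure) and M :: "('a, 'm) module" (structure)

lemmas (in rmodule) [simp, intro] = smult_closed
lemmas (in rmodule) [simp] = smult_one

text \<open>Over a commutative ring left and right modules coincide, so what is proved in
  \<open>rmodule\<close> serves \<open>R\<close>, \<open>S\<close> and the endomorphism ring
  alike.\<close>

lemma rmodule_of_module:
  assumes "module R N"
  shows "rmodule R N"
proof -
  interpret module R N by fact
  show ?thesis
    by unfold_locales
      (auto simp: smult_l_distr smult_r_distr smult_assoc1[symmetric] R.m_comm)
qed

context rmodule
begin

lemma smult_r_null [simp]: "a \<in> carrier R \<Longrightarrow> a \<odot>\<^bsub>M\<^esub> \<zero>\<^bsub>M\<^esub> = \<zero>\<^bsub>M\<^esub>"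
  by (metis M.add.l_cancel_one M.zero_closed smult_closed smult_r_distr M.l_zero)

lemma smult_l_null [simp]: "x \<in> carrier M \<Longrightarrow> \<zero> \<odot>\<^bsub>M\<^esub> x = \<zero>\<^bsub>M\<^esub>"
  by (metis M.add.l_cancel_one R.zero_closed smult_closed smult_l_distr R.l_zero)

lemma smult_r_minus: "a \<in> carrier R \<Longrightarrow> x \<in> carrier M \<Longrightarrow> a \<odot>\<^bsub>M\<^esub> (\<ominus>\<^bsub>M\<^esub> x) = \<ominus>\<^bsub>M\<^esub> (a \<odot>\<^bsub>M\<^esub> x)"
  by (metis M.a_inv_closed M.minus_equality M.l_neg smult_closed smult_r_distr smult_r_null)

lemma smult_l_minus: "a \<in> carrier R \<Longrightarrow> x \<in> carrier M \<Longrightarrow> (\<ominus> a) \<odot>\<^bsub>M\<^esub> x = \<ominus>\<^bsub>M\<^esub> (a \<odot>\<^bsub>M\<^esub> x)"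
  by (metis R.a_inv_closed M.minus_equality R.l_neg smult_closed smult_l_distr smult_l_null)

lemma smult_r_diff:
  "a \<in> carrier R \<Longrightarrow> x \<in> carrier M \<Longrightarrow> y \<in> carrier M \<Longrightarrow>
   a \<odot>\<^bsub>M\<^esub> (x \<ominus>\<^bsub>M\<^esub> y) = a \<odot>\<^bsub>M\<^esub> x \<ominus>\<^bsub>M\<^esub> a \<odot>\<^bsub>M\<^esub> y"
  by (simp add: M.minus_eq smult_r_distr smult_r_minus)

lemma minus_one_smult: "x \<in> carrier M \<Longrightarrow> (\<ominus> \<one>) \<odot>\<^bsub>M\<^esub> x = \<ominus>\<^bsub>M\<^esub> x"
  by (simp add: smult_l_minus)

lemma sub_minus: "is_sub R M W \<Longrightarrow> x \<in> W \<Longrightarrow> \<ominus>\<^bsub>M\<^esub> x \<in> W"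
  using minus_one_smult is_subD(4,5)[of R M W] by (metis R.a_inv_closed R.one_closed)

lemma sub_diff: "is_sub R M W \<Longrightarrow> x \<in> W \<Longrightarrow> y \<in> W \<Longrightarrow> x \<ominus>\<^bsub>M\<^esub> y \<in> W"
  unfolding M.minus_eq by (simp add: is_subD(3) sub_minus)

lemma sub_add_cancel: "is_sub R M W \<Longrightarrow> x \<in> carrier M \<Longrightarrow> y \<in> W \<Longrightarrow> x \<oplus>\<^bsub>M\<^esub> y \<in> W \<Longrightarrow> x \<in> W"
  using sub_diff[of W "x \<oplus>\<^bsub>M\<^esub> y" y] is_subD(5)[of R M W y]
  by (simp add: M.minus_eq M.a_assoc M.r_neg)

lemma sub_carrier: "is_sub R M (carrier M)"
  by (rule is_subI) auto

lemma sub_zero: "is_sub R M {\<zero>\<^bsub>M\<^esub>}"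
  by (rule is_subI) auto

lemma rmodule_sub:
  assumes "is_sub R M W"
  shows "rmodule R (M\<lparr>carrier := W\<rparr>)"
proof -
  note W = is_subD[OF assms]
  have inv: "\<exists>y \<in> W. x \<oplus>\<^bsub>M\<^esub> y = \<zero>\<^bsub>M\<^esub>" if "x \<in> W" for x
    using sub_minus[OF assms that] M.r_neg[OF W(5)[OF that]] by blast
  have "abelian_group (M\<lparr>carrier := W\<rparr>)"
    using W sub_minus[OF assms]
    by (intro abelian_groupI) (auto simp: subset_eq M.a_ac inv)
  then show ?thesis
    using W R.ring_axioms
    by (intro rmodule.intro right_module.intro right_module_axioms.intro)
      (auto simp: smult_l_distr smult_r_distr smult_assoc)
qed

lemma lspan_subset: "is_sub R M W \<Longrightarrow> A \<subseteq> W \<Longrightarrow> lspan R M A \<subseteq> W"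
proof
  fix x assume "is_sub R M W" "A \<subseteq> W" "x \<in> lspan R M A"
  from this(3,1,2) show "x \<in> W"
    by (induction rule: lspan.induct) (auto intro: is_subD)
qed

lemma lspan_sub: "A \<subseteq> carrier M \<Longrightarrow> is_sub R M (lspan R M A)"
  by (rule is_subI[OF lspan_subset[OF sub_carrier]]) (auto intro: lspan.intros)

text \<open>The elements c a + y with y in the span of \<open>A\<close> form a submodule containing
  \<open>insert a A\<close>. Splitting off one generator in this way drives the later inductions
  over finite generating sets (\<open>fin_gen\<close>, Noetherian modules, Nakayama's
  lemma).\<close>

lemma lspan_insertE:
  assumes "x \<in> lspan R M (insert a A)" "a \<in> carrier M" "A \<subseteq> carrier M"
  obtains c y where "c \<in> carrier R" "y \<in> lspan R M A" "x = c \<odot>\<^bsub>M\<^esub> a \<oplus>\<^bsub>M\<^esub> y"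
proof -
  note S = lspan_sub[OF assms(3)]
  let ?W = "{c \<odot>\<^bsub>M\<^esub> a \<oplus>\<^bsub>M\<^esub> y | c y. c \<in> carrier R \<and> y \<in> lspan R M A}"
  have "is_sub R M ?W"
  proof
    show "?W \<subseteq> carrier M" using assms(2) is_subD[OF S] by auto
    show "\<zero>\<^bsub>M\<^esub> \<in> ?W" using assms(2) is_subD(2)[OF S]
      by (auto intro!: exI[of _ "\<zero>"] exI[of _ "\<zero>\<^bsub>M\<^esub>"])
  next
    fix u v assume "u \<in> ?W" "v \<in> ?W"
    then obtain c y c' y' where *: "c \<in> carrier R" "y \<in> lspan R M A" "u = c \<odot>\<^bsub>M\<^esub> a \<oplus>\<^bsub>M\<^esub> y"
      "c' \<in> carrier R" "y' \<in> lspan R M A" "v = c' \<odot>\<^bsub>M\<^esub> a \<oplus>\<^bsub>M\<^esub> y'" by blast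
    have yc: "y \<in> carrier M" "y' \<in> carrier M" using * is_subD(5)[OF S] by auto
    have "u \<oplus>\<^bsub>M\<^esub> v = (c \<oplus> c') \<odot>\<^bsub>M\<^esub> a \<oplus>\<^bsub>M\<^esub> (y \<oplus>\<^bsub>M\<^esub> y')"
      using * yc assms(2) by (simp add: smult_l_distr M.a_ac)
    then show "u \<oplus>\<^bsub>M\<^esub> v \<in> ?W" using * by (blast intro: lspan_add R.a_closed)
  next
    fix r u assume r: "r \<in> carrier R" and "u \<in> ?W"
    then obtain c y where *: "c \<in> carrier R" "y \<in> lspan R M A" "u = c \<odot>\<^bsub>M\<^esub> a \<oplus>\<^bsub>M\<^esub> y" by blast
    have yc: "y \<in> carrier M" using * is_subD(5)[OF S] by auto
    have "r \<odot>\<^bsub>M\<^esub> u = (c \<otimes> r) \<odot>\<^bsub>M\<^esub> a \<oplus>\<^bsub>M\<^esub> r \<odot>\<^bsub>M\<^esub> y"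
      using * yc r assms(2) by (simp add: smult_r_distr smult_assoc)
    then show "r \<odot>\<^bsub>M\<^esub> u \<in> ?W" using * r by (blast intro: lspan_smult R.m_closed)
  qed
  moreover have "insert a A \<subseteq> ?W"
  proof
    fix z assume "z \<in> insert a A"
    then have "z = \<one> \<odot>\<^bsub>M\<^esub> a \<oplus>\<^bsub>M\<^esub> \<zero>\<^bsub>M\<^esub> \<or> z = \<zero> \<odot>\<^bsub>M\<^esub> a \<oplus>\<^bsub>M\<^esub> z \<and> z \<in> A"
      using assms by auto
    then show "z \<in> ?W" by (blast intro: lspan_base lspan_zero)
  qed
  ultimately show ?thesis using lspan_subset assms(1) that by blast
qed

lemma fin_gen_iff_lspan:
  "fin_gen R M \<longleftrightarrow> (\<exists>A. finite A \<and> A \<subseteq> carrier M \<and> carrier M \<subseteq> lspan R M A)"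
proof
  assume "fin_gen R M"
  then obtain A where A: "A \<subseteq> carrier M" "finite A"
    "\<forall>x \<in> carrier M. \<exists>c \<in> A \<rightarrow> carrier R. x = (\<Oplus>\<^bsub>M\<^esub>a\<in>A. c a \<odot>\<^bsub>M\<^esub> a)"
    unfolding fin_gen_def by blast
  have "(\<Oplus>\<^bsub>M\<^esub>a\<in>B. c a \<odot>\<^bsub>M\<^esub> a) \<in> lspan R M A" if "finite B" "B \<subseteq> A" "c \<in> A \<rightarrow> carrier R" for c B
    using that
  proof (induction B)
    case empty then show ?case by (simp add: lspan_zero)
  next
    case (insert b B)
    then have "(\<Oplus>\<^bsub>M\<^esub>a\<in>insert b B. c a \<odot>\<^bsub>M\<^esub> a) = c b \<odot>\<^bsub>M\<^esub> b \<oplus>\<^bsub>M\<^esub> (\<Oplus>\<^bsub>M\<^esub>a\<in>B. c a \<odot>\<^bsub>M\<^esub> a)"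
      using A(1) by (intro M.finsum_insert) auto
    moreover have "c b \<odot>\<^bsub>M\<^esub> b \<in> lspan R M A"
      using insert.prems by (intro lspan_smult lspan_base) (auto simp: Pi_iff)
    moreover have "(\<Oplus>\<^bsub>M\<^esub>a\<in>B. c a \<odot>\<^bsub>M\<^esub> a) \<in> lspan R M A" using insert by simp
    ultimately show ?case by (simp add: lspan_add)
  qed
  note step = this[OF A(2) order_refl]
  have "carrier M \<subseteq> lspan R M A"
  proof
    fix x assume "x \<in> carrier M"
    then obtain c where "c \<in> A \<rightarrow> carrier R" "x = (\<Oplus>\<^bsub>M\<^esub>a\<in>A. c a \<odot>\<^bsub>M\<^esub> a)" using A(3) by (elim ballE bexE) auto
    then show "x \<in> lspan R M A" using step[of c] by simp
  qed
  then show "\<exists>A. finite A \<and> A \<subseteq> carrier M \<and> carrier M \<subseteq> lspan R M A"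
    using A by blast
next
  assume "\<exists>A. finite A \<and> A \<subseteq> carrier M \<and> carrier M \<subseteq> lspan R M A"
  then obtain A where A: "finite A" "A \<subseteq> carrier M" "carrier M \<subseteq> lspan R M A" by blast
  have "\<exists>c \<in> B \<rightarrow> carrier R. x = (\<Oplus>\<^bsub>M\<^esub>a\<in>B. c a \<odot>\<^bsub>M\<^esub> a)" if "finite B" "B \<subseteq> A" "x \<in> lspan R M B" for x B
    using that
  proof (induction B arbitrary: x)
    case empty
    then have "x = \<zero>\<^bsub>M\<^esub>" using lspan_subset[OF sub_zero, of "{}"] by auto
    then show ?case by simp
  next
    case (insert b B)
    then have b: "b \<in> carrier M" "B \<subseteq> carrier M" using A(2) by auto
    from lspan_insertE[OF insert.prems(2) this]
    obtain c y where cy: "c \<in> carrier R" "y \<in> lspan R M B" "x = c \<odot>\<^bsub>M\<^esub> b \<oplus>\<^bsub>M\<^esub> y" by blast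
    from insert.IH[OF _ cy(2)] insert.prems(1)
    obtain e where e: "e \<in> B \<rightarrow> carrier R" "y = (\<Oplus>\<^bsub>M\<^esub>a\<in>B. e a \<odot>\<^bsub>M\<^esub> a)" by auto
    let ?e = "e(b := c)"
    have "(\<Oplus>\<^bsub>M\<^esub>a\<in>insert b B. ?e a \<odot>\<^bsub>M\<^esub> a) = ?e b \<odot>\<^bsub>M\<^esub> b \<oplus>\<^bsub>M\<^esub> (\<Oplus>\<^bsub>M\<^esub>a\<in>B. ?e a \<odot>\<^bsub>M\<^esub> a)"
      using insert.hyps b e cy(1) by (intro M.finsum_insert) (auto simp: Pi_iff)
    also have "(\<Oplus>\<^bsub>M\<^esub>a\<in>B. ?e a \<odot>\<^bsub>M\<^esub> a) = (\<Oplus>\<^bsub>M\<^esub>a\<in>B. e a \<odot>\<^bsub>M\<^esub> a)"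
      using insert.hyps b e by (intro M.finsum_cong') (auto simp: Pi_iff)
    finally have "x = (\<Oplus>\<^bsub>M\<^esub>a\<in>insert b B. ?e a \<odot>\<^bsub>M\<^esub> a)" using cy e by simp
    moreover have "?e \<in> insert b B \<rightarrow> carrier R" using e cy by auto
    ultimately show ?case by blast
  qed
  from this[OF A(1) order_refl] show "fin_gen R M" unfolding fin_gen_def using A by blast
qed

lemma linear_zero_map:
  assumes "rmodule R L"
  shows "is_linear R M L (\<lambda>x. \<zero>\<^bsub>L\<^esub>)"
proof -
  interpret L: rmodule R L by fact
  show ?thesis by (rule is_linearI) auto
qed

lemma linear_zero:
  assumes "rmodule R L" "is_linear R M L f"
  shows "f \<zero>\<^bsub>M\<^esub> = \<zero>\<^bsub>L\<^esub>"
proof -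
  interpret L: rmodule R L by fact
  have "f \<zero>\<^bsub>M\<^esub> = f (\<zero> \<odot>\<^bsub>M\<^esub> \<zero>\<^bsub>M\<^esub>)" by simp
  also have "\<dots> = \<zero> \<odot>\<^bsub>L\<^esub> f \<zero>\<^bsub>M\<^esub>" by (rule is_linearD(3)[OF assms(2)]) auto
  finally show ?thesis using is_linearD(1)[OF assms(2)] by simp
qed

lemma linear_minus:
  assumes "rmodule R L" "is_linear R M L f" "x \<in> carrier M"
  shows "f (\<ominus>\<^bsub>M\<^esub> x) = \<ominus>\<^bsub>L\<^esub> f x"
proof -
  interpret L: rmodule R L by fact
  have "f ((\<ominus> \<one>) \<odot>\<^bsub>M\<^esub> x) = (\<ominus> \<one>) \<odot>\<^bsub>L\<^esub> f x" by (rule is_linearD(3)[OF assms(2)]) (use assms in auto)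
  then show ?thesis using is_linearD(1)[OF assms(2)] assms(3)
    by (simp add: minus_one_smult L.minus_one_smult)
qed

lemma linear_diff:
  assumes "rmodule R L" "is_linear R M L f" "x \<in> carrier M" "y \<in> carrier M"
  shows "f (x \<ominus>\<^bsub>M\<^esub> y) = f x \<ominus>\<^bsub>L\<^esub> f y"
  using assms by (simp add: a_minus_def is_linearD(2) linear_minus)

lemma linear_image_sub:
  assumes "rmodule R L" "is_linear R M L f" "is_sub R M W"
  shows "is_sub R L (f ` W)"
proof
  note W = is_subD[OF assms(3)] and f = is_linearD[OF assms(2)]
  show "f ` W \<subseteq> carrier L" using W f by auto
  show "\<zero>\<^bsub>L\<^esub> \<in> f ` W" using linear_zero[OF assms(1,2)] W(2) by (metis imageI)
  show "x \<oplus>\<^bsub>L\<^esub> y \<in> f ` W" if "x \<in> f ` W" "y \<in> f ` W" for x y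
    using that
  proof (elim imageE)
    fix u v assume "x = f u" "y = f v" "u \<in> W" "v \<in> W"
    then show ?thesis using f(2)[of u v] W(3)[of u v] W(5)[of u] W(5)[of v]
      by (intro image_eqI[of _ _ "u \<oplus>\<^bsub>M\<^esub> v"]) auto
  qed
  show "a \<odot>\<^bsub>L\<^esub> x \<in> f ` W" if "a \<in> carrier R" "x \<in> f ` W" for a x
    using that(2)
  proof (elim imageE)
    fix u assume "x = f u" "u \<in> W"
    then show ?thesis using that f(3)[of a u] W(4)[of a u] W(5)[of u]
      by (intro image_eqI[of _ _ "a \<odot>\<^bsub>M\<^esub> u"]) auto
  qed
qed

lemma linear_vimage_sub:
  assumes "rmodule R L" "is_linear R M L f" "is_sub R L W"
  shows "is_sub R M {x \<in> carrier M. f x \<in> W}"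
  using linear_zero[OF assms(1,2)]
  by (intro is_subI) (auto simp: is_linearD[OF assms(2)] is_subD[OF assms(3)])

lemma ker_sub:
  assumes "rmodule R L" "is_linear R M L f"
  shows "is_sub R M (ker_of M L f)"
  using linear_vimage_sub[OF assms rmodule.sub_zero[OF assms(1)]] by (simp add: ker_of_def)

lemma linear_ext_on_lspan:
  assumes "rmodule R L" "is_linear R M L f" "is_linear R M L g" "A \<subseteq> carrier M"
    and "\<And>a. a \<in> A \<Longrightarrow> f a = g a" "x \<in> lspan R M A"
  shows "f x = g x"
proof -
  have "x \<in> carrier M \<and> f x = g x"
    using assms(6)
  proof (induction rule: lspan.induct)
    case lspan_zero
    show ?case using linear_zero[OF assms(1,2)] linear_zero[OF assms(1,3)] by simp
  next
    case (lspan_base a)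
    then show ?case using assms(4,5) by auto
  qed (auto simp: is_linearD[OF assms(2)] is_linearD[OF assms(3)])
  then show ?thesis by simp
qed

end

lemma module_iff_rmodule: "module R N \<longleftrightarrow> cring R \<and> rmodule R N"
proof
  assume "module R N"
  then show "cring R \<and> rmodule R N" using rmodule_of_module module.axioms(1) by blast
next
  assume R: "cring R \<and> rmodule R N"
  then interpret cring R by simp
  interpret N: rmodule R N using R by simp
  show "module R N"
    by (intro moduleI)
      (use R N.M.abelian_group_axioms N.smult_assoc[symmetric] m_comm in
        \<open>auto simp: N.smult_l_distr N.smult_r_distr\<close>)
qed

lemma rmodule_mono:
  assumes "rmodule S N" "ring_extension R S"
  shows "rmodule R N"
proof -
  interpret N: rmodule S N by fact
  interpret S: cring S using assms(2) by (simp add: ring_extension_def)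
  have R: "subring (carrier R) S" "R = S\<lparr>carrier := carrier R\<rparr>"
    using assms(2) by (auto simp: ring_extension_def)
  then have "ring R" using ring.subring_is_ring[OF N.R.ring_axioms] by metis
  have sub: "carrier R \<subseteq> carrier S" using R(1) subringE(1) by blast
  have ops: "ring.add R = ring.add S" "monoid.mult R = monoid.mult S" "one R = one S" by (subst R(2), simp)+
  show ?thesis
    using \<open>ring R\<close> N.M.abelian_group_axioms sub
    by (intro rmodule.intro right_module.intro right_module_axioms.intro)
      (auto simp: ops N.smult_l_distr N.smult_r_distr subset_eq intro: N.smult_assoc)
qed

section \<open>Maps factoring through sums of copies of a module\<close>

text \<open>
  \<open>factors_through \<Lambda> M N L h\<close> says that \<open>h\<close> is a finite sum of composites \<open>N \<rightarrow> M \<rightarrow> L\<close>; thus \<open>N\<close> lies in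
  \<open>add M\<close> iff its identity map factors_through.
\<close>
inductive factors_through ::
  "('a, 'c) ring_scheme \<Rightarrow> ('a, 'm) module \<Rightarrow> ('a, 'n) module \<Rightarrow> ('a, 'l) module \<Rightarrow> ('n \<Rightarrow> 'l) \<Rightarrow> bool"
  for \<Lambda> M N L where
  through_zero: "(\<forall>x \<in> carrier N. h x = \<zero>\<^bsub>L\<^esub>) \<Longrightarrow> factors_through \<Lambda> M N L h"
| through_step: "\<lbrakk>factors_through \<Lambda> M N L h; is_linear \<Lambda> N M f; is_linear \<Lambda> M L g;
     \<forall>x \<in> carrier N. h' x = h x \<oplus>\<^bsub>L\<^esub> g (f x)\<rbrakk> \<Longrightarrow> factors_through \<Lambda> M N L h'"

abbreviation in_add :: "('a, 'c) ring_scheme \<Rightarrow> ('a, 'm) module \<Rightarrow> ('a, 'n) module \<Rightarrow> bool" where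
  "in_add \<Lambda> M N \<equiv> factors_through \<Lambda> M N N (\<lambda>x. x)"

lemma through_cong:
  "factors_through \<Lambda> M N L h \<Longrightarrow> (\<And>x. x \<in> carrier N \<Longrightarrow> h' x = h x) \<Longrightarrow> factors_through \<Lambda> M N L h'"
  by (erule factors_through.cases) (auto intro: through_zero through_step)

lemma through_linear:
  assumes "rmodule \<Lambda> N" "rmodule \<Lambda> L" "factors_through \<Lambda> M N L h"
  shows "is_linear \<Lambda> N L h"
proof -
  interpret N: rmodule \<Lambda> N by fact
  interpret L: rmodule \<Lambda> L by fact
  show ?thesis
    using assms(3)
  proof (induction rule: factors_through.induct)
    case (through_zero h)
    then show ?case by (intro is_linearI) auto
  next
    case (through_step h f g h')
    note h = is_linearD[OF through_step.IH] and fg = is_linearD[OF is_linear_comp[OF through_step(2,3)]]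
    show ?case
      by (rule is_linearI)
        (auto simp: through_step(4) h fg L.M.a_ac L.smult_r_distr)
  qed
qed

lemma through_closed:
  "rmodule \<Lambda> N \<Longrightarrow> rmodule \<Lambda> L \<Longrightarrow> factors_through \<Lambda> M N L h \<Longrightarrow> x \<in> carrier N \<Longrightarrow> h x \<in> carrier L"
  using through_linear is_linearD(1) by metis

lemma through_single:
  assumes "rmodule \<Lambda> L" "is_linear \<Lambda> N M f" "is_linear \<Lambda> M L g"
  shows "factors_through \<Lambda> M N L (\<lambda>x. g (f x))"
proof -
  interpret L: rmodule \<Lambda> L by fact
  show ?thesis
    by (rule through_step[OF through_zero[of N "\<lambda>_. \<zero>\<^bsub>L\<^esub>"] assms(2,3)])
      (auto simp: is_linearD[OF assms(2)] is_linearD[OF assms(3)])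
qed

lemma through_plus:
  assumes "rmodule \<Lambda> N" "rmodule \<Lambda> L" "factors_through \<Lambda> M N L h" "factors_through \<Lambda> M N L k"
  shows "factors_through \<Lambda> M N L (\<lambda>x. h x \<oplus>\<^bsub>L\<^esub> k x)"
  using assms(4)
proof (induction rule: factors_through.induct)
  case (through_zero k)
  interpret L: rmodule \<Lambda> L by fact
  show ?case by (rule through_cong[OF assms(3)]) (auto simp: through_zero through_closed[OF assms(1-3)])
next
  case (through_step k f g k')
  interpret L: rmodule \<Lambda> L by fact
  show ?case
    by (rule factors_through.through_step[OF through_step.IH through_step(2,3)])
      (auto simp: through_step(4) through_closed[OF assms(1-3)] through_closed[OF assms(1,2) through_step(1)]
        is_linearD(1)[OF through_step(2)] is_linearD(1)[OF through_step(3)] L.M.a_assoc)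
qed

lemma through_pre:
  assumes "factors_through \<Lambda> M N L h" "is_linear \<Lambda> K N p"
  shows "factors_through \<Lambda> M K L (\<lambda>x. h (p x))"
  using assms(1)
proof (induction rule: factors_through.induct)
  case (through_zero h)
  then show ?case using is_linearD(1)[OF assms(2)] by (auto intro: factors_through.through_zero)
next
  case (through_step h f g h')
  show ?case
    by (rule factors_through.through_step[OF through_step.IH is_linear_comp[OF assms(2) through_step(2)] through_step(3)])
      (auto simp: through_step(4) is_linearD(1)[OF assms(2)])
qed

lemma through_post:
  assumes "rmodule \<Lambda> N" "rmodule \<Lambda> L" "rmodule \<Lambda> K" "factors_through \<Lambda> M N L h" "is_linear \<Lambda> L K p"
  shows "factors_through \<Lambda> M N K (\<lambda>x. p (h x))"
  using assms(4)
proof (induction rule: factors_through.induct)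
  case (through_zero h)
  then show ?case using rmodule.linear_zero[OF assms(2,3,5)] by (auto intro: factors_through.through_zero)
next
  case (through_step h f g h')
  show ?case
    by (rule factors_through.through_step[OF through_step.IH through_step(2) is_linear_comp[OF through_step(3) assms(5)]])
      (auto simp: through_step(4) is_linearD(2)[OF assms(5)] through_closed[OF assms(1,2) through_step(1)]
        is_linearD(1)[OF through_step(2)] is_linearD(1)[OF through_step(3)])
qed

text \<open>In a composite N -> K -> L the identity of \<open>K\<close> can be inserted as a sum of
  maps through \<open>M\<close>. For \<open>h\<close> the identity this is transitivity of
  \<open>in_add\<close>.\<close>

lemma through_trans:
  assumes "rmodule \<Lambda> N" "rmodule \<Lambda> L" "rmodule \<Lambda> K" "factors_through \<Lambda> K N L h" "in_add \<Lambda> M K"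
  shows "factors_through \<Lambda> M N L h"
  using assms(4)
proof (induction rule: factors_through.induct)
  case (through_zero h)
  then show ?case by (rule factors_through.through_zero)
next
  case (through_step h f g h')
  have "factors_through \<Lambda> M N L (\<lambda>x. g (f x))"
    by (rule through_post[OF assms(1,3,2) through_pre[OF assms(5) through_step(2)] through_step(3)])
  from through_plus[OF assms(1,2) through_step.IH this] show ?case
    by (rule through_cong) (use through_step(4) in auto)
qed

text \<open>A section and a retraction are enough, without a complement. Most memberships in add M
  below are obtained this way.\<close>

lemma in_add_retract:
  assumes "rmodule \<Lambda> N" "rmodule \<Lambda> K" "in_add \<Lambda> M K" "is_linear \<Lambda> N K f" "is_linear \<Lambda> K N g"
    "\<And>x. x \<in> carrier N \<Longrightarrow> g (f x) = x"
  shows "in_add \<Lambda> M N"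
  by (rule through_cong[OF through_post[OF assms(1,2,1) through_pre[OF assms(3,4)] assms(5)]])
    (simp add: assms(6))

lemma through_mono:
  assumes "factors_through \<Lambda> M N L h" "carrier \<Lambda>' \<subseteq> carrier \<Lambda>"
  shows "factors_through \<Lambda>' M N L h"
  using assms(1)
  by induction (auto intro: through_zero through_step is_linear_mono[OF _ assms(2)])

text \<open>Every element of \<open>N\<close> is a sum of terms g (f x), so \<open>N\<close> is
  generated by the images of generators of \<open>M\<close> under the finitely many maps g.\<close>

lemma in_add_fin_gen:
  assumes "rmodule \<Lambda> M" "rmodule \<Lambda> N" "in_add \<Lambda> M N" "fin_gen \<Lambda> M"
  shows "fin_gen \<Lambda> N"
proof -
  interpret M: rmodule \<Lambda> M by fact
  interpret N: rmodule \<Lambda> N by fact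
  obtain B where B: "finite B" "B \<subseteq> carrier M" "carrier M \<subseteq> lspan \<Lambda> M B"
    using assms(4) M.fin_gen_iff_lspan by blast
  have "\<exists>A. finite A \<and> A \<subseteq> carrier N \<and> h ` carrier N \<subseteq> lspan \<Lambda> N A" if "factors_through \<Lambda> M N N h" for h
    using that
  proof (induction rule: factors_through.induct)
    case (through_zero h)
    then show ?case by (intro exI[of _ "{}"]) (auto intro: lspan_zero)
  next
    case (through_step h f g h')
    then obtain A where A: "finite A" "A \<subseteq> carrier N" "h ` carrier N \<subseteq> lspan \<Lambda> N A" by blast
    let ?A = "A \<union> g ` B"
    have A': "?A \<subseteq> carrier N" using A(2) B(2) is_linearD(1)[OF through_step(3)] by auto
    note S = N.lspan_sub[OF A']
    have 1: "lspan \<Lambda> N A \<subseteq> lspan \<Lambda> N ?A"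
      by (rule N.lspan_subset[OF S]) (auto intro: lspan_base)
    have "lspan \<Lambda> M B \<subseteq> {x \<in> carrier M. g x \<in> lspan \<Lambda> N ?A}"
      by (rule M.lspan_subset[OF M.linear_vimage_sub[OF assms(2) through_step(3) S]])
        (use B(2) in \<open>auto intro: lspan_base\<close>)
    then have 2: "g x \<in> lspan \<Lambda> N ?A" if "x \<in> carrier M" for x using that B(3) by blast
    have "h' x \<in> lspan \<Lambda> N ?A" if "x \<in> carrier N" for x
      using through_step(4) that A(3) 1 2[OF is_linearD(1)[OF through_step(2) that]]
      by (auto intro!: lspan_add)
    then show ?case using A(1) B(1) A' by (intro exI[of _ ?A]) auto
  qed
  from this[OF assms(3)] show ?thesis using N.fin_gen_iff_lspan by auto
qed

section \<open>Noetherian modules\<close>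

definition noeth :: "('a, 'c) ring_scheme \<Rightarrow> ('a, 'm) module \<Rightarrow> bool" where
  "noeth \<Lambda> N \<longleftrightarrow> (\<forall>W. is_sub \<Lambda> N W \<longrightarrow> (\<exists>A. finite A \<and> A \<subseteq> W \<and> W \<subseteq> lspan \<Lambda> N A))"

text \<open>Over a commutative ring the submodules of this right module are the ideals, and it
  agrees with \<open>regular_module\<close> up to the order of the factors.\<close>

definition right_regular :: "('a, 'c) ring_scheme \<Rightarrow> ('a, 'a) module" where
  "right_regular \<Lambda> = \<lparr>carrier = carrier \<Lambda>, monoid.mult = undefined, one = undefined,
     ring.zero = \<zero>\<^bsub>\<Lambda>\<^esub>, ring.add = add \<Lambda>, smult = (\<lambda>a x. x \<otimes>\<^bsub>\<Lambda>\<^esub> a)\<rparr>"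

lemma right_regular_simps [simp]:
  "carrier (right_regular \<Lambda>) = carrier \<Lambda>" "ring.zero (right_regular \<Lambda>) = \<zero>\<^bsub>\<Lambda>\<^esub>"
  "add (right_regular \<Lambda>) = add \<Lambda>" "smult (right_regular \<Lambda>) a x = x \<otimes>\<^bsub>\<Lambda>\<^esub> a"
  by (simp_all add: right_regular_def)

lemma abelian_group_ops_cong:
  assumes "abelian_group A" "carrier B = carrier A" "ring.zero B = ring.zero A" "add B = add A"
  shows "abelian_group B"
proof -
  interpret abelian_group A by fact
  show ?thesis
    by (intro abelian_groupI) (auto simp: assms(2-4) a_ac intro: bexI[of _ "\<ominus>\<^bsub>A\<^esub> _"] l_neg)
qed

lemma rmodule_right_regular:
  assumes "ring \<Lambda>"
  shows "rmodule \<Lambda> (right_regular \<Lambda>)"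
proof -
  interpret ring \<Lambda> by fact
  show ?thesis
    by (intro rmodule.intro right_module.intro right_module_axioms.intro assms
        abelian_group_ops_cong[OF abelian_group_axioms])
      (auto simp: r_distr l_distr m_assoc)
qed

lemma lspan_carrier_update: "lspan \<Lambda> (N\<lparr>carrier := W\<rparr>) A = lspan \<Lambda> N A"
proof -
  have "x \<in> lspan \<Lambda> N A" if "x \<in> lspan \<Lambda> (N\<lparr>carrier := W\<rparr>) A" for x
    using that by induction (auto intro: lspan.intros)
  moreover have "x \<in> lspan \<Lambda> (N\<lparr>carrier := W\<rparr>) A" if "x \<in> lspan \<Lambda> N A" for x
    using that lspan.intros[where \<Lambda> = \<Lambda> and N = "N\<lparr>carrier := W\<rparr>" and A = A] by induction auto
  ultimately show ?thesis by blast
qed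

lemma is_sub_carrier_update:
  "is_sub \<Lambda> (N\<lparr>carrier := W\<rparr>) V \<Longrightarrow> W \<subseteq> carrier N \<Longrightarrow> is_sub \<Lambda> N V"
  by (auto simp: is_sub_def)

lemma noeth_sub:
  assumes "noeth \<Lambda> N" "is_sub \<Lambda> N W"
  shows "noeth \<Lambda> (N\<lparr>carrier := W\<rparr>)"
  unfolding noeth_def lspan_carrier_update
proof (intro allI impI)
  fix V assume "is_sub \<Lambda> (N\<lparr>carrier := W\<rparr>) V"
  then have "is_sub \<Lambda> N V" by (rule is_sub_carrier_update[OF _ is_subD(1)[OF assms(2)]])
  then show "\<exists>A. finite A \<and> A \<subseteq> V \<and> V \<subseteq> lspan \<Lambda> N A" using assms(1) unfolding noeth_def by simp
qed

lemma (in rmodule) noeth_fin_gen: "noeth R M \<Longrightarrow> fin_gen R M"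
  unfolding noeth_def fin_gen_iff_lspan using sub_carrier by blast

lemma noeth_imp_fin_gen_sub:
  assumes "rmodule \<Lambda> N" "noeth \<Lambda> N" "is_sub \<Lambda> N W"
  shows "fin_gen \<Lambda> (N\<lparr>carrier := W\<rparr>)"
  using rmodule.noeth_fin_gen[OF rmodule.rmodule_sub noeth_sub] assms by blast

text \<open>The union of a chain is a submodule, hence finitely generated, and its finitely many
  generators already lie in one member. So chains are bounded and Zorn's lemma applies.\<close>

lemma noeth_maximal:
  assumes "noeth \<Lambda> N" "C \<noteq> {}" "\<And>W. W \<in> C \<Longrightarrow> is_sub \<Lambda> N W"
  shows "\<exists>W \<in> C. \<forall>V \<in> C. W \<subseteq> V \<longrightarrow> V = W"
proof (rule subset_Zorn_nonempty[OF assms(2)])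
  fix D assume D: "D \<noteq> {}" "subset.chain C D"
  then have DC: "D \<subseteq> C" and tot: "\<And>U Y. U \<in> D \<Longrightarrow> Y \<in> D \<Longrightarrow> U \<subseteq> Y \<or> Y \<subseteq> U"
    by (auto simp: subset_chain_def)
  have D_sub: "is_sub \<Lambda> N W" if "W \<in> D" for W using that DC assms(3) by blast
  have "is_sub \<Lambda> N (\<Union>D)"
  proof
    show "\<Union>D \<subseteq> carrier N" by (rule Union_least) (rule is_subD(1)[OF D_sub])
    show "\<zero>\<^bsub>N\<^esub> \<in> \<Union>D" using D(1) is_subD(2)[OF D_sub] by blast
    show "x \<oplus>\<^bsub>N\<^esub> y \<in> \<Union>D" if xy: "x \<in> \<Union>D" "y \<in> \<Union>D" for x y
    proof -
      obtain U Y where UY: "U \<in> D" "Y \<in> D" "x \<in> U" "y \<in> Y" using xy by blast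
      then show ?thesis using tot[OF UY(1,2)] is_subD(3)[OF D_sub[OF UY(1)]] is_subD(3)[OF D_sub[OF UY(2)]]
        by blast
    qed
    show "a \<odot>\<^bsub>N\<^esub> x \<in> \<Union>D" if "a \<in> carrier \<Lambda>" "x \<in> \<Union>D" for a x
    proof -
      obtain U where U: "U \<in> D" "x \<in> U" using \<open>x \<in> \<Union>D\<close> by blast
      have "a \<odot>\<^bsub>N\<^esub> x \<in> U" by (rule is_subD(4)[OF D_sub[OF U(1)] that(1) U(2)])
      then show ?thesis using U(1) by blast
    qed
  qed
  then obtain A where A: "finite A" "A \<subseteq> \<Union>D" "\<Union>D \<subseteq> lspan \<Lambda> N A"
    using assms(1) unfolding noeth_def by blast
  obtain W where W: "W \<in> D" "A \<subseteq> W"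
    using finite_subset_Union_chain[OF A(1,2) D(1)] D(2) by blast
  have "x \<in> W" if "x \<in> lspan \<Lambda> N A" for x
    using that by induction (use W is_subD[OF D_sub[OF W(1)]] in auto)
  then have "\<Union>D = W" using A(3) W(1) by blast
  then show "\<Union>D \<in> C" using W(1) DC by blast
qed

text \<open>Induction on the generators of \<open>N\<close>. Elements of \<open>W\<close> realising
  generators of the right ideal of \<open>a\<close>-coefficients, together with generators of
  \<open>W\<close> cut with the span of the remaining generators, generate \<open>W\<close>.\<close>

lemma noeth_of_fin_gen:
  assumes "noeth \<Lambda> (right_regular \<Lambda>)" "rmodule \<Lambda> N" "fin_gen \<Lambda> N"
  shows "noeth \<Lambda> N"
proof -
  interpret N: rmodule \<Lambda> N by fact
  interpret L: rmodule \<Lambda> "right_regular \<Lambda>" by (rule rmodule_right_regular) (rule N.R.ring_axioms)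
  have *: "\<exists>B. finite B \<and> B \<subseteq> W \<and> W \<subseteq> lspan \<Lambda> N B"
    if "finite A" "A \<subseteq> carrier N" "is_sub \<Lambda> N W" "W \<subseteq> lspan \<Lambda> N A" for A W
    using that
  proof (induction A arbitrary: W)
    case empty
    then have "W \<subseteq> {\<zero>\<^bsub>N\<^esub>}" using N.lspan_subset[OF N.sub_zero, of "{}"] by blast
    then show ?case by (intro exI[of _ "{}"]) (auto intro: lspan_zero)
  next
    case (insert a A)
    note W = is_subD[OF insert.prems(2)]
    have a: "a \<in> carrier N" and A: "A \<subseteq> carrier N" using insert.prems by auto
    note SA = N.lspan_sub[OF A]
    \<comment> \<open>The right ideal of all coefficients with which \<open>a\<close> occurs in
      elements of \<open>W\<close>, modulo the span of the other generators.\<close>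
    let ?J = "{r \<in> carrier \<Lambda>. \<exists>w \<in> W. w \<ominus>\<^bsub>N\<^esub> r \<odot>\<^bsub>N\<^esub> a \<in> lspan \<Lambda> N A}"
    have add_eq: "(w \<oplus>\<^bsub>N\<^esub> w') \<ominus>\<^bsub>N\<^esub> (r \<oplus>\<^bsub>\<Lambda>\<^esub> r') \<odot>\<^bsub>N\<^esub> a
        = (w \<ominus>\<^bsub>N\<^esub> r \<odot>\<^bsub>N\<^esub> a) \<oplus>\<^bsub>N\<^esub> (w' \<ominus>\<^bsub>N\<^esub> r' \<odot>\<^bsub>N\<^esub> a)"
      if "w \<in> W" "w' \<in> W" "r \<in> carrier \<Lambda>" "r' \<in> carrier \<Lambda>" for w w' r r'
      using that W(5) a by (simp add: N.M.minus_eq N.smult_l_distr N.M.minus_add N.M.a_ac)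
    have smult_eq: "(c \<odot>\<^bsub>N\<^esub> w) \<ominus>\<^bsub>N\<^esub> (r \<otimes>\<^bsub>\<Lambda>\<^esub> c) \<odot>\<^bsub>N\<^esub> a = c \<odot>\<^bsub>N\<^esub> (w \<ominus>\<^bsub>N\<^esub> r \<odot>\<^bsub>N\<^esub> a)"
      if "w \<in> W" "r \<in> carrier \<Lambda>" "c \<in> carrier \<Lambda>" for w r c
      using that W(5) a by (simp add: N.smult_r_diff N.smult_assoc)
    have J: "is_sub \<Lambda> (right_regular \<Lambda>) ?J"
    proof
      show "\<zero>\<^bsub>right_regular \<Lambda>\<^esub> \<in> ?J"
        using W(2) a N.sub_minus[OF SA lspan_zero] by (auto intro!: bexI[of _ "\<zero>\<^bsub>N\<^esub>"] simp: N.M.minus_eq)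
    next
      fix r r' assume "r \<in> ?J" "r' \<in> ?J"
      then obtain w w' where "r \<in> carrier \<Lambda>" "w \<in> W" "w \<ominus>\<^bsub>N\<^esub> r \<odot>\<^bsub>N\<^esub> a \<in> lspan \<Lambda> N A"
        "r' \<in> carrier \<Lambda>" "w' \<in> W" "w' \<ominus>\<^bsub>N\<^esub> r' \<odot>\<^bsub>N\<^esub> a \<in> lspan \<Lambda> N A" by blast
      then show "r \<oplus>\<^bsub>right_regular \<Lambda>\<^esub> r' \<in> ?J"
        using W(3) by (auto intro!: bexI[of _ "w \<oplus>\<^bsub>N\<^esub> w'"] lspan_add simp: add_eq)
    next
      fix c r assume c: "c \<in> carrier \<Lambda>" and "r \<in> ?J"
      then obtain w where "r \<in> carrier \<Lambda>" "w \<in> W" "w \<ominus>\<^bsub>N\<^esub> r \<odot>\<^bsub>N\<^esub> a \<in> lspan \<Lambda> N A" by blast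
      then show "c \<odot>\<^bsub>right_regular \<Lambda>\<^esub> r \<in> ?J"
        using W(4) c by (auto intro!: bexI[of _ "c \<odot>\<^bsub>N\<^esub> w"] lspan_smult simp: smult_eq)
    qed auto
    then have "\<exists>T. finite T \<and> T \<subseteq> ?J \<and> ?J \<subseteq> lspan \<Lambda> (right_regular \<Lambda>) T"
      by (rule assms(1)[unfolded noeth_def, rule_format])
    then obtain T where T: "finite T" "T \<subseteq> ?J" "?J \<subseteq> lspan \<Lambda> (right_regular \<Lambda>) T"
      by (elim exE conjE)
    from T(2) have "\<forall>r \<in> T. \<exists>w. w \<in> W \<and> w \<ominus>\<^bsub>N\<^esub> r \<odot>\<^bsub>N\<^esub> a \<in> lspan \<Lambda> N A" by blast
    then obtain w where w: "\<And>r. r \<in> T \<Longrightarrow> w r \<in> W" "\<And>r. r \<in> T \<Longrightarrow> w r \<ominus>\<^bsub>N\<^esub> r \<odot>\<^bsub>N\<^esub> a \<in> lspan \<Lambda> N A"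
      by metis
    have wW: "w ` T \<subseteq> W" using w by blast
    have lsW: "lspan \<Lambda> N (w ` T) \<subseteq> W" by (rule N.lspan_subset[OF insert.prems(2) wW])
    have lift: "\<exists>v \<in> lspan \<Lambda> N (w ` T). v \<ominus>\<^bsub>N\<^esub> r \<odot>\<^bsub>N\<^esub> a \<in> lspan \<Lambda> N A" and rc: "r \<in> carrier \<Lambda>"
      if "r \<in> lspan \<Lambda> (right_regular \<Lambda>) T" for r
    proof -
      have "r \<in> carrier \<Lambda> \<and> (\<exists>v \<in> lspan \<Lambda> N (w ` T). v \<ominus>\<^bsub>N\<^esub> r \<odot>\<^bsub>N\<^esub> a \<in> lspan \<Lambda> N A)"
        using that
      proof (induction rule: lspan.induct)
        case lspan_zero
        then show ?case using a N.sub_minus[OF SA lspan.lspan_zero]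
          by (auto intro!: bexI[of _ "\<zero>\<^bsub>N\<^esub>"] simp: N.M.minus_eq lspan.lspan_zero)
      next
        case (lspan_base r)
        then show ?case using w T(2) by (auto intro!: bexI[of _ "w r"] intro: lspan.lspan_base)
      next
        case (lspan_add r r')
        then obtain v v' where v: "v \<in> lspan \<Lambda> N (w ` T)" "v \<ominus>\<^bsub>N\<^esub> r \<odot>\<^bsub>N\<^esub> a \<in> lspan \<Lambda> N A"
          "v' \<in> lspan \<Lambda> N (w ` T)" "v' \<ominus>\<^bsub>N\<^esub> r' \<odot>\<^bsub>N\<^esub> a \<in> lspan \<Lambda> N A" by blast
        have r: "r \<in> carrier \<Lambda>" "r' \<in> carrier \<Lambda>" using lspan_add.IH by auto
        have "v \<in> W" "v' \<in> W" using v lsW by auto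
        from add_eq[OF this r] show ?case
          using lspan.lspan_add[OF v(2,4)] lspan.lspan_add[OF v(1,3)] r
          by (auto intro!: bexI[of _ "v \<oplus>\<^bsub>N\<^esub> v'"])
      next
        case (lspan_smult c r)
        then obtain v where v: "v \<in> lspan \<Lambda> N (w ` T)" "v \<ominus>\<^bsub>N\<^esub> r \<odot>\<^bsub>N\<^esub> a \<in> lspan \<Lambda> N A" by blast
        have r: "r \<in> carrier \<Lambda>" using lspan_smult.IH by auto
        have "v \<in> W" using v lsW by auto
        from smult_eq[OF this r lspan_smult(1)] show ?case
          using lspan.lspan_smult[OF lspan_smult(1) v(2)] lspan.lspan_smult[OF lspan_smult(1) v(1)] r lspan_smult(1)
          by (auto intro!: bexI[of _ "c \<odot>\<^bsub>N\<^esub> v"])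
      qed
      then show "r \<in> carrier \<Lambda>" "\<exists>v \<in> lspan \<Lambda> N (w ` T). v \<ominus>\<^bsub>N\<^esub> r \<odot>\<^bsub>N\<^esub> a \<in> lspan \<Lambda> N A" by auto
    qed
    have WA: "is_sub \<Lambda> N (W \<inter> lspan \<Lambda> N A)"
      using insert.prems(2) SA unfolding is_sub_def by blast
    obtain B where B: "finite B" "B \<subseteq> W \<inter> lspan \<Lambda> N A" "W \<inter> lspan \<Lambda> N A \<subseteq> lspan \<Lambda> N B"
      using insert.IH[OF A WA] by blast
    let ?B = "w ` T \<union> B"
    have B': "?B \<subseteq> W" using wW B(2) by blast
    have S: "is_sub \<Lambda> N (lspan \<Lambda> N ?B)" by (rule N.lspan_sub) (use B' W(1) in blast)
    have mono: "lspan \<Lambda> N (w ` T) \<subseteq> lspan \<Lambda> N ?B" "lspan \<Lambda> N B \<subseteq> lspan \<Lambda> N ?B"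
      by (rule N.lspan_subset[OF S]; auto intro: lspan_base)+
    have "x \<in> lspan \<Lambda> N ?B" if x: "x \<in> W" for x
    proof -
      have xin: "x \<in> lspan \<Lambda> N (insert a A)" using x insert.prems(3) by blast
      obtain c y where cy: "c \<in> carrier \<Lambda>" "y \<in> lspan \<Lambda> N A" "x = c \<odot>\<^bsub>N\<^esub> a \<oplus>\<^bsub>N\<^esub> y"
        using N.lspan_insertE[OF xin a A] by metis
      have yc: "y \<in> carrier N" using cy(2) is_subD(5)[OF SA] by blast
      have xy: "x \<ominus>\<^bsub>N\<^esub> c \<odot>\<^bsub>N\<^esub> a = y"
        using cy yc a by (simp add: N.M.minus_eq N.M.a_ac N.M.r_neg1 N.M.r_neg2 N.M.r_neg)
      have "c \<in> ?J" using x cy(1,2) xy by (auto intro!: bexI[of _ x])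
      then obtain v where v: "v \<in> lspan \<Lambda> N (w ` T)" "v \<ominus>\<^bsub>N\<^esub> c \<odot>\<^bsub>N\<^esub> a \<in> lspan \<Lambda> N A"
        using lift T(3) by blast
      have vW: "v \<in> W" using v(1) lsW by blast
      \<comment> \<open>Both \<open>x\<close> and \<open>v\<close> have \<open>a\<close>-coefficient
        \<open>c\<close>, so their difference lies in \<open>W\<close> and in the span of
        \<open>A\<close>, where \<open>B\<close> generates.\<close>
      have "x \<ominus>\<^bsub>N\<^esub> v = (x \<ominus>\<^bsub>N\<^esub> c \<odot>\<^bsub>N\<^esub> a) \<ominus>\<^bsub>N\<^esub> (v \<ominus>\<^bsub>N\<^esub> c \<odot>\<^bsub>N\<^esub> a)"
        using W(5)[OF x] W(5)[OF vW] cy(1) a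
        by (simp add: N.M.minus_eq N.M.minus_add N.M.a_ac N.M.r_neg1 N.M.r_neg2 N.M.r_neg)
      then have "x \<ominus>\<^bsub>N\<^esub> v \<in> W \<inter> lspan \<Lambda> N A"
        using N.sub_diff[OF SA cy(2) v(2)] N.sub_diff[OF insert.prems(2) x vW] xy by simp
      then have "x \<ominus>\<^bsub>N\<^esub> v \<in> lspan \<Lambda> N ?B" using B(3) mono(2) by blast
      moreover have "v \<in> lspan \<Lambda> N ?B" using v(1) mono(1) by blast
      ultimately have "(x \<ominus>\<^bsub>N\<^esub> v) \<oplus>\<^bsub>N\<^esub> v \<in> lspan \<Lambda> N ?B" by (rule lspan_add)
      then show ?thesis using W(5)[OF x] W(5)[OF vW] by (simp add: N.M.minus_eq N.M.a_assoc N.M.l_neg)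
    qed
    then show ?case using B' B(1) T(1) by (intro exI[of _ ?B]) auto
  qed
  obtain A where A: "finite A" "A \<subseteq> carrier N" "carrier N \<subseteq> lspan \<Lambda> N A"
    using assms(3) N.fin_gen_iff_lspan by blast
  show ?thesis unfolding noeth_def using *[OF A(1,2)] A(3) is_subD(1)
    by (metis subset_trans)
qed

lemma (in cring) sub_right_regular_iff: "is_sub R (right_regular R) I \<longleftrightarrow> ideal I R"
proof
  interpret L: rmodule R "right_regular R" by (rule rmodule_right_regular) (rule ring_axioms)
  assume I: "is_sub R (right_regular R) I"
  note D = is_subD[OF I, simplified]
  show "ideal I R"
  proof (rule idealI[OF ring_axioms])
    have "\<ominus> a \<in> I" if "a \<in> I" for a
      using D(4)[of "\<ominus> \<one>" a] D(5)[OF that] that by (simp add: r_minus)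
    then show "subgroup I (add_monoid R)"
      using D by (intro add.subgroupI) (auto simp: a_inv_def[symmetric])
    show ax: "a \<otimes> x \<in> I" if "a \<in> I" "x \<in> carrier R" for a x using D(4)[OF that(2,1)] .
    show "x \<otimes> a \<in> I" if "a \<in> I" "x \<in> carrier R" for a x
      using ax[OF that] m_comm[OF D(5)[OF that(1)] that(2)] by simp
  qed
next
  assume "ideal I R"
  then interpret ideal I R .
  show "is_sub R (right_regular R) I"
    by (rule is_subI) (auto simp: I_r_closed)
qed

lemma noeth_right_regular:
  assumes "noetherian_ring R" "cring R"
  shows "noeth R (right_regular R)"
proof -
  interpret cring R by fact
  interpret noetherian_ring R by fact
  interpret L: rmodule R "right_regular R" by (rule rmodule_right_regular) (rule ring_axioms)
  show ?thesis
    unfolding noeth_def sub_right_regular_iff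
  proof (intro allI impI)
    fix I assume "ideal I R"
    then obtain A where A: "A \<subseteq> carrier R" "finite A" "I = Idl\<^bsub>R\<^esub> A" using finetely_gen by blast
    have "is_sub R (right_regular R) (lspan R (right_regular R) A)" by (rule L.lspan_sub) (use A in simp)
    then have "Idl\<^bsub>R\<^esub> A \<subseteq> lspan R (right_regular R) A"
      by (intro genideal_minimal) (auto simp: sub_right_regular_iff intro: lspan_base)
    then show "\<exists>A. finite A \<and> A \<subseteq> I \<and> I \<subseteq> lspan R (right_regular R) A"
      using A genideal_self[OF A(1)] by (intro exI[of _ A]) simp
  qed
qed

section \<open>Powers and transport of structure\<close>

definition pow_module :: "('a, 'm) module \<Rightarrow> nat \<Rightarrow> ('a, nat \<Rightarrow> 'm) module" where
  "pow_module N b = \<lparr>carrier = {..<b} \<rightarrow>\<^sub>E carrier N, monoid.mult = undefined, one = undefined,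
     ring.zero = (\<lambda>i\<in>{..<b}. \<zero>\<^bsub>N\<^esub>), ring.add = (\<lambda>x y. \<lambda>i\<in>{..<b}. x i \<oplus>\<^bsub>N\<^esub> y i),
     smult = (\<lambda>a x. \<lambda>i\<in>{..<b}. a \<odot>\<^bsub>N\<^esub> x i)\<rparr>"

lemma pow_module_simps [simp]:
  "carrier (pow_module N b) = {..<b} \<rightarrow>\<^sub>E carrier N"
  "\<zero>\<^bsub>pow_module N b\<^esub> = (\<lambda>i\<in>{..<b}. \<zero>\<^bsub>N\<^esub>)"
  "x \<oplus>\<^bsub>pow_module N b\<^esub> y = (\<lambda>i\<in>{..<b}. x i \<oplus>\<^bsub>N\<^esub> y i)"
  "a \<odot>\<^bsub>pow_module N b\<^esub> x = (\<lambda>i\<in>{..<b}. a \<odot>\<^bsub>N\<^esub> x i)"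
  by (simp_all add: pow_module_def)

lemma rmodule_pow:
  assumes "rmodule \<Lambda> N"
  shows "rmodule \<Lambda> (pow_module N b)"
proof -
  interpret N: rmodule \<Lambda> N by fact
  have "abelian_group (pow_module N b)"
  proof (rule abelian_groupI)
    fix x assume x: "x \<in> carrier (pow_module N b)"
    show "\<exists>y \<in> carrier (pow_module N b). y \<oplus>\<^bsub>pow_module N b\<^esub> x = \<zero>\<^bsub>pow_module N b\<^esub>"
      by (rule bexI[of _ "\<lambda>i\<in>{..<b}. \<ominus>\<^bsub>N\<^esub> x i"])
        (use x in \<open>auto simp: PiE_iff N.M.l_neg fun_eq_iff\<close>)
  qed (auto simp: PiE_iff N.M.a_ac fun_eq_iff extensional_def restrict_def)
  then show ?thesis
    by (intro rmodule.intro right_module.intro right_module_axioms.intro N.R.ring_axioms)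
      (auto simp: PiE_iff N.smult_l_distr N.smult_r_distr N.smult_assoc fun_eq_iff extensional_def restrict_def)
qed

lemma pow_proj_linear: "i < b \<Longrightarrow> is_linear \<Lambda> (pow_module N b) N (\<lambda>x. x i)"
  by (rule is_linearI) (auto simp: PiE_iff)

lemma pow_inj_linear:
  assumes "rmodule \<Lambda> N"
  shows "is_linear \<Lambda> N (pow_module N b) (\<lambda>y. \<lambda>i\<in>{..<b}. if i = j then y else \<zero>\<^bsub>N\<^esub>)"
proof -
  interpret N: rmodule \<Lambda> N by fact
  show ?thesis by (rule is_linearI) (auto simp: fun_eq_iff)
qed

text \<open>Induction on k over the truncations to the first k coordinates: each step adds one
  composite of a projection with an injection, and k = b gives the identity.\<close>

lemma in_add_pow:
  assumes "rmodule \<Lambda> N"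
  shows "in_add \<Lambda> N (pow_module N b)"
proof -
  interpret N: rmodule \<Lambda> N by fact
  have "factors_through \<Lambda> N (pow_module N b) (pow_module N b) (\<lambda>x. \<lambda>i\<in>{..<b}. if i < k then x i else \<zero>\<^bsub>N\<^esub>)"
    if "k \<le> b" for k
    using that
  proof (induction k)
    case 0
    show ?case by (rule through_zero) (auto simp: fun_eq_iff)
  next
    case (Suc k)
    then have k: "k < b" by simp
    show ?case
      by (rule through_step[OF Suc.IH pow_proj_linear[OF k] pow_inj_linear[OF assms, of b k]])
        (use k in \<open>auto simp: fun_eq_iff restrict_def PiE_iff less_Suc_eq\<close>)
  qed
  from this[OF order_refl] show ?thesis
    by (rule through_cong) (auto simp: fun_eq_iff restrict_def PiE_iff extensional_def)
qed

section \<open>Transport of a module structure along a map\<close>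

text \<open>The operations go through representatives picked by \<open>inv_into\<close>. In general
  this is a quotient by the fibres of \<open>\<pi>\<close>, for injective \<open>\<pi>\<close> a
  copy of \<open>N\<close>. Both uses occur, because modules have to be realised on
  \<open>coset_type\<close>.\<close>

definition img_module :: "('a, 'm) module \<Rightarrow> ('m \<Rightarrow> 'n) \<Rightarrow> ('a, 'n) module" where
  "img_module N \<pi> = \<lparr>carrier = \<pi> ` carrier N, monoid.mult = undefined, one = undefined,
     ring.zero = \<pi> \<zero>\<^bsub>N\<^esub>,
     ring.add = (\<lambda>u v. \<pi> (inv_into (carrier N) \<pi> u \<oplus>\<^bsub>N\<^esub> inv_into (carrier N) \<pi> v)),
     smult = (\<lambda>a u. \<pi> (a \<odot>\<^bsub>N\<^esub> inv_into (carrier N) \<pi> u))\<rparr>"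

lemma carrier_img_module [simp]: "carrier (img_module N \<pi>) = \<pi> ` carrier N"
  by (simp add: img_module_def)

lemma img_module:
  assumes "rmodule \<Lambda> N"
    and add: "\<And>x x' y. \<lbrakk>x \<in> carrier N; x' \<in> carrier N; y \<in> carrier N; \<pi> x = \<pi> x'\<rbrakk> \<Longrightarrow>
      \<pi> (x \<oplus>\<^bsub>N\<^esub> y) = \<pi> (x' \<oplus>\<^bsub>N\<^esub> y)"
    and smult: "\<And>a x x'. \<lbrakk>a \<in> carrier \<Lambda>; x \<in> carrier N; x' \<in> carrier N; \<pi> x = \<pi> x'\<rbrakk> \<Longrightarrow>
      \<pi> (a \<odot>\<^bsub>N\<^esub> x) = \<pi> (a \<odot>\<^bsub>N\<^esub> x')"
  shows "rmodule \<Lambda> (img_module N \<pi>)" "is_linear \<Lambda> N (img_module N \<pi>) \<pi>"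
proof -
  interpret N: rmodule \<Lambda> N by fact
  let ?s = "inv_into (carrier N) \<pi>"
  have s: "?s (\<pi> x) \<in> carrier N" "\<pi> (?s (\<pi> x)) = \<pi> x" if "x \<in> carrier N" for x
    using that by (auto intro: inv_into_into f_inv_into_f)
  have a: "\<pi> x \<oplus>\<^bsub>img_module N \<pi>\<^esub> \<pi> y = \<pi> (x \<oplus>\<^bsub>N\<^esub> y)" if "x \<in> carrier N" "y \<in> carrier N" for x y
  proof -
    have "\<pi> (?s (\<pi> x) \<oplus>\<^bsub>N\<^esub> ?s (\<pi> y)) = \<pi> (x \<oplus>\<^bsub>N\<^esub> ?s (\<pi> y))"
      using s that by (intro add) auto
    also have "\<dots> = \<pi> (?s (\<pi> y) \<oplus>\<^bsub>N\<^esub> x)" using s that by (simp add: N.M.a_comm)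
    also have "\<dots> = \<pi> (y \<oplus>\<^bsub>N\<^esub> x)" using s that by (intro add) auto
    finally show ?thesis using that by (simp add: img_module_def N.M.a_comm)
  qed
  have m: "c \<odot>\<^bsub>img_module N \<pi>\<^esub> \<pi> x = \<pi> (c \<odot>\<^bsub>N\<^esub> x)" if "c \<in> carrier \<Lambda>" "x \<in> carrier N" for c x
    using smult[OF that(1) s(1)[OF that(2)] that(2) s(2)[OF that(2)]] by (simp add: img_module_def)
  have z: "\<zero>\<^bsub>img_module N \<pi>\<^esub> = \<pi> \<zero>\<^bsub>N\<^esub>" by (simp add: img_module_def)
  show "is_linear \<Lambda> N (img_module N \<pi>) \<pi>" by (rule is_linearI) (auto simp: a m)
  have "abelian_group (img_module N \<pi>)"
  proof (rule abelian_groupI)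
    fix u assume "u \<in> carrier (img_module N \<pi>)"
    then obtain x where x: "x \<in> carrier N" "u = \<pi> x" by auto
    show "\<exists>v \<in> carrier (img_module N \<pi>). v \<oplus>\<^bsub>img_module N \<pi>\<^esub> u = \<zero>\<^bsub>img_module N \<pi>\<^esub>"
      by (rule bexI[of _ "\<pi> (\<ominus>\<^bsub>N\<^esub> x)"]) (use x in \<open>auto simp: a z N.M.l_neg\<close>)
  qed (auto simp: a z N.M.a_ac)
  then show "rmodule \<Lambda> (img_module N \<pi>)"
    by (intro rmodule.intro right_module.intro right_module_axioms.intro N.R.ring_axioms)
      (auto simp: a m N.smult_l_distr N.smult_r_distr N.smult_assoc)
qed

lemma img_module_inj:
  assumes "rmodule \<Lambda> N" "inj_on \<pi> (carrier N)"
  shows "rmodule \<Lambda> (img_module N \<pi>)" "is_linear \<Lambda> N (img_module N \<pi>) \<pi>"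
    "is_linear \<Lambda> (img_module N \<pi>) N (inv_into (carrier N) \<pi>)"
proof -
  interpret N: rmodule \<Lambda> N by fact
  show 1: "rmodule \<Lambda> (img_module N \<pi>)" "is_linear \<Lambda> N (img_module N \<pi>) \<pi>"
    by (rule img_module[OF assms(1)]; metis inj_onD[OF assms(2)])+
  show "is_linear \<Lambda> (img_module N \<pi>) N (inv_into (carrier N) \<pi>)"
    by (rule is_linearI)
      (use assms(2) in \<open>auto simp: is_linearD(2,3)[OF 1(2), symmetric]\<close>)
qed

section \<open>Regular sequences\<close>

text \<open>The submodule (x_0, ..., x_{j-1}) N, by recursion on j because the arguments on regular
  sequences peel off the last entry. \<open>seq_submodule_eq\<close> identifies it with the sums of
  \<open>seq_submodule\<close>.\<close>

primrec seq_mult :: "('a, 'm) module \<Rightarrow> (nat \<Rightarrow> 'a) \<Rightarrow> nat \<Rightarrow> 'm set" where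
  "seq_mult N x 0 = {\<zero>\<^bsub>N\<^esub>}"
| "seq_mult N x (Suc j) = {u \<oplus>\<^bsub>N\<^esub> x j \<odot>\<^bsub>N\<^esub> v | u v. u \<in> seq_mult N x j \<and> v \<in> carrier N}"

text \<open>The condition \<open>(x)N \<noteq> N\<close> is omitted, so the zero module is allowed.\<close>
definition weakly_regular :: "('a, 'm) module \<Rightarrow> (nat \<Rightarrow> 'a) \<Rightarrow> nat \<Rightarrow> bool" where
  "weakly_regular N x k \<longleftrightarrow>
     (\<forall>i < k. \<forall>y \<in> carrier N. x i \<odot>\<^bsub>N\<^esub> y \<in> seq_mult N x i \<longrightarrow> y \<in> seq_mult N x i)"

lemma weakly_regularD:
  "weakly_regular N x k \<Longrightarrow> i < k \<Longrightarrow> y \<in> carrier N \<Longrightarrow> x i \<odot>\<^bsub>N\<^esub> y \<in> seq_mult N x i \<Longrightarrow> y \<in> seq_mult N x i"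
  by (auto simp: weakly_regular_def)

lemma weakly_regular_mono: "weakly_regular N x k \<Longrightarrow> j \<le> k \<Longrightarrow> weakly_regular N x j"
  by (auto simp: weakly_regular_def)

lemma weakly_regular_0: "weakly_regular N x 0"
  by (simp add: weakly_regular_def)

locale cmodule = rmodule + cring R

lemma cmodule_iff: "cmodule R N \<longleftrightarrow> module R N"
  by (auto simp: module_iff_rmodule cmodule_def)

context cmodule
begin

lemma smult_smult: "a \<in> carrier R \<Longrightarrow> b \<in> carrier R \<Longrightarrow> y \<in> carrier M \<Longrightarrow>
    a \<odot>\<^bsub>M\<^esub> (b \<odot>\<^bsub>M\<^esub> y) = b \<odot>\<^bsub>M\<^esub> (a \<odot>\<^bsub>M\<^esub> y)"
  by (metis smult_assoc m_comm)

lemma smult_linear: "a \<in> carrier R \<Longrightarrow> is_linear R M M (\<lambda>y. a \<odot>\<^bsub>M\<^esub> y)"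
  by (rule is_linearI) (auto simp: smult_r_distr smult_smult)

lemma seq_mult_sub:
  assumes "x \<in> {..<j} \<rightarrow> carrier R"
  shows "is_sub R M (seq_mult M x j)"
  using assms
proof (induction j)
  case 0
  show ?case by (simp add: sub_zero)
next
  case (Suc j)
  have "x \<in> {..<j} \<rightarrow> carrier R" using Suc.prems by (simp add: Pi_iff)
  from Suc.IH[OF this] have IH: "is_sub R M (seq_mult M x j)" .
  have x: "x j \<in> carrier R" using Suc.prems by auto
  note D = is_subD[OF IH]
  show ?case
  proof
    show "seq_mult M x (Suc j) \<subseteq> carrier M" using D x by auto
    show "\<zero>\<^bsub>M\<^esub> \<in> seq_mult M x (Suc j)"
      using D(2) x by (auto intro!: exI[of _ "\<zero>\<^bsub>M\<^esub>"])
  next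
    fix a b assume "a \<in> seq_mult M x (Suc j)" "b \<in> seq_mult M x (Suc j)"
    then obtain u v u' v' where *: "u \<in> seq_mult M x j" "v \<in> carrier M" "a = u \<oplus>\<^bsub>M\<^esub> x j \<odot>\<^bsub>M\<^esub> v"
      "u' \<in> seq_mult M x j" "v' \<in> carrier M" "b = u' \<oplus>\<^bsub>M\<^esub> x j \<odot>\<^bsub>M\<^esub> v'" by auto
    have "a \<oplus>\<^bsub>M\<^esub> b = (u \<oplus>\<^bsub>M\<^esub> u') \<oplus>\<^bsub>M\<^esub> x j \<odot>\<^bsub>M\<^esub> (v \<oplus>\<^bsub>M\<^esub> v')"
      using * D(5) x by (simp add: smult_r_distr M.a_ac)
    then show "a \<oplus>\<^bsub>M\<^esub> b \<in> seq_mult M x (Suc j)" using * D(3) M.a_closed by auto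
  next
    fix c a assume c: "c \<in> carrier R" and "a \<in> seq_mult M x (Suc j)"
    then obtain u v where *: "u \<in> seq_mult M x j" "v \<in> carrier M" "a = u \<oplus>\<^bsub>M\<^esub> x j \<odot>\<^bsub>M\<^esub> v" by auto
    have "c \<odot>\<^bsub>M\<^esub> a = c \<odot>\<^bsub>M\<^esub> u \<oplus>\<^bsub>M\<^esub> x j \<odot>\<^bsub>M\<^esub> (c \<odot>\<^bsub>M\<^esub> v)"
      using * D(5) x c by (simp add: smult_r_distr smult_smult)
    then show "c \<odot>\<^bsub>M\<^esub> a \<in> seq_mult M x (Suc j)" using * D(4) c smult_closed by auto
  qed
qed

lemma seq_mult_mono:
  assumes "x \<in> {..<Suc j} \<rightarrow> carrier R" "u \<in> seq_mult M x j"
  shows "u \<in> seq_mult M x (Suc j)"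
proof -
  have "is_sub R M (seq_mult M x j)" by (rule seq_mult_sub) (use assms(1) in auto)
  then have "u \<oplus>\<^bsub>M\<^esub> x j \<odot>\<^bsub>M\<^esub> \<zero>\<^bsub>M\<^esub> = u" using assms is_subD(5)[of R M _ u] by (simp add: Pi_iff)
  then show ?thesis using assms(2) M.zero_closed by (simp del: M.zero_closed) metis
qed

lemma seq_mult_smult:
  assumes "x \<in> {..<j} \<rightarrow> carrier R" "i < j" "y \<in> carrier M"
  shows "x i \<odot>\<^bsub>M\<^esub> y \<in> seq_mult M x j"
  using assms
proof (induction j)
  case (Suc j)
  show ?case
  proof (cases "i = j")
    case True
    have "is_sub R M (seq_mult M x j)" by (rule seq_mult_sub) (use Suc.prems(1) in auto)
    then have "\<zero>\<^bsub>M\<^esub> \<in> seq_mult M x j" by (rule is_subD(2))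
    moreover have "x i \<odot>\<^bsub>M\<^esub> y = \<zero>\<^bsub>M\<^esub> \<oplus>\<^bsub>M\<^esub> x j \<odot>\<^bsub>M\<^esub> y"
      using Suc.prems True by (simp add: Pi_iff)
    ultimately show ?thesis using Suc.prems(3) by auto
  next
    case False
    then show ?thesis using Suc by (intro seq_mult_mono) (auto simp: Pi_iff)
  qed
qed simp

lemma finsum_lessThan_Suc:
  "f \<in> {..<Suc n} \<rightarrow> carrier M \<Longrightarrow> (\<Oplus>\<^bsub>M\<^esub>i\<in>{..<Suc n}. f i) = (\<Oplus>\<^bsub>M\<^esub>i\<in>{..<n}. f i) \<oplus>\<^bsub>M\<^esub> f n"
  unfolding lessThan_Suc
  by (subst M.finsum_insert) (auto intro!: M.a_comm)

lemma seq_mult_eq_finsum: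
  assumes "x \<in> {..<j} \<rightarrow> carrier R"
  shows "seq_mult M x j = {\<Oplus>\<^bsub>M\<^esub>i\<in>{..<j}. x i \<odot>\<^bsub>M\<^esub> v i | v. v \<in> {..<j} \<rightarrow> carrier M}"
  using assms
proof (induction j)
  case 0
  show ?case by auto
next
  case (Suc j)
  have "x \<in> {..<j} \<rightarrow> carrier R" using Suc.prems by (simp add: Pi_iff)
  note IH = Suc.IH[OF this]
  have x: "x i \<in> carrier R" if "i \<le> j" for i using Suc.prems that by auto
  show ?case
  proof (intro Set.set_eqI iffI)
    fix z assume "z \<in> seq_mult M x (Suc j)"
    then obtain u v where uv: "u \<in> seq_mult M x j" "v \<in> carrier M" "z = u \<oplus>\<^bsub>M\<^esub> x j \<odot>\<^bsub>M\<^esub> v" by auto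
    then obtain w where w: "w \<in> {..<j} \<rightarrow> carrier M" "u = (\<Oplus>\<^bsub>M\<^esub>i\<in>{..<j}. x i \<odot>\<^bsub>M\<^esub> w i)"
      unfolding IH by auto
    let ?w = "w(j := v)"
    have c: "?w i \<in> carrier M" if "i \<le> j" for i using w(1) uv(2) that by auto
    have "(\<Oplus>\<^bsub>M\<^esub>i\<in>{..<Suc j}. x i \<odot>\<^bsub>M\<^esub> ?w i) = (\<Oplus>\<^bsub>M\<^esub>i\<in>{..<j}. x i \<odot>\<^bsub>M\<^esub> ?w i) \<oplus>\<^bsub>M\<^esub> x j \<odot>\<^bsub>M\<^esub> ?w j"
      by (rule finsum_lessThan_Suc) (use x c in auto)
    also have "(\<Oplus>\<^bsub>M\<^esub>i\<in>{..<j}. x i \<odot>\<^bsub>M\<^esub> ?w i) = u"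
      unfolding w(2) by (rule M.finsum_cong') (use x w(1) in auto)
    finally have "z = (\<Oplus>\<^bsub>M\<^esub>i\<in>{..<Suc j}. x i \<odot>\<^bsub>M\<^esub> ?w i)" using uv(3) by simp
    moreover have "?w \<in> {..<Suc j} \<rightarrow> carrier M" using c by auto
    ultimately show "z \<in> {\<Oplus>\<^bsub>M\<^esub>i\<in>{..<Suc j}. x i \<odot>\<^bsub>M\<^esub> v i | v. v \<in> {..<Suc j} \<rightarrow> carrier M}"
      by (intro CollectI exI[of _ ?w] conjI)
  next
    fix z assume "z \<in> {\<Oplus>\<^bsub>M\<^esub>i\<in>{..<Suc j}. x i \<odot>\<^bsub>M\<^esub> v i | v. v \<in> {..<Suc j} \<rightarrow> carrier M}"
    then obtain v where v: "v \<in> {..<Suc j} \<rightarrow> carrier M" "z = (\<Oplus>\<^bsub>M\<^esub>i\<in>{..<Suc j}. x i \<odot>\<^bsub>M\<^esub> v i)"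
      by (elim CollectE exE conjE)
    have "z = (\<Oplus>\<^bsub>M\<^esub>i\<in>{..<j}. x i \<odot>\<^bsub>M\<^esub> v i) \<oplus>\<^bsub>M\<^esub> x j \<odot>\<^bsub>M\<^esub> v j"
      unfolding v(2) by (rule finsum_lessThan_Suc) (use x v(1) in auto)
    moreover have "(\<Oplus>\<^bsub>M\<^esub>i\<in>{..<j}. x i \<odot>\<^bsub>M\<^esub> v i) \<in> seq_mult M x j"
      unfolding IH using v(1) by (intro CollectI exI[of _ v] conjI refl) auto
    moreover have "v j \<in> carrier M" using v(1) by auto
    ultimately show "z \<in> seq_mult M x (Suc j)" by auto
  qed
qed

lemma seq_submodule_eq:
  assumes "set xs \<subseteq> carrier R" "j \<le> length xs"
  shows "seq_submodule M (take j xs) = seq_mult M (\<lambda>i. xs ! i) j"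
proof -
  have "seq_mult M (\<lambda>i. xs ! i) j
      = {\<Oplus>\<^bsub>M\<^esub>i\<in>{..<j}. xs ! i \<odot>\<^bsub>M\<^esub> v i | v. v \<in> {..<j} \<rightarrow> carrier M}"
    by (rule seq_mult_eq_finsum) (use assms in \<open>auto simp: subset_eq\<close>)
  also have "\<dots> = seq_submodule M (take j xs)"
  proof -
    have "(\<Oplus>\<^bsub>M\<^esub>i\<in>{..<j}. take j xs ! i \<odot>\<^bsub>M\<^esub> v i) = (\<Oplus>\<^bsub>M\<^esub>i\<in>{..<j}. xs ! i \<odot>\<^bsub>M\<^esub> v i)"
      if "v \<in> {..<j} \<rightarrow> carrier M" for v
      by (rule M.finsum_cong') (use assms that in \<open>auto simp: subset_eq Pi_iff\<close>)
    then show ?thesis unfolding seq_submodule_def using assms(2) by (auto simp: min_absorb2) metis+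
  qed
  finally show ?thesis by simp
qed

lemma regular_sequence_iff:
  assumes "set xs \<subseteq> carrier R"
  shows "regular_sequence R M xs \<longleftrightarrow>
    seq_mult M (\<lambda>i. xs ! i) (length xs) \<noteq> carrier M \<and> weakly_regular M (\<lambda>i. xs ! i) (length xs)"
  using assms seq_submodule_eq[OF assms order_refl]
  by (simp add: regular_sequence_def weakly_regular_def seq_submodule_eq)

end

lemma linear_seq_mult:
  assumes "cmodule R N" "cmodule R L" "is_linear R N L f" "x \<in> {..<j} \<rightarrow> carrier R"
    and "y \<in> seq_mult N x j"
  shows "f y \<in> seq_mult L x j"
  using assms(4,5)
proof (induction j arbitrary: y)
  case 0
  have "rmodule R N" "rmodule R L" using assms(1,2) by (auto simp: cmodule_def)
  then show ?case using rmodule.linear_zero[OF _ _ assms(3)] 0 by simp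
next
  case (Suc j)
  interpret N: cmodule R N by fact
  from Suc.prems obtain u v where uv: "u \<in> seq_mult N x j" "v \<in> carrier N" "y = u \<oplus>\<^bsub>N\<^esub> x j \<odot>\<^bsub>N\<^esub> v"
    by auto
  have "u \<in> carrier N" by (rule is_subD(5)[OF N.seq_mult_sub uv(1)]) (use Suc.prems in auto)
  then have "f y = f u \<oplus>\<^bsub>L\<^esub> x j \<odot>\<^bsub>L\<^esub> f v"
    using uv Suc.prems(1) by (auto simp: is_linearD[OF assms(3)] Pi_iff)
  moreover have "f u \<in> seq_mult L x j" using Suc.IH[OF _ uv(1)] Suc.prems(1) by (simp add: Pi_iff)
  ultimately show ?case using uv(2) is_linearD(1)[OF assms(3)] by auto
qed

text \<open>For a composite g f of maps N -> M -> N, regularity on \<open>M\<close> puts f y into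
  the submodule of \<open>M\<close> generated by the earlier entries, and g carries it to that of
  \<open>N\<close>. Summing over the composites gives y itself. It matters that the sequence stays
  the same for all of add M.\<close>

lemma weakly_regular_in_add:
  assumes "cmodule R M" "cmodule R N" "in_add R M N" "x \<in> {..<k} \<rightarrow> carrier R" "weakly_regular M x k"
  shows "weakly_regular N x k"
  unfolding weakly_regular_def
proof (intro allI impI ballI)
  interpret M: cmodule R M by fact
  interpret N: cmodule R N by fact
  fix i y assume i: "i < k" and y: "y \<in> carrier N" and xy: "x i \<odot>\<^bsub>N\<^esub> y \<in> seq_mult N x i"
  have x: "x \<in> {..<i} \<rightarrow> carrier R" "x i \<in> carrier R" using assms(4) i by auto
  note S = N.seq_mult_sub[OF x(1)]
  have "h y \<in> seq_mult N x i" if "factors_through R M N N h" for h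
    using that
  proof (induction rule: factors_through.induct)
    case (through_zero h)
    then show ?case using y is_subD(2)[OF S] by simp
  next
    case (through_step h f g h')
    have "x i \<odot>\<^bsub>M\<^esub> f y \<in> seq_mult M x i"
      using linear_seq_mult[OF assms(2,1) through_step(2) x(1) xy] is_linearD(3)[OF through_step(2) x(2) y]
      by simp
    then have "f y \<in> seq_mult M x i"
      by (rule weakly_regularD[OF assms(5) i is_linearD(1)[OF through_step(2) y]])
    then have "g (f y) \<in> seq_mult N x i" by (rule linear_seq_mult[OF assms(1,2) through_step(3) x(1)])
    then show ?case using through_step.IH through_step(4) y is_subD(3)[OF S] by simp
  qed
  from this[OF assms(3)] show "y \<in> seq_mult N x i" .
qed

section \<open>Regular sequences along short exact sequences\<close>

lemma (in cmodule) cmodule_sub: "is_sub R M W \<Longrightarrow> cmodule R (M\<lparr>carrier := W\<rparr>)"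
  by (simp add: cmodule_def rmodule_sub cring_axioms)

lemma linear_seq_mult_surj:
  assumes "cmodule R N" "cmodule R L" "is_linear R N L f" "f ` carrier N = carrier L"
    "x \<in> {..<j} \<rightarrow> carrier R" "y \<in> seq_mult L x j"
  shows "\<exists>w \<in> seq_mult N x j. y = f w"
  using assms(5,6)
proof (induction j arbitrary: y)
  case 0
  have "rmodule R N" "rmodule R L" using assms(1,2) by (auto simp: cmodule_def)
  then show ?case using rmodule.linear_zero[OF _ _ assms(3)] 0 by simp
next
  case (Suc j)
  interpret N: cmodule R N by fact
  have x: "x \<in> {..<j} \<rightarrow> carrier R" "x j \<in> carrier R" using Suc.prems(1) by (auto simp: Pi_iff)
  from Suc.prems obtain u v where uv: "u \<in> seq_mult L x j" "v \<in> carrier L" "y = u \<oplus>\<^bsub>L\<^esub> x j \<odot>\<^bsub>L\<^esub> v"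
    by auto
  obtain w where w: "w \<in> seq_mult N x j" "u = f w" using Suc.IH[OF x(1) uv(1)] by blast
  obtain v' where v': "v' \<in> carrier N" "v = f v'" using uv(2) assms(4) by blast
  have "w \<in> carrier N" by (rule is_subD(5)[OF N.seq_mult_sub[OF x(1)] w(1)])
  then have "f (w \<oplus>\<^bsub>N\<^esub> x j \<odot>\<^bsub>N\<^esub> v') = y"
    using uv(3) w(2) v' x(2) by (simp add: is_linearD[OF assms(3)])
  moreover have "w \<oplus>\<^bsub>N\<^esub> x j \<odot>\<^bsub>N\<^esub> v' \<in> seq_mult N x (Suc j)" using w(1) v'(1) by auto
  ultimately show ?case by blast
qed

text \<open>A short exact sequence 0 -> K -> N -> L -> 0 together with a sequence of scalars. The
  sequence is total, so that one \<open>x\<close> serves all lengths.\<close>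

locale syzygy = N: cmodule R N + L: cmodule R L
  for R :: "('a, 'c) ring_scheme" (structure) and N :: "('a, 'm) module" and L :: "('a, 'n) module" +
  fixes f and x :: "nat \<Rightarrow> 'a"
  assumes f: "is_linear R N L f" "f ` carrier N = carrier L"
    and x: "x \<in> UNIV \<rightarrow> carrier R"
begin

abbreviation "K \<equiv> N\<lparr>carrier := ker_of N L f\<rparr>"

lemma rmods: "rmodule R N" "rmodule R L"
  using N.rmodule_axioms L.rmodule_axioms .

lemma xc [simp]: "x i \<in> carrier R" and xj: "x \<in> {..<j} \<rightarrow> carrier R"
  using x by auto

lemma K_sub: "is_sub R N (ker_of N L f)"
  using N.ker_sub[OF rmods(2) f(1)] .

lemma cmodule_K: "cmodule R K"
  using N.cmodule_sub[OF K_sub] .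

lemma seq_mult_K_subset: "u \<in> seq_mult K x j \<Longrightarrow> u \<in> seq_mult N x j"
  using linear_seq_mult[OF cmodule_K N.cmodule_axioms is_linear_sub_incl[OF K_sub] xj] .

lemma f_diff: "u \<in> carrier N \<Longrightarrow> v \<in> carrier N \<Longrightarrow> f (u \<ominus>\<^bsub>N\<^esub> v) = f u \<ominus>\<^bsub>L\<^esub> f v"
  using N.linear_diff[OF rmods(2) f(1)] .

text \<open>Vanishing of Tor_1(R/(x), L) in elementary terms. If w = u + x_j m is in the kernel,
  then x_j f(m) lies in the part of \<open>L\<close> generated by the earlier entries, hence so does
  f(m), and m can be corrected by a lift.\<close>

lemma seq_mult_inter_ker:
  assumes "weakly_regular L x j" "w \<in> seq_mult N x j" "f w = \<zero>\<^bsub>L\<^esub>"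
  shows "w \<in> seq_mult K x j"
  using assms
proof (induction j arbitrary: w)
  case 0
  then show ?case by simp
next
  case (Suc j)
  note D = is_subD[OF N.seq_mult_sub[OF xj, of j]] and E = is_subD[OF L.seq_mult_sub[OF xj, of j]]
  from Suc.prems(2) obtain u m where um: "u \<in> seq_mult N x j" "m \<in> carrier N" "w = u \<oplus>\<^bsub>N\<^esub> x j \<odot>\<^bsub>N\<^esub> m"
    by auto
  have uc: "u \<in> carrier N" using D(5) um(1) .
  have fu: "f u \<in> seq_mult L x j" using linear_seq_mult[OF N.cmodule_axioms L.cmodule_axioms f(1) xj um(1)] .
  have "x j \<odot>\<^bsub>L\<^esub> f m \<oplus>\<^bsub>L\<^esub> f u = \<zero>\<^bsub>L\<^esub>"
    using Suc.prems(3) um uc by (simp add: is_linearD[OF f(1)] L.M.a_comm)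
  then have "x j \<odot>\<^bsub>L\<^esub> f m \<in> seq_mult L x j"
    using L.sub_add_cancel[OF L.seq_mult_sub[OF xj] _ fu] E(2) um(2) is_linearD(1)[OF f(1)] by simp
  then have "f m \<in> seq_mult L x j"
    using weakly_regularD[OF Suc.prems(1), of j] is_linearD(1)[OF f(1) um(2)] by simp
  then obtain v where v: "v \<in> seq_mult N x j" "f m = f v"
    using linear_seq_mult_surj[OF N.cmodule_axioms L.cmodule_axioms f xj] by blast
  have vc: "v \<in> carrier N" using D(5) v(1) .
  let ?m = "m \<ominus>\<^bsub>N\<^esub> v"
  have mK: "?m \<in> ker_of N L f"
    using um(2) vc v(2) is_linearD(1)[OF f(1)] by (simp add: ker_of_def f_diff L.M.minus_eq L.M.r_neg)
  have mc: "?m \<in> carrier N" using um(2) vc by simp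
  \<comment> \<open>Shifting \<open>x j\<close> times the lift \<open>v\<close> between the summands
    leaves \<open>x j\<close> times a kernel element; \<open>?w\<close> is then in the kernel too
    and falls under the induction hypothesis.\<close>
  let ?w = "u \<oplus>\<^bsub>N\<^esub> x j \<odot>\<^bsub>N\<^esub> v"
  have w: "w = ?w \<oplus>\<^bsub>N\<^esub> x j \<odot>\<^bsub>N\<^esub> ?m"
  proof -
    have "?w \<oplus>\<^bsub>N\<^esub> x j \<odot>\<^bsub>N\<^esub> ?m = u \<oplus>\<^bsub>N\<^esub> x j \<odot>\<^bsub>N\<^esub> (v \<oplus>\<^bsub>N\<^esub> ?m)"
      using uc vc mc by (simp add: N.smult_r_distr N.M.a_assoc)
    also have "v \<oplus>\<^bsub>N\<^esub> ?m = m" using vc um(2)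
      by (simp add: N.M.minus_eq N.M.a_ac N.M.r_neg1 N.M.r_neg2 N.M.r_neg)
    finally show ?thesis using um(3) by simp
  qed
  have "?w \<in> seq_mult N x j" using D(3,4) um(1) v(1) by simp
  moreover have "f ?w = \<zero>\<^bsub>L\<^esub>"
  proof -
    have "f w = f ?w \<oplus>\<^bsub>L\<^esub> x j \<odot>\<^bsub>L\<^esub> f ?m" using w uc vc mc by (simp add: is_linearD[OF f(1)])
    also have "f ?m = \<zero>\<^bsub>L\<^esub>" using mK by (simp add: ker_of_def)
    finally show ?thesis using Suc.prems(3) uc vc is_linearD(1)[OF f(1)] by simp
  qed
  ultimately have "?w \<in> seq_mult K x j"
    using Suc.IH weakly_regular_mono[OF Suc.prems(1), of j] by simp
  then show ?case using w mK by auto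
qed

text \<open>The depth lemma for a fixed sequence: a relation in \<open>K\<close> holds in
  \<open>N\<close>, can be cancelled there, and comes back to \<open>K\<close> by
  \<open>seq_mult_inter_ker\<close>. That lemma only needs regularity on \<open>L\<close> below the
  current index, so the kernel gains one element over \<open>L\<close>.\<close>

lemma weakly_regular_ker:
  assumes "weakly_regular L x j" "weakly_regular N x (Suc j)"
  shows "weakly_regular K x (Suc j)"
  unfolding weakly_regular_def
proof (intro allI impI ballI)
  fix i y assume i: "i < Suc j" and y: "y \<in> carrier K" and "x i \<odot>\<^bsub>K\<^esub> y \<in> seq_mult K x i"
  then have "x i \<odot>\<^bsub>N\<^esub> y \<in> seq_mult N x i" using seq_mult_K_subset by simp
  then have "y \<in> seq_mult N x i" using weakly_regularD[OF assms(2) i] y by (simp add: ker_of_def)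
  then show "y \<in> seq_mult K x i"
    using y i by (intro seq_mult_inter_ker weakly_regular_mono[OF assms(1)]) (auto simp: ker_of_def)
qed

text \<open>The connecting map \<open>Tor\<^sub>j(R/(x), L) \<rightarrow> Tor\<^sub>j\<^sub>-\<^sub>1(R/(x), K)\<close> in elementary terms: a nonzero element of
  \<open>L/(x\<^sub>1, \<dots>, x\<^sub>j)L\<close> killed by the whole sequence yields one of \<open>K/(x\<^sub>1, \<dots>, x\<^sub>j\<^sub>+\<^sub>1)K\<close>.\<close>
lemma socle_ker:
  assumes "weakly_regular L x j" "weakly_regular N x (Suc j)"
    "z \<in> carrier L" "z \<notin> seq_mult L x j" "\<And>i. i < d \<Longrightarrow> x i \<odot>\<^bsub>L\<^esub> z \<in> seq_mult L x j" "j < d"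
  shows "\<exists>z' \<in> carrier K. z' \<notin> seq_mult K x (Suc j) \<and> (\<forall>i < d. x i \<odot>\<^bsub>K\<^esub> z' \<in> seq_mult K x (Suc j))"
proof -
  note SN = N.seq_mult_sub[OF xj, of j]
  note D = is_subD[OF SN] and fl = is_linearD[OF f(1)]
  obtain m where m: "m \<in> carrier N" "z = f m" using assms(3) f(2) by blast
  have lift: "\<exists>w \<in> seq_mult N x j. x i \<odot>\<^bsub>L\<^esub> z = f w" if "i < d" for i
    using linear_seq_mult_surj[OF N.cmodule_axioms L.cmodule_axioms f xj assms(5)[OF that]] .
  obtain w where w: "w \<in> seq_mult N x j" "x j \<odot>\<^bsub>L\<^esub> z = f w" using lift[OF assms(6)] by blast
  have wc: "w \<in> carrier N" using D(5) w(1) .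
  have kerI: "x i \<odot>\<^bsub>N\<^esub> m \<ominus>\<^bsub>N\<^esub> n \<in> ker_of N L f" if "x i \<odot>\<^bsub>L\<^esub> z = f n" "n \<in> carrier N" for i n
    using that m fl(1)[OF that(2)] by (simp add: ker_of_def f_diff fl(3) L.M.minus_eq L.M.r_neg)
  \<comment> \<open>The connecting map: \<open>x j\<close> times \<open>z\<close> lies in the
    submodule of the first j entries, so \<open>x j\<close> times the lift \<open>m\<close> differs
    from some \<open>w\<close> in that submodule of \<open>N\<close> by an element of the
    kernel.\<close>
  let ?z = "x j \<odot>\<^bsub>N\<^esub> m \<ominus>\<^bsub>N\<^esub> w"
  have zK: "?z \<in> ker_of N L f" using kerI[OF w(2) wc] .
  have "?z \<notin> seq_mult K x (Suc j)"
  proof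
    assume "?z \<in> seq_mult K x (Suc j)"
    then obtain u v where uv: "u \<in> seq_mult K x j" "v \<in> ker_of N L f" "?z = u \<oplus>\<^bsub>N\<^esub> x j \<odot>\<^bsub>N\<^esub> v" by auto
    have uN: "u \<in> seq_mult N x j" using seq_mult_K_subset uv(1) .
    have uc: "u \<in> carrier N" using D(5) uN .
    have vc: "v \<in> carrier N" "f v = \<zero>\<^bsub>L\<^esub>" using uv(2) by (auto simp: ker_of_def)
    have "x j \<odot>\<^bsub>N\<^esub> m = ?z \<oplus>\<^bsub>N\<^esub> w" using m(1) wc by (simp add: N.M.minus_eq N.M.a_assoc N.M.l_neg)
    also have "\<dots> = (w \<oplus>\<^bsub>N\<^esub> u) \<oplus>\<^bsub>N\<^esub> x j \<odot>\<^bsub>N\<^esub> v" using uv(3) uc vc(1) wc by (simp add: N.M.a_ac)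
    finally have "x j \<odot>\<^bsub>N\<^esub> m \<ominus>\<^bsub>N\<^esub> x j \<odot>\<^bsub>N\<^esub> v = w \<oplus>\<^bsub>N\<^esub> u"
      using wc uc vc(1) by (simp add: N.M.minus_eq N.M.a_assoc N.M.r_neg)
    \<comment> \<open>Cancelling \<open>x j\<close> on \<open>N\<close> puts \<open>m - v\<close>
      into the submodule of the first j entries; its image \<open>z\<close> would then lie in the
      submodule that it avoids.\<close>
    then have "x j \<odot>\<^bsub>N\<^esub> (m \<ominus>\<^bsub>N\<^esub> v) = w \<oplus>\<^bsub>N\<^esub> u" using m(1) vc(1) by (simp add: N.smult_r_diff)
    then have "x j \<odot>\<^bsub>N\<^esub> (m \<ominus>\<^bsub>N\<^esub> v) \<in> seq_mult N x j" using D(3)[OF w(1) uN] by simp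
    then have "m \<ominus>\<^bsub>N\<^esub> v \<in> seq_mult N x j"
      using weakly_regularD[OF assms(2), of j] m(1) vc(1) by simp
    then have "f (m \<ominus>\<^bsub>N\<^esub> v) \<in> seq_mult L x j"
      by (rule linear_seq_mult[OF N.cmodule_axioms L.cmodule_axioms f(1) xj])
    moreover have "f (m \<ominus>\<^bsub>N\<^esub> v) = z" using m vc fl(1)[OF m(1)] by (simp add: f_diff L.M.minus_eq)
    ultimately show False using assms(4) by simp
  qed
  moreover have "x i \<odot>\<^bsub>K\<^esub> ?z \<in> seq_mult K x (Suc j)" if i: "i < d" for i
  proof -
    obtain n where n: "n \<in> seq_mult N x j" "x i \<odot>\<^bsub>L\<^esub> z = f n" using lift[OF i] by blast
    have nc: "n \<in> carrier N" using D(5) n(1) .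
    let ?y = "x i \<odot>\<^bsub>N\<^esub> m \<ominus>\<^bsub>N\<^esub> n"
    have yK: "?y \<in> ker_of N L f" using kerI[OF n(2) nc] .
    have yc: "?y \<in> carrier N" using m(1) nc by simp
    \<comment> \<open>\<open>x i\<close> times \<open>?z\<close> is \<open>x j\<close> times the
      kernel element \<open>?y\<close>, plus \<open>?t\<close>. As a kernel element generated in
      \<open>N\<close> by the first j entries, \<open>?t\<close> is so generated in \<open>K\<close>
      as well.\<close>
    let ?t = "x j \<odot>\<^bsub>N\<^esub> n \<ominus>\<^bsub>N\<^esub> x i \<odot>\<^bsub>N\<^esub> w"
    have t: "?t \<in> seq_mult N x j" using D(4) n(1) w(1) by (intro N.sub_diff[OF SN]) auto
    have "?t \<oplus>\<^bsub>N\<^esub> x j \<odot>\<^bsub>N\<^esub> ?y = x j \<odot>\<^bsub>N\<^esub> (n \<oplus>\<^bsub>N\<^esub> ?y) \<ominus>\<^bsub>N\<^esub> x i \<odot>\<^bsub>N\<^esub> w"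
      using yc nc wc by (simp add: N.smult_r_distr N.M.minus_eq N.M.a_ac)
    also have "n \<oplus>\<^bsub>N\<^esub> ?y = x i \<odot>\<^bsub>N\<^esub> m"
      using nc m(1) by (simp add: N.M.minus_eq N.M.a_ac N.M.r_neg1 N.M.r_neg2 N.M.r_neg)
    finally have eq: "x i \<odot>\<^bsub>N\<^esub> ?z = ?t \<oplus>\<^bsub>N\<^esub> x j \<odot>\<^bsub>N\<^esub> ?y"
      using m(1) wc by (simp add: N.smult_r_diff N.smult_smult)
    have "?t \<oplus>\<^bsub>N\<^esub> x j \<odot>\<^bsub>N\<^esub> ?y \<in> ker_of N L f" unfolding eq[symmetric] using is_subD(4)[OF K_sub] zK by simp
    then have "?t \<in> ker_of N L f"
      using N.sub_add_cancel[OF K_sub, of ?t "x j \<odot>\<^bsub>N\<^esub> ?y"] is_subD(4)[OF K_sub _ yK] nc wc by simp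
    then have "?t \<in> seq_mult K x j" by (intro seq_mult_inter_ker[OF assms(1) t]) (simp add: ker_of_def)
    then show ?thesis using eq yK by auto
  qed
  ultimately show ?thesis using zK by auto
qed

end

text \<open>Every passage to a kernel gains one regular element, until the \<open>d\<close>
  available on the middle terms are exhausted.\<close>

lemma syzygies_weakly_regular:
  assumes "\<And>j. syzygy R (N j) (L j) (f j) x" "\<And>j. L (Suc j) = N j\<lparr>carrier := ker_of (N j) (L j) (f j)\<rparr>"
    "\<And>j. weakly_regular (N j) x d" "weakly_regular (L 0) x s"
  shows "weakly_regular (L j) x (min d (j + s))"
proof (induction j)
  case 0
  show ?case by (rule weakly_regular_mono[OF assms(4)]) simp
next
  case (Suc j)
  interpret syzygy R "N j" "L j" "f j" x by fact
  \<comment> \<open>The bound is written as a successor to match \<open>weakly_regular_ker\<close>;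
    for d > 0 it equals min d (Suc j + s).\<close>
  have "weakly_regular (L (Suc j)) x (Suc (min (d - 1) (j + s)))" if "d > 0"
    unfolding assms(2)
    by (rule weakly_regular_ker; rule weakly_regular_mono[OF Suc] weakly_regular_mono[OF assms(3)])
      (use that in auto)
  then show ?case by (cases "d = 0") (auto simp: weakly_regular_0 elim: weakly_regular_mono)
qed

text \<open>Iterates \<open>socle_ker\<close> from a nonzero element killed by the whole sequence.
  In particular \<open>L j\<close> is nonzero for all j \<le> d, which is what bounds resolutions
  from below.\<close>

lemma syzygies_socle:
  assumes "\<And>j. syzygy R (N j) (L j) (f j) x" "\<And>j. L (Suc j) = N j\<lparr>carrier := ker_of (N j) (L j) (f j)\<rparr>"
    "\<And>j. weakly_regular (N j) x d"
    "c \<in> carrier (L 0)" "c \<noteq> \<zero>\<^bsub>L 0\<^esub>" "\<And>i. i < d \<Longrightarrow> x i \<odot>\<^bsub>L 0\<^esub> c = \<zero>\<^bsub>L 0\<^esub>" "j \<le> d"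
  shows "\<exists>z \<in> carrier (L j). z \<notin> seq_mult (L j) x j \<and> (\<forall>i < d. x i \<odot>\<^bsub>L j\<^esub> z \<in> seq_mult (L j) x j)"
  using assms(7)
proof (induction j)
  case 0
  then show ?case using assms(4-6) by auto
next
  case (Suc j)
  interpret syzygy R "N j" "L j" "f j" x by fact
  \<comment> \<open>Taken with s = 0: nothing is known about \<open>L 0\<close>, yet j kernels later
    there are j regular elements, just enough for the next connecting map.\<close>
  have "weakly_regular (L j) x j"
    using syzygies_weakly_regular[where N = N and L = L and s = 0, OF assms(1-3) weakly_regular_0, of j] Suc.prems by (simp add: min_def)
  moreover have "weakly_regular (N j) x (Suc j)" using weakly_regular_mono[OF assms(3)] Suc.prems .
  moreover obtain z where "z \<in> carrier (L j)" "z \<notin> seq_mult (L j) x j"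
    "\<forall>i < d. x i \<odot>\<^bsub>L j\<^esub> z \<in> seq_mult (L j) x j" using Suc by auto
  ultimately show ?case unfolding assms(2) using Suc.prems by (intro socle_ker) auto
qed

section \<open>Maximal Cohen-Macaulay modules\<close>

lemma (in cmodule) annihilator_sub:
  assumes "is_sub R M L" "u \<in> carrier M"
  shows "is_sub R (right_regular R) {r \<in> carrier R. r \<odot>\<^bsub>M\<^esub> u \<in> L}"
proof
  note D = is_subD[OF assms(1)]
  show "\<zero>\<^bsub>right_regular R\<^esub> \<in> {r \<in> carrier R. r \<odot>\<^bsub>M\<^esub> u \<in> L}" using assms(2) D(2) by simp
  show "r \<oplus>\<^bsub>right_regular R\<^esub> s \<in> {r \<in> carrier R. r \<odot>\<^bsub>M\<^esub> u \<in> L}"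
    if "r \<in> {r \<in> carrier R. r \<odot>\<^bsub>M\<^esub> u \<in> L}" "s \<in> {r \<in> carrier R. r \<odot>\<^bsub>M\<^esub> u \<in> L}" for r s
    using that assms(2) D(3) by (simp add: smult_l_distr)
  show "a \<odot>\<^bsub>right_regular R\<^esub> r \<in> {r \<in> carrier R. r \<odot>\<^bsub>M\<^esub> u \<in> L}"
    if "a \<in> carrier R" "r \<in> {r \<in> carrier R. r \<odot>\<^bsub>M\<^esub> u \<in> L}" for a r
    using that assms(2) D(4) by (simp add: smult_assoc)
qed auto

text \<open>Among the annihilators of nonzero elements of M/L that contain the one of
  \<open>w\<close>, a maximal member exists by Noetherianity, and maximality makes it prime.\<close>

lemma (in cmodule) exists_associated_prime:
  assumes "noeth R (right_regular R)" "is_sub R M L" "w \<in> carrier M" "w \<notin> L"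
  obtains u where "u \<in> carrier M" "u \<notin> L" "primeideal {r \<in> carrier R. r \<odot>\<^bsub>M\<^esub> u \<in> L} R"
    "{r \<in> carrier R. r \<odot>\<^bsub>M\<^esub> w \<in> L} \<subseteq> {r \<in> carrier R. r \<odot>\<^bsub>M\<^esub> u \<in> L}"
proof -
  note D = is_subD[OF assms(2)]
  define ann where "ann u = {r \<in> carrier R. r \<odot>\<^bsub>M\<^esub> u \<in> L}" for u
  define C where "C = {ann u | u. u \<in> carrier M \<and> u \<notin> L \<and> ann w \<subseteq> ann u}"
  have ann_sub: "is_sub R (right_regular R) (ann u)" if "u \<in> carrier M" for u
    unfolding ann_def by (rule annihilator_sub[OF assms(2) that])
  have "ann w \<in> C" using assms(3,4) unfolding C_def by blast
  then have "C \<noteq> {}" by blast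
  moreover have "is_sub R (right_regular R) V" if "V \<in> C" for V
    using that ann_sub unfolding C_def by auto
  ultimately obtain V where V: "V \<in> C" "\<And>V'. V' \<in> C \<Longrightarrow> V \<subseteq> V' \<Longrightarrow> V' = V"
    using noeth_maximal[OF assms(1), of C] by metis
  then obtain u where u: "V = ann u" "u \<in> carrier M" "u \<notin> L" "ann w \<subseteq> ann u" unfolding C_def by blast
  have "ideal (ann u) R" using ann_sub[OF u(2)] by (simp add: sub_right_regular_iff)
  then have "primeideal (ann u) R"
  proof (rule primeidealI[OF _ cring_axioms])
    have "\<one> \<notin> ann u" using u(2,3) by (simp add: ann_def)
    then show "carrier R \<noteq> ann u" by (metis one_closed)
    fix a b assume ab: "a \<in> carrier R" "b \<in> carrier R" "a \<otimes> b \<in> ann u"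
    show "a \<in> ann u \<or> b \<in> ann u"
    proof (cases "b \<odot>\<^bsub>M\<^esub> u \<in> L")
      case True
      then show ?thesis using ab(2) by (simp add: ann_def)
    next
      case False
      \<comment> \<open>Since \<open>b\<close> times \<open>u\<close> is outside \<open>L\<close>,
        maximality forces its annihilator to equal that of \<open>u\<close>; and it contains
        \<open>a\<close>.\<close>
      have "ann u \<subseteq> ann (b \<odot>\<^bsub>M\<^esub> u)"
        using ab(2) u(2) D(4) by (auto simp: ann_def smult_smult[of _ b])
      then have "ann (b \<odot>\<^bsub>M\<^esub> u) = ann u"
        using V(2)[of "ann (b \<odot>\<^bsub>M\<^esub> u)"] u ab(2) False unfolding C_def by auto
      moreover have "a \<odot>\<^bsub>M\<^esub> (b \<odot>\<^bsub>M\<^esub> u) = (a \<otimes> b) \<odot>\<^bsub>M\<^esub> u"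
        using smult_assoc[of b a u] ab u(2) by (simp add: m_comm)
      then have "a \<in> ann (b \<odot>\<^bsub>M\<^esub> u)" using ab u(2) by (simp add: ann_def)
      ultimately show ?thesis by simp
    qed
  qed
  then show ?thesis using that[of u] u unfolding ann_def by simp
qed

section \<open>Noetherian local domains: Nakayama's lemma and chains of primes\<close>

locale noeth_local = noetherian_domain R for R (structure) +
  assumes local: "local_ring R"
begin

abbreviation "\<mm> \<equiv> max_ideal R"

lemma noeth_R: "noeth R (right_regular R)"
  by (rule noeth_right_regular) (rule noetherian_ring_axioms cring_axioms)+

lemma max_ideal_unique: "maximalideal I R \<Longrightarrow> I = \<mm>"
  and maximalideal_max_ideal: "maximalideal \<mm> R"
proof -
  have ex1: "\<exists>!m. maximalideal m R" using local by (simp add: local_ring_def)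
  then show "maximalideal \<mm> R" unfolding max_ideal_def by (rule theI')
  then show "maximalideal I R \<Longrightarrow> I = \<mm>" using ex1 by blast
qed

lemma max_ideal_ideal: "ideal \<mm> R"
  using maximalideal_max_ideal maximalideal.axioms(1) by blast

lemma max_ideal_carrier: "a \<in> \<mm> \<Longrightarrow> a \<in> carrier R"
  using ideal.Icarr[OF max_ideal_ideal] .

lemma one_notin_max_ideal: "\<one> \<notin> \<mm>"
  using maximalideal.I_notcarr[OF maximalideal_max_ideal] ideal.one_imp_carrier[OF max_ideal_ideal] by auto

lemma proper_ideal_subset:
  assumes "ideal I R" "I \<noteq> carrier R"
  shows "I \<subseteq> \<mm>"
proof -
  let ?C = "{J. ideal J R \<and> J \<noteq> carrier R \<and> I \<subseteq> J}"
  have "\<exists>J \<in> ?C. \<forall>V \<in> ?C. J \<subseteq> V \<longrightarrow> V = J"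
    by (rule noeth_maximal[OF noeth_R]) (use assms sub_right_regular_iff in auto)
  then obtain J where J: "ideal J R" "J \<noteq> carrier R" "I \<subseteq> J" "\<And>V. V \<in> ?C \<Longrightarrow> J \<subseteq> V \<Longrightarrow> V = J"
    by auto
  have "maximalideal J R"
  proof (rule maximalidealI[OF J(1)])
    show "carrier R \<noteq> J" using J(2) by simp
    fix V assume V: "ideal V R" "J \<subseteq> V" "V \<subseteq> carrier R"
    then show "V = J \<or> V = carrier R" using J(3,4)
      by (metis (mono_tags, lifting) mem_Collect_eq subset_trans)
  qed
  then show ?thesis using max_ideal_unique J(3) by simp
qed

lemma unit_of_notin_max_ideal:
  assumes "a \<in> carrier R" "a \<notin> \<mm>"
  shows "a \<in> Units R"
proof -
  have "PIdl a = carrier R"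
    using proper_ideal_subset[OF cgenideal_ideal[OF assms(1)]] assms cgenideal_self by auto
  then have "\<one> \<in> PIdl a" by simp
  then obtain r where "r \<in> carrier R" "\<one> = r \<otimes> a" by (auto simp: cgenideal_def)
  then show ?thesis using assms(1) unfolding Units_def by (auto intro!: bexI[of _ r] simp: m_comm)
qed

lemma one_minus_unit:
  assumes "a \<in> \<mm>"
  shows "\<one> \<ominus> a \<in> Units R"
proof (rule unit_of_notin_max_ideal)
  have a: "a \<in> carrier R" using assms max_ideal_carrier by blast
  then show "\<one> \<ominus> a \<in> carrier R" by simp
  interpret m: ideal \<mm> R by (rule max_ideal_ideal)
  show "\<one> \<ominus> a \<notin> \<mm>"
  proof
    assume "\<one> \<ominus> a \<in> \<mm>"
    then have "(\<one> \<ominus> a) \<oplus> a \<in> \<mm>" using assms m.a_closed by blast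
    moreover have "(\<one> \<ominus> a) \<oplus> a = \<one>" using a by (simp add: minus_eq a_assoc l_neg)
    ultimately show False using one_notin_max_ideal by simp
  qed
qed

text \<open>Generators are discarded one at a time: a = l + x (c a + y) gives (1 - c x) a in the
  span of \<open>L\<close> and the remaining generators, and 1 - c x is a unit because
  \<open>x\<close> lies in the maximal ideal.\<close>

lemma nakayama:
  assumes "cmodule R N" "is_sub R N W" "is_sub R N L" "finite A" "A \<subseteq> W" "W \<subseteq> lspan R N (L \<union> A)"
    and x: "x \<in> \<mm>" and W: "\<And>w. w \<in> W \<Longrightarrow> \<exists>l \<in> L. \<exists>v \<in> W. w = l \<oplus>\<^bsub>N\<^esub> x \<odot>\<^bsub>N\<^esub> v"
  shows "W \<subseteq> L"
  using assms(4-6)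
proof (induction A)
  case empty
  then show ?case using rmodule.lspan_subset[OF _ assms(3) order_refl] assms(1) by (auto simp: cmodule_def)
next
  case (insert a A)
  interpret N: cmodule R N by fact
  let ?B = "L \<union> A"
  have a: "a \<in> W" "a \<in> carrier N" using insert.prems(1) is_subD(1)[OF assms(2)] by auto
  have B: "?B \<subseteq> carrier N" using insert.prems(1) is_subD(1)[OF assms(2)] is_subD(1)[OF assms(3)] by auto
  note S = N.lspan_sub[OF B]
  have xc: "x \<in> carrier R" using x max_ideal_carrier by blast
  obtain l v where lv: "l \<in> L" "v \<in> W" "a = l \<oplus>\<^bsub>N\<^esub> x \<odot>\<^bsub>N\<^esub> v" using W[OF a(1)] by blast
  have "v \<in> lspan R N (insert a ?B)" using lv(2) insert.prems(2) by auto
  then obtain c y where cy: "c \<in> carrier R" "y \<in> lspan R N ?B" "v = c \<odot>\<^bsub>N\<^esub> a \<oplus>\<^bsub>N\<^esub> y"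
    using N.lspan_insertE[OF _ a(2) B] by metis
  have yc: "y \<in> carrier N" using is_subD(5)[OF S cy(2)] .
  have lc: "l \<in> carrier N" using B lv(1) by blast
  have lS: "l \<in> lspan R N ?B" using lv(1) by (simp add: lspan_base)
  let ?k = "l \<oplus>\<^bsub>N\<^esub> x \<odot>\<^bsub>N\<^esub> y"
  have k: "?k \<in> lspan R N ?B" using is_subD(3,4)[OF S] lS cy(2) xc by blast
  have kc: "?k \<in> carrier N" using lc xc yc by simp
  have "a = ?k \<oplus>\<^bsub>N\<^esub> (c \<otimes> x) \<odot>\<^bsub>N\<^esub> a"
  proof -
    have "a = l \<oplus>\<^bsub>N\<^esub> x \<odot>\<^bsub>N\<^esub> (c \<odot>\<^bsub>N\<^esub> a \<oplus>\<^bsub>N\<^esub> y)" using lv(3) unfolding cy(3) .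
    also have "\<dots> = l \<oplus>\<^bsub>N\<^esub> ((c \<otimes> x) \<odot>\<^bsub>N\<^esub> a \<oplus>\<^bsub>N\<^esub> x \<odot>\<^bsub>N\<^esub> y)"
      using cy(1) yc xc a(2) by (simp add: N.smult_r_distr N.smult_assoc)
    finally show ?thesis using lc yc xc cy(1) a(2) by (simp add: N.M.a_ac)
  qed
  then have "(\<one> \<ominus> c \<otimes> x) \<odot>\<^bsub>N\<^esub> a = ?k"
  proof -
    assume eq: "a = ?k \<oplus>\<^bsub>N\<^esub> (c \<otimes> x) \<odot>\<^bsub>N\<^esub> a"
    have "(\<one> \<ominus> c \<otimes> x) \<odot>\<^bsub>N\<^esub> a = a \<oplus>\<^bsub>N\<^esub> \<ominus>\<^bsub>N\<^esub> ((c \<otimes> x) \<odot>\<^bsub>N\<^esub> a)"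
      using cy(1) xc a(2) by (simp add: minus_eq N.smult_l_distr N.smult_l_minus)
    also have "\<dots> = (?k \<oplus>\<^bsub>N\<^esub> (c \<otimes> x) \<odot>\<^bsub>N\<^esub> a) \<oplus>\<^bsub>N\<^esub> \<ominus>\<^bsub>N\<^esub> ((c \<otimes> x) \<odot>\<^bsub>N\<^esub> a)"
      using eq by simp
    also have "\<dots> = ?k" using kc cy(1) xc a(2) by (simp add: N.M.a_assoc N.M.r_neg)
    finally show ?thesis .
  qed
  moreover have u: "\<one> \<ominus> c \<otimes> x \<in> Units R"
    using one_minus_unit ideal.I_l_closed[OF max_ideal_ideal x cy(1)] by simp
  ultimately have "a = inv (\<one> \<ominus> c \<otimes> x) \<odot>\<^bsub>N\<^esub> ?k"
    using N.smult_assoc[of "\<one> \<ominus> c \<otimes> x" "inv (\<one> \<ominus> c \<otimes> x)" a] a(2)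
    by (metis N.smult_one Units_closed Units_inv_closed Units_r_inv)
  then have "a \<in> lspan R N ?B" using is_subD(4)[OF S _ k] u by (metis Units_inv_closed)
  then have "insert a ?B \<subseteq> lspan R N ?B" by (auto intro: lspan_base)
  from N.lspan_subset[OF S this] have "W \<subseteq> lspan R N ?B" using insert.prems(2) by simp
  with insert.IH insert.prems(1) show ?case by blast
qed

text \<open>Going up along a regular sequence: if \<open>p\<close> is the annihilator of a nonzero element of
  \<open>N/(x\<^sub>1, \<dots>, x\<^sub>j)N\<close>, then Nakayama's lemma for the elements killed by \<open>p\<close> yields an element of
  \<open>N/(x\<^sub>1, \<dots>, x\<^sub>j\<^sub>+\<^sub>1)N\<close> with prime annihilator containing \<open>p\<close> and \<open>x\<^sub>j\<^sub>+\<^sub>1\<close>.\<close>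
lemma regular_sequence_prime_chain:
  assumes "cmodule R N" "fin_gen R N" "x \<in> UNIV \<rightarrow> carrier R" "\<And>i. i < n \<Longrightarrow> x i \<in> \<mm>" "weakly_regular N x n"
    and v: "v \<in> carrier N" "v \<noteq> \<zero>\<^bsub>N\<^esub>" and a: "a \<in> carrier R" "a \<odot>\<^bsub>N\<^esub> v = \<zero>\<^bsub>N\<^esub>"
  shows "\<exists>p u. (\<forall>i\<le>n. primeideal (p i) R) \<and> (\<forall>i<n. p i \<subset> p (Suc i)) \<and> a \<in> p 0 \<and>
    u \<in> carrier N \<and> u \<notin> seq_mult N x n \<and> p n = {r \<in> carrier R. r \<odot>\<^bsub>N\<^esub> u \<in> seq_mult N x n}"
  using assms(4,5)
proof (induction n)
  case 0
  interpret N: cmodule R N by fact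
  have "v \<notin> {\<zero>\<^bsub>N\<^esub>}" using v(2) by simp
  from N.exists_associated_prime[OF noeth_R N.sub_zero v(1) this]
  obtain u where u: "u \<in> carrier N" "u \<notin> {\<zero>\<^bsub>N\<^esub>}" "primeideal {r \<in> carrier R. r \<odot>\<^bsub>N\<^esub> u \<in> {\<zero>\<^bsub>N\<^esub>}} R"
    "{r \<in> carrier R. r \<odot>\<^bsub>N\<^esub> v \<in> {\<zero>\<^bsub>N\<^esub>}} \<subseteq> {r \<in> carrier R. r \<odot>\<^bsub>N\<^esub> u \<in> {\<zero>\<^bsub>N\<^esub>}}" .
  then show ?case
    using a by (intro exI[of _ "\<lambda>_. {r \<in> carrier R. r \<odot>\<^bsub>N\<^esub> u \<in> {\<zero>\<^bsub>N\<^esub>}}"] exI[of _ u]) auto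
next
  case (Suc n)
  interpret N: cmodule R N by fact
  have xj: "x \<in> {..<j} \<rightarrow> carrier R" for j using assms(3) by auto
  let ?I = "seq_mult N x n" and ?J = "seq_mult N x (Suc n)"
  note SI = N.seq_mult_sub[OF xj[of n]] and SJ = N.seq_mult_sub[OF xj[of "Suc n"]]
  note D = is_subD[OF SI]
  have xn: "x n \<in> \<mm>" "x n \<in> carrier R" using Suc.prems(1) assms(3) by auto
  obtain p u where p: "\<forall>i\<le>n. primeideal (p i) R" "\<forall>i<n. p i \<subset> p (Suc i)" "a \<in> p 0"
    and u: "u \<in> carrier N" "u \<notin> ?I" "p n = {r \<in> carrier R. r \<odot>\<^bsub>N\<^esub> u \<in> ?I}"
    using Suc.IH Suc.prems weakly_regular_mono[OF Suc.prems(2), of n] by auto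
  \<comment> \<open>The elements killed by \<open>p n\<close> modulo \<open>?I\<close>. Since
    \<open>u\<close> is one of them outside \<open>?I\<close>, Nakayama's lemma forbids that
    \<open>?I\<close> and \<open>x n\<close> times \<open>?W\<close> together exhaust
    \<open>?W\<close>.\<close>
  let ?W = "{w \<in> carrier N. \<forall>r \<in> p n. r \<odot>\<^bsub>N\<^esub> w \<in> ?I}"
  have pn: "r \<in> carrier R" if "r \<in> p n" for r using that u(3) by simp
  have SW: "is_sub R N ?W"
  proof
    show "\<zero>\<^bsub>N\<^esub> \<in> ?W" using D(2) pn by auto
    show "w \<oplus>\<^bsub>N\<^esub> w' \<in> ?W" if "w \<in> ?W" "w' \<in> ?W" for w w'
      using that D(3) pn by (auto simp: N.smult_r_distr)
    show "r \<odot>\<^bsub>N\<^esub> w \<in> ?W" if "r \<in> carrier R" "w \<in> ?W" for r w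
      using that D(4) pn by (auto simp: N.smult_smult[of _ r])
  qed auto
  have "\<exists>w \<in> ?W. \<not> (\<exists>l \<in> ?I. \<exists>v \<in> ?W. w = l \<oplus>\<^bsub>N\<^esub> x n \<odot>\<^bsub>N\<^esub> v)"
  proof (rule ccontr)
    assume "\<not> ?thesis"
    then have *: "\<exists>l \<in> ?I. \<exists>v \<in> ?W. w = l \<oplus>\<^bsub>N\<^esub> x n \<odot>\<^bsub>N\<^esub> v" if "w \<in> ?W" for w using that by auto
    have "noeth R N" by (rule noeth_of_fin_gen[OF noeth_R N.rmodule_axioms assms(2)])
    then obtain A where A: "finite A" "A \<subseteq> ?W" "?W \<subseteq> lspan R N A" using SW unfolding noeth_def by meson
    have IA: "?I \<union> A \<subseteq> carrier N" using A(2) D(1) by blast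
    have "lspan R N A \<subseteq> lspan R N (?I \<union> A)"
      by (rule N.lspan_subset[OF N.lspan_sub[OF IA]]) (auto intro: lspan_base)
    then have "?W \<subseteq> ?I" using A by (intro nakayama[OF assms(1) SW SI A(1,2) _ xn(1) *]) auto
    moreover have "u \<in> ?W" using u(1,3) by simp
    ultimately show False using u(2) by blast
  qed
  then obtain w where w: "w \<in> carrier N" "\<And>r. r \<in> p n \<Longrightarrow> r \<odot>\<^bsub>N\<^esub> w \<in> ?I"
    "\<And>l v. l \<in> ?I \<Longrightarrow> v \<in> ?W \<Longrightarrow> w \<noteq> l \<oplus>\<^bsub>N\<^esub> x n \<odot>\<^bsub>N\<^esub> v" by blast
  \<comment> \<open>If w = l + x_n z, then x_n r z is in \<open>?I\<close> for every
    \<open>r\<close> in \<open>p n\<close>; cancelling \<open>x n\<close> puts \<open>z\<close> into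
    \<open>?W\<close>, against the choice of \<open>w\<close>.\<close>
  have "w \<notin> ?J"
  proof
    assume "w \<in> ?J"
    then obtain l z where lz: "l \<in> ?I" "z \<in> carrier N" "w = l \<oplus>\<^bsub>N\<^esub> x n \<odot>\<^bsub>N\<^esub> z" by auto
    have "r \<odot>\<^bsub>N\<^esub> z \<in> ?I" if r: "r \<in> p n" for r
    proof -
      have lc: "l \<in> carrier N" using D(5) lz(1) .
      have "x n \<odot>\<^bsub>N\<^esub> (r \<odot>\<^bsub>N\<^esub> z) \<oplus>\<^bsub>N\<^esub> r \<odot>\<^bsub>N\<^esub> l = r \<odot>\<^bsub>N\<^esub> w"
        using lz lc pn[OF r] xn(2) by (simp add: N.smult_r_distr N.smult_smult N.M.a_comm)
      then have "x n \<odot>\<^bsub>N\<^esub> (r \<odot>\<^bsub>N\<^esub> z) \<oplus>\<^bsub>N\<^esub> r \<odot>\<^bsub>N\<^esub> l \<in> ?I" using w(2)[OF r] by simp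
      then have "x n \<odot>\<^bsub>N\<^esub> (r \<odot>\<^bsub>N\<^esub> z) \<in> ?I"
        using N.sub_add_cancel[OF SI _ D(4)[OF pn[OF r] lz(1)]] pn[OF r] xn(2) lz(2) by simp
      then show ?thesis using weakly_regularD[OF Suc.prems(2), of n] pn[OF r] lz(2) by simp
    qed
    then have "z \<in> ?W" using lz(2) by simp
    then show False using w(3)[OF lz(1)] lz(3) by blast
  qed
  from N.exists_associated_prime[OF noeth_R SJ w(1) this] obtain u'
    where u': "u' \<in> carrier N" "u' \<notin> ?J" "primeideal {r \<in> carrier R. r \<odot>\<^bsub>N\<^esub> u' \<in> ?J} R"
    "{r \<in> carrier R. r \<odot>\<^bsub>N\<^esub> w \<in> ?J} \<subseteq> {r \<in> carrier R. r \<odot>\<^bsub>N\<^esub> u' \<in> ?J}" .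
  let ?q = "{r \<in> carrier R. r \<odot>\<^bsub>N\<^esub> u' \<in> ?J}"
  have "p n \<subseteq> ?q"
  proof
    fix r assume r: "r \<in> p n"
    have "r \<odot>\<^bsub>N\<^esub> w \<in> ?J" using N.seq_mult_mono[OF xj w(2)[OF r]] .
    then show "r \<in> ?q" using u'(4) pn[OF r] by auto
  qed
  moreover have "x n \<in> ?q" using N.seq_mult_smult[OF xj, of n "Suc n" u'] u'(1) xn(2) by simp
  \<comment> \<open>By regularity \<open>x n\<close> cannot move \<open>u\<close> into
    \<open>?I\<close>; this makes the inclusion of the primes strict.\<close>
  moreover have "x n \<notin> p n" using u weakly_regularD[OF Suc.prems(2), of n u] by auto
  ultimately have sub: "p n \<subset> ?q" by blast
  let ?p = "p(Suc n := ?q)"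
  have "\<forall>i\<le>Suc n. primeideal (?p i) R" using p(1) u'(3) by (auto simp: le_Suc_eq)
  moreover have "\<forall>i<Suc n. ?p i \<subset> ?p (Suc i)" using p(2) sub by (auto simp: less_Suc_eq)
  moreover have "a \<in> ?p 0" using p(3) by simp
  ultimately show ?case using u'(1,2) by (intro exI[of _ ?p] exI[of _ u']) simp
qed

end

lemma seq_mult_cong: "(\<And>i. i < j \<Longrightarrow> x i = y i) \<Longrightarrow> seq_mult N x j = seq_mult N y j"
  by (induction j) auto

lemma weakly_regular_cong:
  assumes "\<And>i. i < k \<Longrightarrow> x i = y i" "weakly_regular N x k"
  shows "weakly_regular N y k"
proof -
  have "seq_mult N x i = seq_mult N y i" if "i < k" for i
    by (rule seq_mult_cong) (use that assms(1) in auto)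
  then show ?thesis using assms unfolding weakly_regular_def by simp
qed

section \<open>Maximal Cohen-Macaulay modules over a ring of dimension d\<close>

locale noeth_local_dim = noeth_local +
  fixes d :: nat
  assumes dim: "krull_dim R = enat d"
begin

lemma prime_chain_le:
  assumes "\<And>i. i \<le> n \<Longrightarrow> primeideal (p i) R" "\<And>i. i < n \<Longrightarrow> p i \<subset> p (Suc i)"
  shows "n \<le> d"
proof -
  have "enat n \<le> krull_dim R" unfolding krull_dim_def by (rule Sup_upper) (use assms in blast)
  then show ?thesis using dim by simp
qed

text \<open>Depth does not exceed dimension: the sequence produces a strict chain of primes of its
  own length.\<close>

lemma regular_sequence_length:
  assumes "cmodule R N" "fin_gen R N" "set xs \<subseteq> \<mm>" "regular_sequence R N xs"
  shows "length xs \<le> d"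
proof -
  interpret N: cmodule R N by fact
  define x where "x i = (if i < length xs then xs ! i else \<zero>)" for i
  have xs: "set xs \<subseteq> carrier R" using assms(3) max_ideal_carrier by blast
  have x: "x \<in> UNIV \<rightarrow> carrier R" using subsetD[OF xs nth_mem] by (auto simp: x_def)
  have xm: "x i \<in> \<mm>" if "i < length xs" for i using that assms(3) by (auto simp: x_def)
  have xeq: "xs ! i = x i" if "i < length xs" for i using that by (simp add: x_def)
  have "weakly_regular N (\<lambda>i. xs ! i) (length xs)" and ne: "seq_mult N (\<lambda>i. xs ! i) (length xs) \<noteq> carrier N"
    using assms(4) N.regular_sequence_iff[OF xs] by auto
  from this(1) have wr: "weakly_regular N x (length xs)"
    by (rule weakly_regular_cong[rotated]) (rule xeq)
  have "seq_mult N (\<lambda>i. xs ! i) (length xs) = seq_mult N x (length xs)" by (rule seq_mult_cong) (rule xeq)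
  then have ne': "seq_mult N x (length xs) \<noteq> carrier N" using ne by simp
  have S: "is_sub R N (seq_mult N x (length xs))" by (rule N.seq_mult_sub) (use x in auto)
  obtain v where "v \<in> carrier N" "v \<noteq> \<zero>\<^bsub>N\<^esub>" using ne' is_subD(1,2)[OF S] by blast
  from regular_sequence_prime_chain[OF assms(1,2) x xm wr this zero_closed]
  show ?thesis using prime_chain_le \<open>v \<in> carrier N\<close> by auto
qed

text \<open>The form in which the property is used from here on; it absorbs the zero module, on
  which every sequence is weakly regular. Conversely, on a nonzero module the prime chain provides
  an element outside (x)N, so the sequence is regular in the strict sense, and depth is at most
  \<open>d\<close> in any case.\<close>

lemma MCM_iff:
  "MCM R N \<longleftrightarrow> cmodule R N \<and> fin_gen R N \<and>
     (\<exists>x \<in> UNIV \<rightarrow> carrier R. (\<forall>i < d. x i \<in> \<mm>) \<and> weakly_regular N x d)" (is "?L \<longleftrightarrow> ?R")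
proof
  assume L: ?L
  then have N: "cmodule R N" "fin_gen R N" by (auto simp: MCM_def cmodule_iff)
  interpret N: cmodule R N by fact
  have "\<exists>x \<in> UNIV \<rightarrow> carrier R. (\<forall>i < d. x i \<in> \<mm>) \<and> weakly_regular N x d"
  proof (cases "is_zero N")
    case True
    have "\<zero> \<in> \<mm>" using additive_subgroup.zero_closed ideal.axioms(1)[OF max_ideal_ideal] by blast
    moreover have "weakly_regular N (\<lambda>_. \<zero>) d"
      unfolding weakly_regular_def
    proof (intro allI impI ballI)
      fix i y assume "y \<in> carrier N"
      then have "y = \<zero>\<^bsub>N\<^esub>" using True by (simp add: is_zero_def)
      moreover have "is_sub R N (seq_mult N (\<lambda>_. \<zero>) i)" by (rule N.seq_mult_sub) auto
      ultimately show "y \<in> seq_mult N (\<lambda>_. \<zero>) i" using is_subD(2) by metis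
    qed
    ultimately show ?thesis by (intro bexI[of _ "\<lambda>_. \<zero>"]) auto
  next
    case False
    then have dep: "depth R N = enat d" using L dim by (simp add: MCM_def)
    \<comment> \<open>If all admissible sequences were shorter than \<open>d\<close>, their supremum
      would be at most d - 1. For d = 0 this subtraction would truncate, so that case is set
      apart.\<close>
    have "\<exists>xs. d \<le> length xs \<and> set xs \<subseteq> \<mm> \<and> regular_sequence R N xs \<or> d = 0"
    proof (rule ccontr)
      assume no: "\<not> ?thesis"
      have "depth R N \<le> enat (d - 1)"
        unfolding depth_def
      proof (rule Sup_least)
        fix e assume "e \<in> {enat (length xs) |xs. set xs \<subseteq> \<mm> \<and> regular_sequence R N xs}"
        then obtain xs where "e = enat (length xs)" "set xs \<subseteq> \<mm>" "regular_sequence R N xs" by blast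
        then show "e \<le> enat (d - 1)" using no by (auto simp: not_le)
      qed
      then show False using dep no by auto
    qed
    then show ?thesis
    proof (elim exE disjE)
      assume "d = 0"
      then show ?thesis using weakly_regular_0 by (intro bexI[of _ "\<lambda>_. \<zero>"]) auto
    next
      fix xs assume xs: "d \<le> length xs \<and> set xs \<subseteq> \<mm> \<and> regular_sequence R N xs"
      then have xsc: "set xs \<subseteq> carrier R" using max_ideal_carrier by blast
      define x where "x i = (if i < d then xs ! i else \<zero>)" for i
      have "weakly_regular N (\<lambda>i. xs ! i) (length xs)"
        using xs N.regular_sequence_iff[OF xsc] by blast
      then have "weakly_regular N (\<lambda>i. xs ! i) d" using xs weakly_regular_mono by blast
      then have "weakly_regular N x d" by (rule weakly_regular_cong[rotated]) (simp add: x_def)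
      moreover have "x \<in> UNIV \<rightarrow> carrier R" using xs subsetD[OF xsc nth_mem] by (auto simp: x_def)
      moreover have "\<forall>i<d. x i \<in> \<mm>" using xs by (auto simp: x_def)
      ultimately show ?thesis by blast
    qed
  qed
  then show ?R using N by blast
next
  assume R: ?R
  then obtain x where x: "x \<in> UNIV \<rightarrow> carrier R" "\<And>i. i < d \<Longrightarrow> x i \<in> \<mm>" "weakly_regular N x d" by blast
  from R have N: "cmodule R N" "fin_gen R N" by auto
  interpret N: cmodule R N by fact
  have "depth R N = krull_dim R" if nz: "\<not> is_zero N"
    unfolding dim
  proof (rule antisym)
    show "depth R N \<le> enat d"
      unfolding depth_def by (rule Sup_least) (use regular_sequence_length[OF N] in auto)
    let ?xs = "map x [0..<d]"
    have xs: "set ?xs \<subseteq> carrier R" "set ?xs \<subseteq> \<mm>" using x(1,2) by auto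
    have xeq: "x i = ?xs ! i" if "i < d" for i using that by simp
    obtain v where v: "v \<in> carrier N" "v \<noteq> \<zero>\<^bsub>N\<^esub>" using nz unfolding is_zero_def by blast
    obtain u where u: "u \<in> carrier N" "u \<notin> seq_mult N x d"
      using regular_sequence_prime_chain[OF N x v zero_closed] v(1) by auto
    have eq: "seq_mult N ((!) ?xs) d = seq_mult N x d" by (rule seq_mult_cong) simp
    have "weakly_regular N ((!) ?xs) d" by (rule weakly_regular_cong[OF xeq x(3)])
    then have "regular_sequence R N ?xs" using N.regular_sequence_iff[OF xs(1)] eq u by auto
    then show "enat d \<le> depth R N"
      unfolding depth_def by (intro Sup_upper) (use xs(2) in \<open>auto intro!: exI[of _ ?xs]\<close>)
  qed
  then show ?L using N by (auto simp: MCM_def cmodule_iff)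
qed

lemma MCM_in_add:
  assumes "MCM R M" "cmodule R N" "in_add R M N"
  shows "MCM R N"
proof -
  have M: "cmodule R M" "fin_gen R M" using assms(1) MCM_iff by auto
  obtain x where x: "x \<in> UNIV \<rightarrow> carrier R" "\<forall>i < d. x i \<in> \<mm>" "weakly_regular M x d"
    using assms(1) unfolding MCM_iff by blast
  have "weakly_regular N x d" by (rule weakly_regular_in_add[OF M(1) assms(2,3) _ x(3)]) (use x(1) in auto)
  moreover have "fin_gen R N"
    by (rule in_add_fin_gen[OF _ _ assms(3) M(2)]) (use M(1) assms(2) in \<open>auto simp: cmodule_def\<close>)
  ultimately show ?thesis using assms(2) x MCM_iff by blast
qed

text \<open>A nonzero scalar killing a nonzero element lies in the lowest prime of a chain of length
  \<open>d\<close>. The zero ideal can be put below that prime, which makes the chain longer than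
  the dimension allows.\<close>

lemma MCM_torsion_free:
  assumes "MCM R N"
  shows "torsion_free R N"
  unfolding torsion_free_def
proof (intro ballI impI)
  fix a v assume a: "a \<in> carrier R" and v: "v \<in> carrier N" and av: "a \<odot>\<^bsub>N\<^esub> v = \<zero>\<^bsub>N\<^esub>"
  show "a = \<zero> \<or> v = \<zero>\<^bsub>N\<^esub>"
  proof (rule ccontr)
    assume ne: "\<not> ?thesis"
    have N: "cmodule R N" "fin_gen R N" using assms MCM_iff by auto
    obtain x where x: "x \<in> UNIV \<rightarrow> carrier R" "\<And>i. i < d \<Longrightarrow> x i \<in> \<mm>" "weakly_regular N x d"
      using assms unfolding MCM_iff by blast
    have "v \<noteq> \<zero>\<^bsub>N\<^esub>" using ne by blast
    from regular_sequence_prime_chain[OF N x v this a av]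
    obtain p where p: "\<And>i. i \<le> d \<Longrightarrow> primeideal (p i) R" "\<And>i. i < d \<Longrightarrow> p i \<subset> p (Suc i)" "a \<in> p 0"
      by auto
    let ?p = "\<lambda>i. case i of 0 \<Rightarrow> {\<zero>} | Suc k \<Rightarrow> p k"
    have "\<zero> \<in> p 0" using additive_subgroup.zero_closed ideal.axioms(1) primeideal.axioms(1) p(1)[of 0]
      by blast
    then have "{\<zero>} \<subset> p 0" using ne p(3) by blast
    then have "Suc d \<le> d"
      by (intro prime_chain_le[of "Suc d" ?p]) (auto simp: zeroprimeideal p(1,2) split: nat.split)
    then show False by simp
  qed
qed

end

section \<open>Decomposition into indecomposable modules\<close>

definition direct_sum :: "('a, 'c) ring_scheme \<Rightarrow> ('a, 'm) module \<Rightarrow> 'm set \<Rightarrow> 'm set \<Rightarrow> bool" where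
  "direct_sum \<Lambda> N A B \<longleftrightarrow> is_sub \<Lambda> N A \<and> is_sub \<Lambda> N B \<and> A \<inter> B = {\<zero>\<^bsub>N\<^esub>} \<and>
     (\<forall>x \<in> carrier N. \<exists>a \<in> A. \<exists>b \<in> B. x = a \<oplus>\<^bsub>N\<^esub> b)"

lemma submodule_iff_is_sub:
  assumes "module R M"
  shows "submodule H R M \<longleftrightarrow> is_sub R M H"
proof
  assume "submodule H R M"
  moreover have "\<zero>\<^bsub>M\<^esub> \<in> H"
    using subgroup.one_closed[OF submodule.axioms(1)[OF \<open>submodule H R M\<close>]] by simp
  ultimately show "is_sub R M H" using module.submoduleE[OF assms, of H] by (auto simp: is_sub_def)
next
  interpret M: rmodule R M using assms module_iff_rmodule by blast
  assume H: "is_sub R M H"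
  show "submodule H R M" by (rule module.submoduleI[OF assms]) (use is_subD[OF H] M.sub_minus[OF H] in auto)
qed

lemma internal_direct_sum_iff:
  assumes "module R M"
  shows "internal_direct_sum R M A B \<longleftrightarrow> direct_sum R M A B"
  unfolding internal_direct_sum_def direct_sum_def submodule_iff_is_sub[OF assms] set_add_def'
proof -
  interpret M: rmodule R M using assms module_iff_rmodule by blast
  have "(\<Union>h\<in>A. \<Union>k\<in>B. {h \<oplus>\<^bsub>M\<^esub> k}) = carrier M \<longleftrightarrow>
    (\<forall>x \<in> carrier M. \<exists>a \<in> A. \<exists>b \<in> B. x = a \<oplus>\<^bsub>M\<^esub> b)" if "is_sub R M A" "is_sub R M B"
    using is_subD(5)[OF that(1)] is_subD(5)[OF that(2)] by (auto simp: set_eq_iff subset_eq)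
  then show "is_sub R M A \<and> is_sub R M B \<and> A \<inter> B = {\<zero>\<^bsub>M\<^esub>} \<and>
      (\<Union>h\<in>A. \<Union>k\<in>B. {h \<oplus>\<^bsub>M\<^esub> k}) = carrier M \<longleftrightarrow>
    is_sub R M A \<and> is_sub R M B \<and> A \<inter> B = {\<zero>\<^bsub>M\<^esub>} \<and>
      (\<forall>x \<in> carrier M. \<exists>a \<in> A. \<exists>b \<in> B. x = a \<oplus>\<^bsub>M\<^esub> b)" by blast
qed

lemma direct_sum_proj:
  assumes "rmodule \<Lambda> N" "direct_sum \<Lambda> N A B"
  obtains p where "is_linear \<Lambda> N (N\<lparr>carrier := A\<rparr>) p" "\<And>x. x \<in> carrier N \<Longrightarrow> x \<ominus>\<^bsub>N\<^esub> p x \<in> B"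
    "\<And>a. a \<in> A \<Longrightarrow> p a = a"
proof -
  interpret N: rmodule \<Lambda> N by fact
  have A: "is_sub \<Lambda> N A" and B: "is_sub \<Lambda> N B" and AB: "A \<inter> B = {\<zero>\<^bsub>N\<^esub>}"
    and ex: "\<forall>x \<in> carrier N. \<exists>a \<in> A. \<exists>b \<in> B. x = a \<oplus>\<^bsub>N\<^esub> b"
    using assms(2) unfolding direct_sum_def by simp_all
  note a = is_subD[OF A] and b = is_subD[OF B]
  define p where "p x = (SOME u. u \<in> A \<and> x \<ominus>\<^bsub>N\<^esub> u \<in> B)" for x
  have p: "p x \<in> A \<and> x \<ominus>\<^bsub>N\<^esub> p x \<in> B" if "x \<in> carrier N" for x
    unfolding p_def
  proof (rule someI_ex)
    from ex[rule_format, OF that] obtain u v where uv: "u \<in> A" "v \<in> B" "x = u \<oplus>\<^bsub>N\<^esub> v"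
      by (elim bexE)
    have c: "u \<in> carrier N" "v \<in> carrier N" using a(5)[OF uv(1)] b(5)[OF uv(2)] .
    have "x \<ominus>\<^bsub>N\<^esub> u = (v \<oplus>\<^bsub>N\<^esub> u) \<ominus>\<^bsub>N\<^esub> u" using c uv(3) by (simp add: N.M.a_comm)
    also have "\<dots> = v" using c by (simp add: N.M.minus_eq N.M.a_assoc N.M.r_neg)
    finally have "x \<ominus>\<^bsub>N\<^esub> u = v" .
    then show "\<exists>u. u \<in> A \<and> x \<ominus>\<^bsub>N\<^esub> u \<in> B" using uv by blast
  qed
  have uniq: "u = p x" if "u \<in> A" "x \<ominus>\<^bsub>N\<^esub> u \<in> B" "x \<in> carrier N" for u x
  proof -
    have c: "u \<in> carrier N" "p x \<in> carrier N" using that p a(5) by auto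
    have "u \<ominus>\<^bsub>N\<^esub> p x = (x \<ominus>\<^bsub>N\<^esub> p x) \<ominus>\<^bsub>N\<^esub> (x \<ominus>\<^bsub>N\<^esub> u)"
      using c that(3) by (simp add: N.M.minus_eq N.M.minus_add N.M.a_ac N.M.r_neg1 N.M.r_neg2 N.M.r_neg)
    then have "u \<ominus>\<^bsub>N\<^esub> p x \<in> B" using p[OF that(3)] that(2) N.sub_diff[OF B] by simp
    moreover have "u \<ominus>\<^bsub>N\<^esub> p x \<in> A" using p[OF that(3)] that(1) N.sub_diff[OF A] by simp
    ultimately have "u \<ominus>\<^bsub>N\<^esub> p x \<in> A \<inter> B" by blast
    then have "u \<ominus>\<^bsub>N\<^esub> p x = \<zero>\<^bsub>N\<^esub>" using AB by blast
    moreover have "(u \<ominus>\<^bsub>N\<^esub> p x) \<oplus>\<^bsub>N\<^esub> p x = u" using c by (simp add: N.M.minus_eq N.M.a_assoc N.M.l_neg)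
    ultimately show ?thesis using c by simp
  qed
  have "is_linear \<Lambda> N (N\<lparr>carrier := A\<rparr>) p"
  proof
    show "p x \<in> carrier (N\<lparr>carrier := A\<rparr>)" if "x \<in> carrier N" for x using p[OF that] by simp
  next
    fix x y assume xy: "x \<in> carrier N" "y \<in> carrier N"
    note px = p[OF xy(1)] and py = p[OF xy(2)]
    have c: "p x \<in> carrier N" "p y \<in> carrier N" using px py a(5) by auto
    have "(x \<oplus>\<^bsub>N\<^esub> y) \<ominus>\<^bsub>N\<^esub> (p x \<oplus>\<^bsub>N\<^esub> p y) = (x \<ominus>\<^bsub>N\<^esub> p x) \<oplus>\<^bsub>N\<^esub> (y \<ominus>\<^bsub>N\<^esub> p y)"
      using c xy by (simp add: N.M.minus_eq N.M.minus_add N.M.a_ac)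
    also have "\<dots> \<in> B" using px py b(3) by blast
    finally show "p (x \<oplus>\<^bsub>N\<^esub> y) = p x \<oplus>\<^bsub>N\<lparr>carrier := A\<rparr>\<^esub> p y"
      using uniq[of "p x \<oplus>\<^bsub>N\<^esub> p y" "x \<oplus>\<^bsub>N\<^esub> y"] px py a(3) xy by simp
  next
    fix c x assume cx: "c \<in> carrier \<Lambda>" "x \<in> carrier N"
    note px = p[OF cx(2)]
    have "c \<odot>\<^bsub>N\<^esub> x \<ominus>\<^bsub>N\<^esub> c \<odot>\<^bsub>N\<^esub> p x = c \<odot>\<^bsub>N\<^esub> (x \<ominus>\<^bsub>N\<^esub> p x)"
      using cx px a(5) by (simp add: N.smult_r_diff)
    also have "\<dots> \<in> B" using px b(4) cx by blast
    finally show "p (c \<odot>\<^bsub>N\<^esub> x) = c \<odot>\<^bsub>N\<lparr>carrier := A\<rparr>\<^esub> p x"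
      using uniq[of "c \<odot>\<^bsub>N\<^esub> p x" "c \<odot>\<^bsub>N\<^esub> x"] px a(4) cx by simp
  qed
  moreover have "p u = u" if "u \<in> A" for u
    using uniq[OF that, of u] a(5)[OF that] b(2) by (simp add: N.M.minus_eq N.M.r_neg)
  ultimately show ?thesis using that p by blast
qed

lemma is_linear_inv:
  assumes "rmodule \<Lambda> N" "is_linear \<Lambda> N L f" "bij_betw f (carrier N) (carrier L)"
  shows "is_linear \<Lambda> L N (inv_into (carrier N) f)"
proof
  interpret N: rmodule \<Lambda> N by fact
  let ?g = "inv_into (carrier N) f"
  note f = is_linearD[OF assms(2)]
  have g: "?g y \<in> carrier N" "f (?g y) = y" if "y \<in> carrier L" for y
    using that assms(3) by (auto simp: bij_betw_def inv_into_into f_inv_into_f)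
  have gf: "?g (f x) = x" if "x \<in> carrier N" for x using that assms(3) by (auto simp: bij_betw_def)
  show "?g y \<in> carrier N" if "y \<in> carrier L" for y using g that by blast
  show "?g (y \<oplus>\<^bsub>L\<^esub> z) = ?g y \<oplus>\<^bsub>N\<^esub> ?g z" if "y \<in> carrier L" "z \<in> carrier L" for y z
  proof -
    have "f (?g y \<oplus>\<^bsub>N\<^esub> ?g z) = y \<oplus>\<^bsub>L\<^esub> z" using g that by (simp add: f(2))
    then show ?thesis using gf[of "?g y \<oplus>\<^bsub>N\<^esub> ?g z"] g that by simp
  qed
  show "?g (a \<odot>\<^bsub>L\<^esub> y) = a \<odot>\<^bsub>N\<^esub> ?g y" if "a \<in> carrier \<Lambda>" "y \<in> carrier L" for a y
  proof -
    have "f (a \<odot>\<^bsub>N\<^esub> ?g y) = a \<odot>\<^bsub>L\<^esub> y" using g that by (simp add: f(3))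
    then show ?thesis using gf[of "a \<odot>\<^bsub>N\<^esub> ?g y"] g that by simp
  qed
qed

lemma lspan_mono_ring:
  assumes "carrier \<Lambda>' \<subseteq> carrier \<Lambda>" "x \<in> lspan \<Lambda>' N A"
  shows "x \<in> lspan \<Lambda> N A"
  using assms(2) by induction (use assms(1) in \<open>auto intro: lspan.intros\<close>)

lemma noeth_mono_ring:
  assumes "carrier \<Lambda>' \<subseteq> carrier \<Lambda>" "noeth \<Lambda>' N"
  shows "noeth \<Lambda> N"
  unfolding noeth_def
proof (intro allI impI)
  fix W assume "is_sub \<Lambda> N W"
  then have "is_sub \<Lambda>' N W" by (rule is_sub_mono[OF _ assms(1)])
  then obtain A where "finite A" "A \<subseteq> W" "W \<subseteq> lspan \<Lambda>' N A" using assms(2) unfolding noeth_def by meson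
  then show "\<exists>A. finite A \<and> A \<subseteq> W \<and> W \<subseteq> lspan \<Lambda> N A"
    using lspan_mono_ring[OF assms(1), of _ N A] by (intro exI[of _ A]) (simp add: subset_iff)
qed

lemma direct_sum_commute:
  assumes "rmodule \<Lambda> N" "direct_sum \<Lambda> N A B"
  shows "direct_sum \<Lambda> N B A"
proof -
  interpret N: rmodule \<Lambda> N by fact
  have AB: "is_sub \<Lambda> N A" "is_sub \<Lambda> N B" "A \<inter> B = {\<zero>\<^bsub>N\<^esub>}"
    "\<forall>x \<in> carrier N. \<exists>a \<in> A. \<exists>b \<in> B. x = a \<oplus>\<^bsub>N\<^esub> b"
    using assms(2) by (auto simp: direct_sum_def)
  have "\<exists>b \<in> B. \<exists>a \<in> A. x = b \<oplus>\<^bsub>N\<^esub> a" if "x \<in> carrier N" for x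
  proof -
    from AB(4)[rule_format, OF that] obtain a b where "a \<in> A" "b \<in> B" "x = a \<oplus>\<^bsub>N\<^esub> b" by (elim bexE)
    then show ?thesis using is_subD(5)[OF AB(1)] is_subD(5)[OF AB(2)] N.M.a_comm by metis
  qed
  then show ?thesis using AB by (auto simp: direct_sum_def Int_commute)
qed

text \<open>Moves the part \<open>B1\<close> of the complement over to \<open>A\<close>. This is the
  enlargement that contradicts maximality in \<open>CM_coset_in_add\<close>.\<close>

lemma direct_sum_assoc:
  assumes "rmodule \<Lambda> N" "direct_sum \<Lambda> N A B" "direct_sum \<Lambda> (N\<lparr>carrier := B\<rparr>) B1 B2"
  shows "direct_sum \<Lambda> N {a \<oplus>\<^bsub>N\<^esub> b | a b. a \<in> A \<and> b \<in> B1} B2"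
proof -
  interpret N: rmodule \<Lambda> N by fact
  have A: "is_sub \<Lambda> N A" and B: "is_sub \<Lambda> N B" and AB: "A \<inter> B = {\<zero>\<^bsub>N\<^esub>}"
    and ex: "\<forall>x \<in> carrier N. \<exists>a \<in> A. \<exists>b \<in> B. x = a \<oplus>\<^bsub>N\<^esub> b"
    using assms(2) unfolding direct_sum_def by simp_all
  have C1: "is_sub \<Lambda> (N\<lparr>carrier := B\<rparr>) B1" and C2: "is_sub \<Lambda> (N\<lparr>carrier := B\<rparr>) B2"
    and B12: "B1 \<inter> B2 = {\<zero>\<^bsub>N\<^esub>}"
    and ex2: "\<forall>x \<in> B. \<exists>a \<in> B1. \<exists>b \<in> B2. x = a \<oplus>\<^bsub>N\<^esub> b"
    using assms(3) unfolding direct_sum_def by simp_all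
  note B1 = is_sub_carrier_update[OF C1 is_subD(1)[OF B]]
    and B2 = is_sub_carrier_update[OF C2 is_subD(1)[OF B]]
  have sB: "B1 \<subseteq> B" "B2 \<subseteq> B" using is_subD(1)[OF C1] is_subD(1)[OF C2] by auto
  note a = is_subD[OF A] and b = is_subD[OF B] and b1 = is_subD[OF B1] and b2 = is_subD[OF B2]
  let ?V = "{a \<oplus>\<^bsub>N\<^esub> b | a b. a \<in> A \<and> b \<in> B1}"
  have "is_sub \<Lambda> N ?V"
  proof
    show "?V \<subseteq> carrier N" using a(5) b1(5) by auto
    show "\<zero>\<^bsub>N\<^esub> \<in> ?V" using a(2) b1(2) by (auto intro!: exI[of _ "\<zero>\<^bsub>N\<^esub>"])
  next
    fix x y assume "x \<in> ?V" "y \<in> ?V"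
    then obtain u v u' v' where *: "u \<in> A" "v \<in> B1" "x = u \<oplus>\<^bsub>N\<^esub> v" "u' \<in> A" "v' \<in> B1" "y = u' \<oplus>\<^bsub>N\<^esub> v'"
      by auto
    then have "x \<oplus>\<^bsub>N\<^esub> y = (u \<oplus>\<^bsub>N\<^esub> u') \<oplus>\<^bsub>N\<^esub> (v \<oplus>\<^bsub>N\<^esub> v')"
      using a(5) b1(5) by (simp add: N.M.a_ac)
    then show "x \<oplus>\<^bsub>N\<^esub> y \<in> ?V" using * a(3) b1(3) by blast
  next
    fix c x assume c: "c \<in> carrier \<Lambda>" and "x \<in> ?V"
    then obtain u v where *: "u \<in> A" "v \<in> B1" "x = u \<oplus>\<^bsub>N\<^esub> v" by auto
    then have "c \<odot>\<^bsub>N\<^esub> x = c \<odot>\<^bsub>N\<^esub> u \<oplus>\<^bsub>N\<^esub> c \<odot>\<^bsub>N\<^esub> v" using c a(5) b1(5) by (simp add: N.smult_r_distr)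
    then show "c \<odot>\<^bsub>N\<^esub> x \<in> ?V" using * c a(4) b1(4) by blast
  qed
  moreover have "?V \<inter> B2 = {\<zero>\<^bsub>N\<^esub>}"
  proof
    show "{\<zero>\<^bsub>N\<^esub>} \<subseteq> ?V \<inter> B2" using is_subD(2)[OF calculation] b2(2) by blast
    show "?V \<inter> B2 \<subseteq> {\<zero>\<^bsub>N\<^esub>}"
    proof
      fix x assume x: "x \<in> ?V \<inter> B2"
      then obtain u v where *: "u \<in> A" "v \<in> B1" "x = u \<oplus>\<^bsub>N\<^esub> v" by auto
      have c: "u \<in> carrier N" "v \<in> carrier N" using * a(5) b1(5) by auto
      have "u \<in> B" using N.sub_add_cancel[OF B c(1), of v] * x sB by auto
      then have "u = \<zero>\<^bsub>N\<^esub>" using AB *(1) by blast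
      then have "x = v" using *(3) c by simp
      then show "x \<in> {\<zero>\<^bsub>N\<^esub>}" using B12 * x by blast
    qed
  qed
  moreover have "\<exists>u \<in> ?V. \<exists>v \<in> B2. x = u \<oplus>\<^bsub>N\<^esub> v" if "x \<in> carrier N" for x
  proof -
    from ex[rule_format, OF that] obtain u w where uw: "u \<in> A" "w \<in> B" "x = u \<oplus>\<^bsub>N\<^esub> w" by (elim bexE)
    from ex2[rule_format, OF uw(2)] obtain v v' where v: "v \<in> B1" "v' \<in> B2" "w = v \<oplus>\<^bsub>N\<^esub> v'" by (elim bexE)
    have "x = (u \<oplus>\<^bsub>N\<^esub> v) \<oplus>\<^bsub>N\<^esub> v'"
      using uw v a(5)[OF uw(1)] b1(5)[OF v(1)] b2(5)[OF v(2)] by (simp add: N.M.a_assoc)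
    moreover have "u \<oplus>\<^bsub>N\<^esub> v \<in> ?V" using uw(1) v(1) by blast
    ultimately show ?thesis using v(2) by (intro bexI[of _ "u \<oplus>\<^bsub>N\<^esub> v"] bexI[of _ v'])
  qed
  ultimately show ?thesis using B2 by (simp add: direct_sum_def)
qed

text \<open>The identity is the sum of the two projections, and each of them factors through a
  summand in add M.\<close>

lemma in_add_direct_sum:
  assumes "rmodule \<Lambda> N" "direct_sum \<Lambda> N A B"
    "in_add \<Lambda> M (N\<lparr>carrier := A\<rparr>)" "in_add \<Lambda> M (N\<lparr>carrier := B\<rparr>)"
  shows "in_add \<Lambda> M N"
proof -
  interpret N: rmodule \<Lambda> N by fact
  have A: "is_sub \<Lambda> N A" and B: "is_sub \<Lambda> N B"
    using assms(2) unfolding direct_sum_def by simp_all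
  obtain p where p: "is_linear \<Lambda> N (N\<lparr>carrier := A\<rparr>) p" "\<And>x. x \<in> carrier N \<Longrightarrow> x \<ominus>\<^bsub>N\<^esub> p x \<in> B"
    using direct_sum_proj[OF assms(1,2)] by metis
  have pN: "is_linear \<Lambda> N N p" using is_linear_comp[OF p(1) is_linear_sub_incl[OF A]] by simp
  have pc: "p x \<in> carrier N" if "x \<in> carrier N" for x using is_linearD(1)[OF pN that] .
  have q: "is_linear \<Lambda> N (N\<lparr>carrier := B\<rparr>) (\<lambda>x. x \<ominus>\<^bsub>N\<^esub> p x)"
    by (rule is_linearI)
      (use p(2) pc in \<open>auto simp: is_linearD(2,3)[OF pN] N.M.minus_eq N.M.minus_add N.M.a_ac
        N.smult_r_distr N.smult_r_minus\<close>)
  have 1: "factors_through \<Lambda> M N N p"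
    using through_post[OF assms(1) N.rmodule_sub[OF A] assms(1) through_pre[OF assms(3) p(1)] is_linear_sub_incl[OF A]]
    by simp
  have 2: "factors_through \<Lambda> M N N (\<lambda>x. x \<ominus>\<^bsub>N\<^esub> p x)"
    using through_post[OF assms(1) N.rmodule_sub[OF B] assms(1) through_pre[OF assms(4) q] is_linear_sub_incl[OF B]]
    by simp
  show ?thesis
  proof (rule through_cong[OF through_plus[OF assms(1,1) 2 1]])
    fix x assume "x \<in> carrier N"
    then show "x = (x \<ominus>\<^bsub>N\<^esub> p x) \<oplus>\<^bsub>N\<^esub> p x" using pc by (simp add: N.M.minus_eq N.M.a_assoc N.M.l_neg)
  qed
qed

lemma in_add_summand:
  assumes "rmodule \<Lambda> N" "direct_sum \<Lambda> N A B"
  shows "in_add \<Lambda> N (N\<lparr>carrier := A\<rparr>)"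
proof -
  interpret N: rmodule \<Lambda> N by fact
  have A: "is_sub \<Lambda> N A" using assms(2) unfolding direct_sum_def by simp
  obtain p where p: "is_linear \<Lambda> N (N\<lparr>carrier := A\<rparr>) p" "\<And>a. a \<in> A \<Longrightarrow> p a = a"
    using direct_sum_proj[OF assms(1,2)] by metis
  show ?thesis
    by (rule through_cong[OF through_single[OF N.rmodule_sub[OF A] is_linear_sub_incl[OF A] p(1)]])
      (simp add: p(2))
qed

section \<open>CM modules over S lie in add M\<close>

locale cm_generator = noeth_local_dim R d for R :: "'s ring" (structure) and d +
  fixes S :: "'s ring" and M :: "('s, 'm) module"
  assumes ext: "ring_extension R S" and gen: "CM_generator R S M"
begin

lemma S_cring: "cring S" and carrier_subset: "carrier R \<subseteq> carrier S" and R_eq: "R = S\<lparr>carrier := carrier R\<rparr>"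
  using ext subringE(1) by (auto simp: ring_extension_def)

lemma cmodule_restrict: "rmodule S N \<Longrightarrow> cmodule R N"
  using rmodule_mono[OF _ ext] cring_axioms by (simp add: cmodule_def)

lemma cmodule_S: "rmodule S N \<longleftrightarrow> cmodule S N"
  using S_cring by (auto simp: cmodule_def)

lemma CM_module_iff: "CM_module R S N \<longleftrightarrow> rmodule S N \<and> MCM R N"
  by (simp add: CM_module_def module_iff_rmodule S_cring)

lemma linear_restrict: "is_linear S N L f \<Longrightarrow> is_linear R N L f"
  by (rule is_linear_mono[OF _ carrier_subset])

lemma through_restrict: "factors_through S K N L h \<Longrightarrow> factors_through R K N L h"
  by (rule through_mono[OF _ carrier_subset])

lemma CM_module_in_add:
  assumes "CM_module R S K" "rmodule S N" "in_add S K N"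
  shows "CM_module R S N"
  using assms MCM_in_add[OF _ cmodule_restrict[OF assms(2)] through_restrict[OF assms(3)]]
  by (simp add: CM_module_iff)

lemma M_S: "rmodule S M" and M_MCM: "MCM R M"
  using gen by (auto simp: CM_generator_def CM_module_iff)

lemma indecomposable_CM_in_add:
  fixes N :: "('s, 's coset_type) module"
  assumes "CM_module R S N" "indecomposable S N"
  shows "in_add S M N"
proof -
  interpret M: rmodule S M by (rule M_S)
  have N: "rmodule S N" using assms(1) by (simp add: CM_module_iff)
  have mM: "module S M" using M_S S_cring by (simp add: module_iff_rmodule)
  obtain A B f where AB: "internal_direct_sum S M A B" and f: "f \<in> linear_maps S N (M\<lparr>carrier := A\<rparr>)"
    "bij_betw f (carrier N) A"
    using gen assms unfolding CM_generator_def iso_direct_summand_def module_iso_def by fastforce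
  have ds: "direct_sum S M A B" using AB internal_direct_sum_iff[OF mM] by simp
  then have A: "is_sub S M A" by (simp add: direct_sum_def)
  have f': "is_linear S N (M\<lparr>carrier := A\<rparr>) f" using f(1) by (rule linear_maps_linear)
  show ?thesis
    by (rule in_add_retract[OF N M.rmodule_sub[OF A] in_add_summand[OF M_S ds] f' is_linear_inv[OF N f']])
      (use f(2) in \<open>auto simp: bij_betw_def\<close>)
qed

text \<open>Submodules over \<open>S\<close> are submodules over \<open>R\<close>, and finite
  generating sets over \<open>R\<close> still generate over \<open>S\<close>.\<close>

lemma noeth_S:
  assumes "rmodule S N" "fin_gen R N"
  shows "noeth S N"
  using noeth_mono_ring[OF carrier_subset noeth_of_fin_gen[OF noeth_R _ assms(2)]] rmodule_mono[OF assms(1) ext] .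

text \<open>A maximal summand \<open>A\<close> whose complement is not in \<open>add M\<close> would have a complement that is
  indecomposable, hence in \<open>add M\<close> after all; no uniqueness of decompositions is involved.\<close>
lemma CM_coset_in_add:
  fixes N :: "('s, 's coset_type) module"
  assumes "CM_module R S N"
  shows "in_add S M N"
proof (rule ccontr)
  assume bad: "\<not> in_add S M N"
  have N: "rmodule S N" and mcm: "MCM R N" using assms by (auto simp: CM_module_iff)
  interpret N: rmodule S N by (rule N)
  \<comment> \<open>Summands whose complement is still bad. The zero submodule is one, since
    \<open>N\<close> itself is assumed to be bad, so a maximal one exists.\<close>
  let ?C = "{A. \<exists>B. direct_sum S N A B \<and> \<not> in_add S M (N\<lparr>carrier := B\<rparr>)}"
  have "direct_sum S N {\<zero>\<^bsub>N\<^esub>} (carrier N)"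
    by (auto simp: direct_sum_def N.sub_zero N.sub_carrier)
  then have "{\<zero>\<^bsub>N\<^esub>} \<in> ?C" using bad by auto
  then have "?C \<noteq> {}" by blast
  moreover have "is_sub S N W" if "W \<in> ?C" for W using that by (auto simp: direct_sum_def)
  moreover have "noeth S N" using noeth_S[OF N] mcm MCM_iff by blast
  ultimately have "\<exists>A \<in> ?C. \<forall>V \<in> ?C. A \<subseteq> V \<longrightarrow> V = A" by (intro noeth_maximal[of S N]) auto
  then obtain A B where AB: "direct_sum S N A B" "\<not> in_add S M (N\<lparr>carrier := B\<rparr>)"
    and max: "\<And>V. V \<in> ?C \<Longrightarrow> A \<subseteq> V \<Longrightarrow> V = A" by auto
  let ?B = "N\<lparr>carrier := B\<rparr>"
  have A: "is_sub S N A" and B: "is_sub S N B" using AB(1) by (auto simp: direct_sum_def)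
  have Bm: "rmodule S ?B" by (rule N.rmodule_sub[OF B])
  then have Bmod: "module S ?B" using S_cring by (simp add: module_iff_rmodule)
  have CM: "CM_module R S ?B"
    by (rule CM_module_in_add[OF assms Bm in_add_summand[OF N direct_sum_commute[OF N AB(1)]]])
  have nz: "\<not> is_zero ?B"
  proof
    assume "is_zero ?B"
    then have "in_add S M ?B" by (intro through_zero) (auto simp: is_zero_def)
    then show False using AB(2) by simp
  qed
  have "\<not> indecomposable S ?B" using indecomposable_CM_in_add[OF CM] AB(2) by blast
  then obtain B1 B2 where "internal_direct_sum S ?B B1 B2" and nz12: "B1 \<noteq> {\<zero>\<^bsub>N\<^esub>}" "B2 \<noteq> {\<zero>\<^bsub>N\<^esub>}"
    using nz unfolding indecomposable_def by auto
  then have B12: "direct_sum S ?B B1 B2" using internal_direct_sum_iff[OF Bmod] by simp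
  \<comment> \<open>If \<open>C2\<close> were bad, adding \<open>C1\<close> to \<open>A\<close>
    would give a member of \<open>?C\<close> again. By maximality it would equal \<open>A\<close>,
    so the nonzero \<open>C1\<close> would lie in both \<open>A\<close> and
    \<open>B\<close>.\<close>
  have good: "in_add S M (N\<lparr>carrier := C2\<rparr>)" if C: "direct_sum S ?B C1 C2" "C1 \<noteq> {\<zero>\<^bsub>N\<^esub>}" for C1 C2
  proof (rule ccontr)
    assume bad2: "\<not> ?thesis"
    let ?V = "{a \<oplus>\<^bsub>N\<^esub> b | a b. a \<in> A \<and> b \<in> C1}"
    have "?V \<in> ?C" using direct_sum_assoc[OF N AB(1) C(1)] bad2 by auto
    moreover have C1: "is_sub S ?B C1" using C(1) by (simp add: direct_sum_def)
    have c1: "\<zero>\<^bsub>N\<^esub> \<in> C1" "C1 \<subseteq> B" using is_subD(1,2)[OF C1] by auto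
    have "A \<subseteq> ?V"
    proof
      fix a assume "a \<in> A"
      moreover have "a = a \<oplus>\<^bsub>N\<^esub> \<zero>\<^bsub>N\<^esub>" using is_subD(5)[OF A \<open>a \<in> A\<close>] by simp
      ultimately show "a \<in> ?V" using c1(1) by blast
    qed
    ultimately have V: "?V = A" by (rule max)
    have "c \<in> A" if "c \<in> C1" for c
    proof -
      have "c = \<zero>\<^bsub>N\<^esub> \<oplus>\<^bsub>N\<^esub> c" using that c1(2) is_subD(5)[OF B] by auto
      then have "c \<in> ?V" using that is_subD(2)[OF A] by blast
      then show ?thesis using V by simp
    qed
    then have "C1 \<subseteq> A \<inter> B" using c1(2) by blast
    then show False using C(2) c1(1) AB(1) by (auto simp: direct_sum_def)
  qed
  have "in_add S M (?B\<lparr>carrier := B1\<rparr>)" "in_add S M (?B\<lparr>carrier := B2\<rparr>)"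
    using good[OF B12 nz12(1)] good[OF direct_sum_commute[OF Bm B12] nz12(2)] by simp_all
  from in_add_direct_sum[OF Bm B12 this] show False using AB(2) by simp
qed

text \<open>The generator hypothesis quantifies over modules on \<open>coset_type\<close>. An
  arbitrary CM module is copied there by \<open>fin_gen_embeds\<close>, and the result is carried
  back along the isomorphism.\<close>

lemma CM_in_add:
  fixes N :: "('s, 'n) module"
  assumes "CM_module R S N"
  shows "in_add S M N"
proof -
  have N: "rmodule S N" and fg: "fin_gen R N" using assms MCM_iff by (auto simp: CM_module_iff)
  interpret N: rmodule S N by (rule N)
  interpret NR: cmodule R N by (rule cmodule_restrict[OF N])
  obtain \<phi> :: "'n \<Rightarrow> 's coset_type" where inj: "inj_on \<phi> (carrier N)"
    using fin_gen_embeds[OF N.M.abelian_group_axioms NR.smult_closed fg] by blast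
  let ?N = "img_module N \<phi>"
  note img = img_module_inj[OF N inj]
  have inv: "inv_into (carrier N) \<phi> (\<phi> x) = x" if "x \<in> carrier N" for x using inj that by simp
  have "factors_through S N ?N ?N (\<lambda>x. \<phi> (inv_into (carrier N) \<phi> x))"
    by (rule through_single[OF img(1,3,2)])
  then have "in_add S N ?N" by (rule through_cong) (auto simp: inv)
  then have "CM_module R S ?N" by (rule CM_module_in_add[OF assms img(1)])
  from CM_coset_in_add[OF this] have "in_add S M ?N" .
  from in_add_retract[OF N img(1) this img(2,3) inv] show ?thesis .
qed

end

section \<open>The module of R-linear maps on S\<close>

text \<open>Hom_R(S, K) for a mere R-module \<open>K\<close>, with \<open>S\<close> acting through
  the source. The kernels to which it is applied carry no action of \<open>S\<close>
  themselves.\<close>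

definition source_hom :: "'a ring \<Rightarrow> 'a ring \<Rightarrow> ('a, 'm) module \<Rightarrow> ('a, 'a \<Rightarrow> 'm) module" where
  "source_hom R S K = \<lparr>carrier = linear_maps R (regular_module S) K, monoid.mult = undefined, one = undefined,
     ring.zero = (\<lambda>t\<in>carrier S. \<zero>\<^bsub>K\<^esub>), ring.add = (\<lambda>f g. \<lambda>t\<in>carrier S. f t \<oplus>\<^bsub>K\<^esub> g t),
     smult = (\<lambda>s f. \<lambda>t\<in>carrier S. f (s \<otimes>\<^bsub>S\<^esub> t))\<rparr>"

lemma source_hom_simps [simp]:
  "carrier (source_hom R S K) = linear_maps R (regular_module S) K"
  "\<zero>\<^bsub>source_hom R S K\<^esub> = (\<lambda>t\<in>carrier S. \<zero>\<^bsub>K\<^esub>)"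
  "f \<oplus>\<^bsub>source_hom R S K\<^esub> g = (\<lambda>t\<in>carrier S. f t \<oplus>\<^bsub>K\<^esub> g t)"
  "s \<odot>\<^bsub>source_hom R S K\<^esub> f = (\<lambda>t\<in>carrier S. f (s \<otimes>\<^bsub>S\<^esub> t))"
  by (simp_all add: source_hom_def)

lemma regular_module_simps [simp]:
  "carrier (regular_module S) = carrier S" "\<zero>\<^bsub>regular_module S\<^esub> = \<zero>\<^bsub>S\<^esub>"
  "x \<oplus>\<^bsub>regular_module S\<^esub> y = x \<oplus>\<^bsub>S\<^esub> y" "a \<odot>\<^bsub>regular_module S\<^esub> x = a \<otimes>\<^bsub>S\<^esub> x"
  by (simp_all add: regular_module_def)

lemma hom_module_simps [simp]:
  "carrier (hom_module R M N) = linear_maps R M N"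
  "\<zero>\<^bsub>hom_module R M N\<^esub> = (\<lambda>x\<in>carrier M. \<zero>\<^bsub>N\<^esub>)"
  "f \<oplus>\<^bsub>hom_module R M N\<^esub> g = (\<lambda>x\<in>carrier M. f x \<oplus>\<^bsub>N\<^esub> g x)"
  "a \<odot>\<^bsub>hom_module R M N\<^esub> f = (\<lambda>x\<in>carrier M. a \<odot>\<^bsub>N\<^esub> f x)"
  by (simp_all add: hom_module_def)

lemma linear_mapsD:
  assumes "f \<in> linear_maps \<Lambda> N L"
  shows "x \<in> carrier N \<Longrightarrow> f x \<in> carrier L"
    and "x \<in> carrier N \<Longrightarrow> y \<in> carrier N \<Longrightarrow> f (x \<oplus>\<^bsub>N\<^esub> y) = f x \<oplus>\<^bsub>L\<^esub> f y"
    and "a \<in> carrier \<Lambda> \<Longrightarrow> x \<in> carrier N \<Longrightarrow> f (a \<odot>\<^bsub>N\<^esub> x) = a \<odot>\<^bsub>L\<^esub> f x"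
    and "x \<notin> carrier N \<Longrightarrow> f x = undefined"
  using assms by (auto simp: linear_maps_def PiE_def extensional_def)

lemma linear_mapsI:
  assumes "\<And>x. x \<in> carrier N \<Longrightarrow> f x \<in> carrier L"
    and "\<And>x y. x \<in> carrier N \<Longrightarrow> y \<in> carrier N \<Longrightarrow> f (x \<oplus>\<^bsub>N\<^esub> y) = f x \<oplus>\<^bsub>L\<^esub> f y"
    and "\<And>a x. a \<in> carrier \<Lambda> \<Longrightarrow> x \<in> carrier N \<Longrightarrow> f (a \<odot>\<^bsub>N\<^esub> x) = a \<odot>\<^bsub>L\<^esub> f x"
    and "\<And>x. x \<notin> carrier N \<Longrightarrow> f x = undefined"
  shows "f \<in> linear_maps \<Lambda> N L"
  using assms by (auto simp: linear_maps_def PiE_def extensional_def)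

lemma linear_maps_eqI:
  assumes "f \<in> linear_maps \<Lambda> N L" "g \<in> linear_maps \<Lambda> N L'" "\<And>x. x \<in> carrier N \<Longrightarrow> f x = g x"
  shows "f = g"
proof
  fix x show "f x = g x"
    using linear_mapsD(4)[OF assms(1)] linear_mapsD(4)[OF assms(2)] assms(3) by (cases "x \<in> carrier N") auto
qed

context cm_generator
begin

lemma ring_ops: "ring.add R = ring.add S" "monoid.mult R = monoid.mult S" "one R = one S" "ring.zero R = ring.zero S"
  by (subst R_eq, simp)+

lemma rmodule_regular: "rmodule S (regular_module S)"
proof -
  interpret S: cring S by (rule S_cring)
  show ?thesis
    by (intro rmodule.intro right_module.intro right_module_axioms.intro S.ring_axioms
        abelian_group_ops_cong[OF S.abelian_group_axioms])
      (auto simp: S.r_distr S.l_distr S.m_ac regular_module_def)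
qed

lemma rmodule_source_hom:
  assumes "rmodule R K"
  shows "rmodule S (source_hom R S K)"
proof -
  interpret S: cring S by (rule S_cring)
  interpret K: rmodule R K by fact
  let ?H = "linear_maps R (regular_module S) K"
  have Rc: "a \<in> carrier S" if "a \<in> carrier R" for a using carrier_subset that by blast
  note D = linear_mapsD[where N = "regular_module S" and \<Lambda> = R and L = K, simplified]
  have add: "(\<lambda>t\<in>carrier S. f t \<oplus>\<^bsub>K\<^esub> g t) \<in> ?H" if "f \<in> ?H" "g \<in> ?H" for f g
    by (rule linear_mapsI)
      (use Rc in \<open>auto simp: D[OF that(1)] D[OF that(2)] K.M.a_ac K.smult_r_distr\<close>)
  have neg: "(\<lambda>t\<in>carrier S. \<ominus>\<^bsub>K\<^esub> f t) \<in> ?H" if "f \<in> ?H" for f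
    by (rule linear_mapsI) (use Rc in \<open>auto simp: D[OF that] K.M.minus_add K.M.a_ac K.smult_r_minus\<close>)
  have zero: "(\<lambda>t\<in>carrier S. \<zero>\<^bsub>K\<^esub>) \<in> ?H"
    by (rule linear_mapsI) (use Rc in auto)
  have smult: "(\<lambda>t\<in>carrier S. f (s \<otimes>\<^bsub>S\<^esub> t)) \<in> ?H" if "f \<in> ?H" "s \<in> carrier S" for f s
  proof (rule linear_mapsI)
    show "(\<lambda>t\<in>carrier S. f (s \<otimes>\<^bsub>S\<^esub> t)) (a \<odot>\<^bsub>regular_module S\<^esub> t)
        = a \<odot>\<^bsub>K\<^esub> (\<lambda>t\<in>carrier S. f (s \<otimes>\<^bsub>S\<^esub> t)) t" if "a \<in> carrier R" "t \<in> carrier (regular_module S)" for a t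
      using that Rc \<open>s \<in> carrier S\<close> D(3)[OF \<open>f \<in> ?H\<close> that(1), of "s \<otimes>\<^bsub>S\<^esub> t"] by (simp add: S.m_lcomm)
  qed (use that in \<open>auto simp: D[OF that(1)] S.r_distr\<close>)
  have eqI: "f = g" if "f \<in> ?H" "g \<in> ?H" "\<And>t. t \<in> carrier S \<Longrightarrow> f t = g t" for f g
    by (rule linear_maps_eqI[OF that(1,2)]) (use that(3) in simp)
  have "abelian_group (source_hom R S K)"
  proof (rule abelian_groupI)
    show "f \<oplus>\<^bsub>source_hom R S K\<^esub> g \<in> carrier (source_hom R S K)"
      if "f \<in> carrier (source_hom R S K)" "g \<in> carrier (source_hom R S K)" for f g
      using add that by simp
    show "\<zero>\<^bsub>source_hom R S K\<^esub> \<in> carrier (source_hom R S K)" using zero by simp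
    show "f \<oplus>\<^bsub>source_hom R S K\<^esub> g \<oplus>\<^bsub>source_hom R S K\<^esub> h = f \<oplus>\<^bsub>source_hom R S K\<^esub> (g \<oplus>\<^bsub>source_hom R S K\<^esub> h)"
      if "f \<in> carrier (source_hom R S K)" "g \<in> carrier (source_hom R S K)" "h \<in> carrier (source_hom R S K)" for f g h
      using that by (auto simp: fun_eq_iff restrict_def D K.M.a_assoc)
    show "f \<oplus>\<^bsub>source_hom R S K\<^esub> g = g \<oplus>\<^bsub>source_hom R S K\<^esub> f"
      if "f \<in> carrier (source_hom R S K)" "g \<in> carrier (source_hom R S K)" for f g
      using that by (auto simp: fun_eq_iff restrict_def D K.M.a_comm)
    show "\<zero>\<^bsub>source_hom R S K\<^esub> \<oplus>\<^bsub>source_hom R S K\<^esub> f = f" if "f \<in> carrier (source_hom R S K)" for f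
      using that add[OF zero, of f] by (intro eqI) (auto simp: D)
    show "\<exists>g \<in> carrier (source_hom R S K). g \<oplus>\<^bsub>source_hom R S K\<^esub> f = \<zero>\<^bsub>source_hom R S K\<^esub>"
      if "f \<in> carrier (source_hom R S K)" for f
      by (rule bexI[of _ "\<lambda>t\<in>carrier S. \<ominus>\<^bsub>K\<^esub> f t"])
        (use that neg in \<open>auto simp: fun_eq_iff restrict_def D K.M.l_neg\<close>)
  qed
  then show ?thesis
  proof (intro rmodule.intro right_module.intro right_module_axioms.intro S.ring_axioms)
    show "a \<odot>\<^bsub>source_hom R S K\<^esub> f \<in> carrier (source_hom R S K)"
      if "a \<in> carrier S" "f \<in> carrier (source_hom R S K)" for a f using that smult by simp
    show "(a \<oplus>\<^bsub>S\<^esub> b) \<odot>\<^bsub>source_hom R S K\<^esub> f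
        = a \<odot>\<^bsub>source_hom R S K\<^esub> f \<oplus>\<^bsub>source_hom R S K\<^esub> b \<odot>\<^bsub>source_hom R S K\<^esub> f"
      if "a \<in> carrier S" "b \<in> carrier S" "f \<in> carrier (source_hom R S K)" for a b f
      using that by (auto simp: fun_eq_iff restrict_def D S.l_distr)
    show "a \<odot>\<^bsub>source_hom R S K\<^esub> (f \<oplus>\<^bsub>source_hom R S K\<^esub> g)
        = a \<odot>\<^bsub>source_hom R S K\<^esub> f \<oplus>\<^bsub>source_hom R S K\<^esub> a \<odot>\<^bsub>source_hom R S K\<^esub> g"
      if "a \<in> carrier S" "f \<in> carrier (source_hom R S K)" "g \<in> carrier (source_hom R S K)" for a f g
      using that by (auto simp: fun_eq_iff restrict_def)
    show "(a \<otimes>\<^bsub>S\<^esub> b) \<odot>\<^bsub>source_hom R S K\<^esub> f = b \<odot>\<^bsub>source_hom R S K\<^esub> (a \<odot>\<^bsub>source_hom R S K\<^esub> f)"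
      if "a \<in> carrier S" "b \<in> carrier S" "f \<in> carrier (source_hom R S K)" for a b f
      using that by (auto simp: fun_eq_iff restrict_def S.m_assoc)
    show "\<one>\<^bsub>S\<^esub> \<odot>\<^bsub>source_hom R S K\<^esub> f = f" if "f \<in> carrier (source_hom R S K)" for f
      using that smult[of f "\<one>\<^bsub>S\<^esub>"] by (intro eqI) auto
  qed
qed

lemma source_hom_linear:
  assumes "rmodule R K" "rmodule R L" "is_linear R K L \<phi>"
  shows "is_linear S (source_hom R S K) (source_hom R S L) (\<lambda>u. \<lambda>t\<in>carrier S. \<phi> (u t))"
proof -
  interpret S: cring S by (rule S_cring)
  note D = linear_mapsD[where N = "regular_module S" and \<Lambda> = R and L = K, simplified]
  have Rc: "a \<in> carrier S" if "a \<in> carrier R" for a using carrier_subset that by blast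
  show ?thesis
  proof
    show "(\<lambda>t\<in>carrier S. \<phi> (u t)) \<in> carrier (source_hom R S L)" if "u \<in> carrier (source_hom R S K)" for u
      unfolding source_hom_simps
      by (rule linear_mapsI)
        (use that Rc in \<open>auto simp: D is_linearD[OF assms(3)]\<close>)
  qed (auto simp: fun_eq_iff restrict_def D is_linearD[OF assms(3)])
qed

text \<open>Hom_R(S, -) is an additive functor, so it preserves sums of composites; this carries add
  N into the add of Hom_R(S, N).\<close>

lemma source_hom_factors:
  assumes "rmodule R K" "rmodule R L" "rmodule R N" "factors_through R N K L h"
  shows "factors_through S (source_hom R S N) (source_hom R S K) (source_hom R S L) (\<lambda>u. \<lambda>t\<in>carrier S. h (u t))"
  using assms(4)
proof (induction rule: factors_through.induct)
  note D = linear_mapsD[where N = "regular_module S" and \<Lambda> = R and L = K, simplified]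
  case (through_zero h)
  then show ?case by (intro factors_through.through_zero) (auto simp: fun_eq_iff restrict_def D)
next
  note D = linear_mapsD[where N = "regular_module S" and \<Lambda> = R and L = K, simplified]
  case (through_step h f g h')
  show ?case
    by (rule factors_through.through_step[OF through_step.IH source_hom_linear[OF assms(1,3) through_step(2)]
          source_hom_linear[OF assms(3,2) through_step(3)]])
      (auto simp: fun_eq_iff restrict_def D through_step(4))
qed

lemma source_hom_in_add:
  assumes "rmodule R K" "rmodule R N" "in_add R N K"
  shows "in_add S (source_hom R S N) (source_hom R S K)"
  by (rule through_cong[OF source_hom_factors[OF assms(1,1,2,3)]])
    (auto simp: fun_eq_iff restrict_def linear_mapsD(4)[where N = "regular_module S", simplified])

text \<open>The splitting \<open>\<rho>\<close> embeds \<open>K\<close> into Hom_R(S, K) by sending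
  k to the map with value \<open>\<rho> t\<close> k at t. Evaluation at 1 is a retraction, because
  \<open>\<rho>\<close> fixes 1.\<close>

lemma in_add_source_hom_retract:
  assumes "pure_extension R S" "rmodule R K" "in_add R M (source_hom R S K)"
  shows "in_add R M K"
proof -
  interpret S: cring S by (rule S_cring)
  interpret K: rmodule R K by fact
  obtain \<rho> where \<rho>: "\<rho> \<in> linear_maps R (regular_module S) (regular_module R)" "\<And>r. r \<in> carrier R \<Longrightarrow> \<rho> r = r"
    using assms(1) by (auto simp: pure_extension_def)
  have Rc: "a \<in> carrier S" if "a \<in> carrier R" for a using carrier_subset that by blast
  note r = linear_mapsD[OF \<rho>(1), simplified]
  have one: "\<one>\<^bsub>S\<^esub> \<in> carrier R" using one_closed by (simp add: ring_ops)
  have lin1: "is_linear R K (source_hom R S K) (\<lambda>k. \<lambda>t\<in>carrier S. \<rho> t \<odot>\<^bsub>K\<^esub> k)"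
  proof
    show "(\<lambda>t\<in>carrier S. \<rho> t \<odot>\<^bsub>K\<^esub> k) \<in> carrier (source_hom R S K)" if "k \<in> carrier K" for k
      unfolding source_hom_simps
    proof (rule linear_mapsI)
      show "(\<lambda>t\<in>carrier S. \<rho> t \<odot>\<^bsub>K\<^esub> k) (a \<odot>\<^bsub>regular_module S\<^esub> t) = a \<odot>\<^bsub>K\<^esub> (\<lambda>t\<in>carrier S. \<rho> t \<odot>\<^bsub>K\<^esub> k) t"
        if "a \<in> carrier R" "t \<in> carrier (regular_module S)" for a t
        using that \<open>k \<in> carrier K\<close> Rc r(1)[of t] K.smult_assoc[of "\<rho> t" a k]
        by (simp add: r(3) m_comm[of a])
    qed (use that in \<open>auto simp: r(1,2) K.smult_l_distr\<close>)
    show "(\<lambda>t\<in>carrier S. \<rho> t \<odot>\<^bsub>K\<^esub> (a \<odot>\<^bsub>K\<^esub> k)) = a \<odot>\<^bsub>source_hom R S K\<^esub> (\<lambda>t\<in>carrier S. \<rho> t \<odot>\<^bsub>K\<^esub> k)"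
      if "a \<in> carrier R" "k \<in> carrier K" for a k
      using that Rc r(1) by (auto simp: fun_eq_iff restrict_def r(3) K.smult_assoc)
  qed (auto simp: fun_eq_iff restrict_def r(1) K.smult_r_distr)
  have lin2: "is_linear R (source_hom R S K) K (\<lambda>u. u \<one>\<^bsub>S\<^esub>)"
  proof
    show "(a \<odot>\<^bsub>source_hom R S K\<^esub> u) \<one>\<^bsub>S\<^esub> = a \<odot>\<^bsub>K\<^esub> u \<one>\<^bsub>S\<^esub>"
      if "a \<in> carrier R" "u \<in> carrier (source_hom R S K)" for a u
      using that linear_mapsD(3)[of u R "regular_module S" K a "\<one>\<^bsub>S\<^esub>"] by simp
  qed (auto simp: linear_mapsD(1)[where N = "regular_module S", simplified])
  have "rmodule R (source_hom R S K)" by (rule rmodule_mono[OF rmodule_source_hom[OF assms(2)] ext])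
  then show ?thesis
    by (rule in_add_retract[OF assms(2) _ assms(3) lin1 lin2])
      (use one Rc[OF one] in \<open>simp add: \<rho>(2) ring_ops(3)[symmetric]\<close>)
qed

end

section \<open>From CM modules Hom_R(S, K) to K in add M\<close>

locale cm_setting = cm_generator R d S M
  for R :: "'s ring" (structure) and d and S :: "'s ring" and M :: "('s, 'm) module" +
  assumes S_MCM: "MCM R (regular_module S)" and pure: "pure_extension R S"
    and hom_MCM: "MCM R (hom_module R (regular_module S) M)"
begin

lemma MCM_in_add_R: "rmodule S N \<Longrightarrow> MCM R N \<Longrightarrow> in_add R M N"
  by (rule through_restrict[OF CM_in_add]) (simp add: CM_module_iff)

lemma S_in_add: "in_add R M (regular_module S)"
  by (rule MCM_in_add_R[OF rmodule_regular S_MCM])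

lemma M_R: "rmodule R M"
  by (rule rmodule_mono[OF M_S ext])

text \<open>Through the action of \<open>S\<close> on \<open>M\<close> the Hom module becomes an
  S-module, so the hypothesis that it is CM places it in add M.\<close>

lemma rmodule_hom: "rmodule S (hom_module R (regular_module S) M)"
proof -
  interpret M: rmodule S M by (rule M_S)
  have "abelian_group (hom_module R (regular_module S) M)"
    using hom_MCM by (auto simp: MCM_def module_def)
  then show ?thesis
  proof (intro rmodule.intro right_module.intro right_module_axioms.intro M.R.ring_axioms)
    note D = linear_mapsD[where N = "regular_module S" and \<Lambda> = R and L = M, simplified]
    have c: "a \<in> carrier S" if "a \<in> carrier R" for a using carrier_subset that by blast
    interpret cM: cmodule S M using M_S cmodule_S[of M] by blast
    show "a \<odot>\<^bsub>hom_module R (regular_module S) M\<^esub> f \<in> carrier (hom_module R (regular_module S) M)"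
      if "a \<in> carrier S" "f \<in> carrier (hom_module R (regular_module S) M)" for a f
      unfolding hom_module_simps
      by (rule linear_mapsI) (use that c in \<open>auto simp: D M.smult_r_distr cM.smult_smult[of a]\<close>)
    show "\<one>\<^bsub>S\<^esub> \<odot>\<^bsub>hom_module R (regular_module S) M\<^esub> f = f"
      if "f \<in> carrier (hom_module R (regular_module S) M)" for f
      using that by (auto simp: fun_eq_iff restrict_def D)
  qed (auto simp: fun_eq_iff restrict_def linear_mapsD(1)[where N = "regular_module S", simplified]
      M.smult_l_distr M.smult_r_distr M.smult_assoc)
qed

lemma hom_in_add: "in_add R M (hom_module R (regular_module S) M)"
  by (rule MCM_in_add_R[OF rmodule_hom hom_MCM])

text \<open>The two \<open>S\<close>-actions on \<open>Hom\<^sub>R(S, M)\<close>, through \<open>M\<close> in \<open>hom_module\<close> and through the source in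
  \<open>source_hom\<close>, agree over \<open>R\<close>.\<close>
lemma source_hom_M_in_add: "in_add R M (source_hom R S M)"
proof -
  have r: "rmodule R (source_hom R S M)" by (rule rmodule_mono[OF rmodule_source_hom[OF M_R] ext])
  have h: "rmodule R (hom_module R (regular_module S) M)" by (rule rmodule_mono[OF rmodule_hom ext])
  have smult_eq: "a \<odot>\<^bsub>source_hom R S M\<^esub> u = a \<odot>\<^bsub>hom_module R (regular_module S) M\<^esub> u"
    if "a \<in> carrier R" "u \<in> linear_maps R (regular_module S) M" for a u
    using linear_mapsD(3)[OF that(2,1)] by (auto simp: fun_eq_iff restrict_def)
  have "is_linear R (source_hom R S M) (hom_module R (regular_module S) M) (\<lambda>u. u)"
    by (rule is_linearI) (simp_all add: smult_eq[simplified])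
  moreover have "is_linear R (hom_module R (regular_module S) M) (source_hom R S M) (\<lambda>u. u)"
    by (rule is_linearI) (simp_all add: smult_eq[simplified])
  ultimately show ?thesis by (rule in_add_retract[OF r h hom_in_add]) simp
qed

lemma source_hom_pow_in_add: "in_add R M (source_hom R S (pow_module M b))"
proof -
  have p: "rmodule R (pow_module M b)" by (rule rmodule_pow[OF M_R])
  note r = rmodule_mono[OF rmodule_source_hom ext]
  show ?thesis
    by (rule through_trans[OF r[OF p] r[OF p] r[OF M_R]
          through_restrict[OF source_hom_in_add[OF p M_R in_add_pow[OF M_R]]] source_hom_M_in_add])
qed

text \<open>Here the generator property, available over \<open>S\<close>, and the splitting over
  \<open>R\<close> meet. This is the criterion for the last kernel.\<close>

lemma in_add_of_source_hom_MCM: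
  assumes "rmodule R K" "MCM R (source_hom R S K)"
  shows "in_add R M K"
  by (rule in_add_source_hom_retract[OF pure assms(1) MCM_in_add_R[OF rmodule_source_hom[OF assms(1)] assms(2)]])

end

section \<open>The endomorphism ring and its free modules\<close>

lemma End_ring_simps [simp]:
  "carrier (End_ring R M) = linear_maps R M M" "\<zero>\<^bsub>End_ring R M\<^esub> = (\<lambda>x\<in>carrier M. \<zero>\<^bsub>M\<^esub>)"
  "\<one>\<^bsub>End_ring R M\<^esub> = (\<lambda>x\<in>carrier M. x)"
  "f \<oplus>\<^bsub>End_ring R M\<^esub> g = (\<lambda>x\<in>carrier M. f x \<oplus>\<^bsub>M\<^esub> g x)" "f \<otimes>\<^bsub>End_ring R M\<^esub> g = compose (carrier M) f g"
  by (simp_all add: End_ring_def)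

lemma (in rmodule) restrict_linear: "is_linear R M L f \<Longrightarrow> (\<lambda>x\<in>carrier M. f x) \<in> linear_maps R M L"
  by (rule restrict_linear_maps) auto

lemma (in cmodule) End_ring_ring: "ring (End_ring R M)"
proof -
  let ?E = "linear_maps R M M"
  note D = linear_mapsD[where \<Lambda> = R and N = M and L = M]
  have eqI: "f = g" if "f \<in> ?E" "g \<in> ?E" "\<And>t. t \<in> carrier M \<Longrightarrow> f t = g t" for f g
    by (rule linear_maps_eqI[OF that(1,2)]) (use that(3) in simp)
  have add: "(\<lambda>x\<in>carrier M. f x \<oplus>\<^bsub>M\<^esub> g x) \<in> ?E" if "f \<in> ?E" "g \<in> ?E" for f g
    by (rule linear_mapsI) (auto simp: D[OF that(1)] D[OF that(2)] M.a_ac smult_r_distr)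
  have neg: "(\<lambda>x\<in>carrier M. \<ominus>\<^bsub>M\<^esub> f x) \<in> ?E" if "f \<in> ?E" for f
    by (rule linear_mapsI) (auto simp: D[OF that] M.minus_add M.a_ac smult_r_minus)
  have zero: "(\<lambda>x\<in>carrier M. \<zero>\<^bsub>M\<^esub>) \<in> ?E" by (rule linear_mapsI) auto
  have one: "(\<lambda>x\<in>carrier M. x) \<in> ?E" by (rule linear_mapsI) auto
  have comp: "compose (carrier M) f g \<in> ?E" if "f \<in> ?E" "g \<in> ?E" for f g
    by (rule linear_mapsI) (auto simp: D[OF that(1)] D[OF that(2)] compose_def)
  show ?thesis
  proof (rule ringI)
    show "abelian_group (End_ring R M)"
    proof (rule abelian_groupI)
      show "f \<oplus>\<^bsub>End_ring R M\<^esub> g \<in> carrier (End_ring R M)"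
        if "f \<in> carrier (End_ring R M)" "g \<in> carrier (End_ring R M)" for f g
        using that add by simp
      show "f \<oplus>\<^bsub>End_ring R M\<^esub> g \<oplus>\<^bsub>End_ring R M\<^esub> h = f \<oplus>\<^bsub>End_ring R M\<^esub> (g \<oplus>\<^bsub>End_ring R M\<^esub> h)"
        if "f \<in> carrier (End_ring R M)" "g \<in> carrier (End_ring R M)" "h \<in> carrier (End_ring R M)" for f g h
        using that by (auto simp: fun_eq_iff restrict_def D M.a_assoc)
      show "f \<oplus>\<^bsub>End_ring R M\<^esub> g = g \<oplus>\<^bsub>End_ring R M\<^esub> f"
        if "f \<in> carrier (End_ring R M)" "g \<in> carrier (End_ring R M)" for f g
        using that by (auto simp: fun_eq_iff restrict_def D M.a_comm)
      show "\<zero>\<^bsub>End_ring R M\<^esub> \<in> carrier (End_ring R M)" using zero by simp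
      show "\<zero>\<^bsub>End_ring R M\<^esub> \<oplus>\<^bsub>End_ring R M\<^esub> f = f" if "f \<in> carrier (End_ring R M)" for f
        using that add[OF zero, of f] by (intro eqI) (auto simp: D)
      show "\<exists>g \<in> carrier (End_ring R M). g \<oplus>\<^bsub>End_ring R M\<^esub> f = \<zero>\<^bsub>End_ring R M\<^esub>"
        if "f \<in> carrier (End_ring R M)" for f
        by (rule bexI[of _ "\<lambda>x\<in>carrier M. \<ominus>\<^bsub>M\<^esub> f x"])
          (use that neg in \<open>auto simp: fun_eq_iff restrict_def D M.l_neg\<close>)
    qed
    show "monoid (End_ring R M)"
    proof (rule monoidI)
      show "f \<otimes>\<^bsub>End_ring R M\<^esub> g \<in> carrier (End_ring R M)"
        if "f \<in> carrier (End_ring R M)" "g \<in> carrier (End_ring R M)" for f g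
        using that comp by simp
      show "\<one>\<^bsub>End_ring R M\<^esub> \<in> carrier (End_ring R M)" using one by simp
      show "(f \<otimes>\<^bsub>End_ring R M\<^esub> g) \<otimes>\<^bsub>End_ring R M\<^esub> h = f \<otimes>\<^bsub>End_ring R M\<^esub> (g \<otimes>\<^bsub>End_ring R M\<^esub> h)"
        if "f \<in> carrier (End_ring R M)" "g \<in> carrier (End_ring R M)" "h \<in> carrier (End_ring R M)" for f g h
        using that by (auto simp: fun_eq_iff compose_def restrict_def D)
      show "\<one>\<^bsub>End_ring R M\<^esub> \<otimes>\<^bsub>End_ring R M\<^esub> f = f" if "f \<in> carrier (End_ring R M)" for f
        using that comp[OF one, of f] by (intro eqI) (auto simp: D compose_def)
      show "f \<otimes>\<^bsub>End_ring R M\<^esub> \<one>\<^bsub>End_ring R M\<^esub> = f" if "f \<in> carrier (End_ring R M)" for f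
        using that comp[OF _ one, of f] by (intro eqI) (auto simp: D compose_def)
    qed
  next
    fix f g h assume *: "f \<in> carrier (End_ring R M)" "g \<in> carrier (End_ring R M)" "h \<in> carrier (End_ring R M)"
    show "(f \<oplus>\<^bsub>End_ring R M\<^esub> g) \<otimes>\<^bsub>End_ring R M\<^esub> h
        = f \<otimes>\<^bsub>End_ring R M\<^esub> h \<oplus>\<^bsub>End_ring R M\<^esub> g \<otimes>\<^bsub>End_ring R M\<^esub> h"
      using * by (auto simp: fun_eq_iff compose_def restrict_def D)
    show "h \<otimes>\<^bsub>End_ring R M\<^esub> (f \<oplus>\<^bsub>End_ring R M\<^esub> g)
        = h \<otimes>\<^bsub>End_ring R M\<^esub> f \<oplus>\<^bsub>End_ring R M\<^esub> h \<otimes>\<^bsub>End_ring R M\<^esub> g"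
      using * by (auto simp: fun_eq_iff compose_def restrict_def D)
  qed
qed

text \<open>Finite sums by recursion on the number of terms: congruence needs no closure conditions,
  and linear maps pass through by plain induction.\<close>

primrec psum :: "('a, 'm) module \<Rightarrow> (nat \<Rightarrow> 'm) \<Rightarrow> nat \<Rightarrow> 'm" where
  "psum N f 0 = \<zero>\<^bsub>N\<^esub>"
| "psum N f (Suc k) = psum N f k \<oplus>\<^bsub>N\<^esub> f k"

lemma (in rmodule) psum_closed [intro]: "(\<And>j. j < k \<Longrightarrow> f j \<in> carrier M) \<Longrightarrow> psum M f k \<in> carrier M"
  by (induction k) auto

lemma psum_cong: "(\<And>j. j < k \<Longrightarrow> f j = g j) \<Longrightarrow> psum N f k = psum N g k"
  by (induction k) auto

lemma (in rmodule) psum_zero: "psum M (\<lambda>j. \<zero>\<^bsub>M\<^esub>) k = \<zero>\<^bsub>M\<^esub>"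
  by (induction k) auto

lemma (in rmodule) psum_single:
  "y i \<in> carrier M \<Longrightarrow> psum M (\<lambda>j. if i = j then y j else \<zero>\<^bsub>M\<^esub>) k = (if i < k then y i else \<zero>\<^bsub>M\<^esub>)"
  by (induction k) (auto simp: less_Suc_eq)

lemma linear_psum:
  assumes "rmodule \<Lambda> N" "rmodule \<Lambda> L" "is_linear \<Lambda> N L h" "\<And>j. j < k \<Longrightarrow> f j \<in> carrier N"
  shows "h (psum N f k) = psum L (\<lambda>j. h (f j)) k"
  using assms(4)
proof (induction k)
  case 0
  show ?case using rmodule.linear_zero[OF assms(1-3)] by simp
next
  case (Suc k)
  have "psum N f k \<in> carrier N" by (rule rmodule.psum_closed[OF assms(1)]) (use Suc.prems in auto)
  then show ?case using Suc by (simp add: is_linearD(2)[OF assms(3)])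
qed

lemma psum_linear:
  assumes "rmodule \<Lambda> N" "rmodule \<Lambda> L" "\<And>j. j < k \<Longrightarrow> is_linear \<Lambda> N L (g j)"
  shows "is_linear \<Lambda> N L (\<lambda>x. psum L (\<lambda>j. g j x) k)"
proof -
  interpret L: rmodule \<Lambda> L by fact
  show ?thesis
    using assms(3)
  proof (induction k)
    case 0
    then show ?case using rmodule.linear_zero_map[OF assms(1,2)] by simp
  next
    case (Suc k)
    then have IH: "is_linear \<Lambda> N L (\<lambda>x. psum L (\<lambda>j. g j x) k)" and g: "is_linear \<Lambda> N L (g k)" by auto
    show ?case
      by (rule is_linearI) (auto simp: is_linearD[OF IH] is_linearD[OF g] L.M.a_ac L.smult_r_distr)
  qed
qed

abbreviation free_module :: "('a, 'c) ring_scheme \<Rightarrow> nat \<Rightarrow> ('a, nat \<Rightarrow> 'a) module" where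
  "free_module \<Lambda> b \<equiv> pow_module (right_regular \<Lambda>) b"

definition unit_vec :: "('a, 'c) ring_scheme \<Rightarrow> nat \<Rightarrow> nat \<Rightarrow> nat \<Rightarrow> 'a" where
  "unit_vec \<Lambda> b j = (\<lambda>i\<in>{..<b}. if i = j then \<one>\<^bsub>\<Lambda>\<^esub> else \<zero>\<^bsub>\<Lambda>\<^esub>)"

lemma unit_vec_closed: "ring \<Lambda> \<Longrightarrow> unit_vec \<Lambda> b j \<in> carrier (free_module \<Lambda> b)"
  by (auto simp: unit_vec_def ring.ring_simprules)

lemma free_module_expand:
  assumes "ring \<Lambda>" "t \<in> carrier (free_module \<Lambda> b)"
  shows "t = psum (free_module \<Lambda> b) (\<lambda>j. t j \<odot>\<^bsub>free_module \<Lambda> b\<^esub> unit_vec \<Lambda> b j) b"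
proof -
  interpret L: rmodule \<Lambda> "right_regular \<Lambda>" by (rule rmodule_right_regular[OF assms(1)])
  interpret F: rmodule \<Lambda> "free_module \<Lambda> b" by (rule rmodule_pow) (rule L.rmodule_axioms)
  let ?s = "psum (free_module \<Lambda> b) (\<lambda>j. t j \<odot>\<^bsub>free_module \<Lambda> b\<^esub> unit_vec \<Lambda> b j) b"
  have t: "t j \<in> carrier \<Lambda>" if "j < b" for j using assms(2) that by (auto simp: PiE_iff)
  have c: "t j \<odot>\<^bsub>free_module \<Lambda> b\<^esub> unit_vec \<Lambda> b j \<in> carrier (free_module \<Lambda> b)" if "j < b" for j
    by (rule F.smult_closed[OF t[OF that] unit_vec_closed[OF assms(1)]])
  have s: "?s \<in> carrier (free_module \<Lambda> b)" by (rule F.psum_closed) (rule c)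
  have "?s i = t i" if i: "i < b" for i
  proof -
    have "?s i = psum (right_regular \<Lambda>) (\<lambda>j. (t j \<odot>\<^bsub>free_module \<Lambda> b\<^esub> unit_vec \<Lambda> b j) i) b"
      by (rule linear_psum[OF F.rmodule_axioms L.rmodule_axioms pow_proj_linear[OF i] c])
    also have "\<dots> = psum (right_regular \<Lambda>) (\<lambda>j. if i = j then t j else \<zero>\<^bsub>right_regular \<Lambda>\<^esub>) b"
      by (rule psum_cong) (use i t in \<open>auto simp: unit_vec_def ring.ring_simprules[OF assms(1)]\<close>)
    also have "\<dots> = t i" using L.psum_single[of t i b] t[OF i] i by simp
    finally show ?thesis .
  qed
  then show ?thesis
    using PiE_ext[OF assms(2)[unfolded pow_module_simps(1)] s[unfolded pow_module_simps(1)]] by simp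
qed

section \<open>Matrices of endomorphisms\<close>

text \<open>A tuple \<open>t\<close> in \<open>End(M)\<^sup>b\<close> is the same as a linear map \<open>M \<rightarrow> M\<^sup>b\<close>; \<open>tuple_app\<close> and \<open>tuple_of\<close>
  translate between the two.\<close>
definition tuple_app :: "nat \<Rightarrow> (nat \<Rightarrow> 'm \<Rightarrow> 'm) \<Rightarrow> 'm \<Rightarrow> nat \<Rightarrow> 'm" where
  "tuple_app b t m = (\<lambda>j\<in>{..<b}. t j m)"

definition tuple_of :: "('a, 'm) module \<Rightarrow> nat \<Rightarrow> ('m \<Rightarrow> nat \<Rightarrow> 'm) \<Rightarrow> nat \<Rightarrow> 'm \<Rightarrow> 'm" where
  "tuple_of M b u = (\<lambda>j\<in>{..<b}. \<lambda>m\<in>carrier M. u m j)"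

locale endo = cmodule R M for R :: "('a, 'c) ring_scheme" (structure) and M :: "('a, 'm) module" (structure)
begin

abbreviation "E \<equiv> End_ring R M"

abbreviation "F b \<equiv> free_module E b"

lemma E_ring: "ring E" by (rule End_ring_ring)

lemma rmodule_E: "rmodule E (right_regular E)" by (rule rmodule_right_regular[OF E_ring])

lemma rmodule_F: "rmodule E (F b)" by (rule rmodule_pow[OF rmodule_E])

lemma rmodule_Mb: "rmodule R (pow_module M b)" by (rule rmodule_pow[OF rmodule_axioms])

lemma F_coord: "t \<in> carrier (F b) \<Longrightarrow> j < b \<Longrightarrow> t j \<in> linear_maps R M M"
  by (auto simp: PiE_iff)

lemma tuple_app_linear:
  assumes "t \<in> carrier (F b)"
  shows "is_linear R M (pow_module M b) (tuple_app b t)"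
proof -
  note c = linear_mapsD[OF F_coord[OF assms]]
  show ?thesis by (rule is_linearI) (auto simp: tuple_app_def fun_eq_iff c(1-3))
qed

lemma tuple_of_closed:
  assumes "is_linear R M (pow_module M b) u"
  shows "tuple_of M b u \<in> carrier (F b)"
proof -
  have "(\<lambda>m\<in>carrier M. u m j) \<in> linear_maps R M M" if "j < b" for j
    by (rule restrict_linear[OF is_linear_comp[OF assms pow_proj_linear[OF that]]])
  then show ?thesis by (simp add: tuple_of_def)
qed

lemma tuple_app_of: "is_linear R M (pow_module M b) u \<Longrightarrow> m \<in> carrier M \<Longrightarrow> tuple_app b (tuple_of M b u) m = u m"
  using is_linearD(1)[of R M "pow_module M b" u m]
  by (auto simp: tuple_app_def tuple_of_def fun_eq_iff PiE_iff extensional_def)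

lemma tuple_app_inject:
  assumes "t \<in> carrier (F b)" "t' \<in> carrier (F b)" "\<And>m. m \<in> carrier M \<Longrightarrow> tuple_app b t m = tuple_app b t' m"
  shows "t = t'"
proof (rule PiE_ext[OF assms(1,2)[unfolded pow_module_simps]])
  fix j assume "j \<in> {..<b}"
  then have j: "j < b" by simp
  show "t j = t' j"
  proof (rule linear_maps_eqI[OF F_coord[OF assms(1) j] F_coord[OF assms(2) j]])
    fix m assume "m \<in> carrier M"
    from fun_cong[OF assms(3)[OF this], of j] show "t j m = t' j m" using j by (simp add: tuple_app_def)
  qed
qed

lemma tuple_app_add:
  "t \<in> carrier (F b) \<Longrightarrow> t' \<in> carrier (F b) \<Longrightarrow> m \<in> carrier M \<Longrightarrow>
   tuple_app b (t \<oplus>\<^bsub>F b\<^esub> t') m = tuple_app b t m \<oplus>\<^bsub>pow_module M b\<^esub> tuple_app b t' m"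
  by (auto simp: tuple_app_def fun_eq_iff)

text \<open>Multiplication in \<open>E\<close> is composition, so acting on a tuple from the right
  is precomposition; E^b and Hom_R(M, M^b) are thereby identified as right modules.\<close>

lemma tuple_app_smult:
  "a \<in> carrier E \<Longrightarrow> t \<in> carrier (F b) \<Longrightarrow> m \<in> carrier M \<Longrightarrow> tuple_app b (a \<odot>\<^bsub>F b\<^esub> t) m = tuple_app b t (a m)"
  by (auto simp: tuple_app_def fun_eq_iff compose_def)

lemma tuple_app_zero: "m \<in> carrier M \<Longrightarrow> tuple_app b \<zero>\<^bsub>F b\<^esub> m = \<zero>\<^bsub>pow_module M b\<^esub>"
  by (auto simp: tuple_app_def fun_eq_iff)

lemma tuple_app_psum:
  assumes "\<And>j. j < k \<Longrightarrow> f j \<in> carrier (F b)" "m \<in> carrier M"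
  shows "tuple_app b (psum (F b) f k) m = psum (pow_module M b) (\<lambda>j. tuple_app b (f j) m) k"
  using assms(1)
proof (induction k)
  case 0
  show ?case unfolding psum.simps by (rule tuple_app_zero[OF assms(2)])
next
  case (Suc k)
  have "psum (F b) f k \<in> carrier (F b)" by (rule rmodule.psum_closed[OF rmodule_F]) (use Suc.prems in auto)
  then show ?case using Suc tuple_app_add[of "psum (F b) f k" b "f k" m] assms(2)
    by (simp del: pow_module_simps)
qed

text \<open>The R-linear map M^b -> M^c whose j-th column is the image of the j-th unit vector, that
  is, \<open>\<phi>\<close> tensored over \<open>E\<close> with \<open>M\<close>.\<close>

definition matrix_map :: "nat \<Rightarrow> nat \<Rightarrow> ((nat \<Rightarrow> 'm \<Rightarrow> 'm) \<Rightarrow> (nat \<Rightarrow> 'm \<Rightarrow> 'm)) \<Rightarrow> (nat \<Rightarrow> 'm) \<Rightarrow> nat \<Rightarrow> 'm" where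
  "matrix_map b c \<phi> m = psum (pow_module M c) (\<lambda>j. tuple_app c (\<phi> (unit_vec E b j)) (m j)) b"

lemma matrix_map_linear:
  assumes "is_linear E (F b) (F c) \<phi>"
  shows "is_linear R (pow_module M b) (pow_module M c) (matrix_map b c \<phi>)"
  unfolding matrix_map_def
proof (rule psum_linear[OF rmodule_Mb rmodule_Mb])
  fix j assume j: "j < b"
  show "is_linear R (pow_module M b) (pow_module M c) (\<lambda>m. tuple_app c (\<phi> (unit_vec E b j)) (m j))"
    using is_linear_comp[OF pow_proj_linear[OF j]
        tuple_app_linear[OF is_linearD(1)[OF assms unit_vec_closed[OF E_ring]]]] .
qed

text \<open>Hom_R(M, -) turns the matrix back into \<open>\<phi>\<close>: expand \<open>t\<close> in
  unit vectors and use E-linearity.\<close>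

lemma matrix_map_app:
  assumes "is_linear E (F b) (F c) \<phi>" "t \<in> carrier (F b)" "m \<in> carrier M"
  shows "tuple_app c (\<phi> t) m = matrix_map b c \<phi> (tuple_app b t m)"
proof -
  interpret Fb: rmodule E "F b" by (rule rmodule_F)
  have t: "t j \<in> carrier E" if "j < b" for j using F_coord[OF assms(2) that] by simp
  note u = unit_vec_closed[OF E_ring, of b]
  have cl: "t j \<odot>\<^bsub>F b\<^esub> unit_vec E b j \<in> carrier (F b)" if "j < b" for j
    by (rule Fb.smult_closed[OF t[OF that] u])
  have "\<phi> t = psum (F c) (\<lambda>j. \<phi> (t j \<odot>\<^bsub>F b\<^esub> unit_vec E b j)) b"
    using linear_psum[where k = b and f = "\<lambda>j. t j \<odot>\<^bsub>F b\<^esub> unit_vec E b j", OF rmodule_F rmodule_F assms(1) cl]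
    unfolding free_module_expand[OF E_ring assms(2), symmetric] .
  also have "\<dots> = psum (F c) (\<lambda>j. t j \<odot>\<^bsub>F c\<^esub> \<phi> (unit_vec E b j)) b"
    by (rule psum_cong) (rule is_linearD(3)[OF assms(1) t u])
  finally have \<phi>t: "\<phi> t = psum (F c) (\<lambda>j. t j \<odot>\<^bsub>F c\<^esub> \<phi> (unit_vec E b j)) b" .
  have "tuple_app c (\<phi> t) m = psum (pow_module M c) (\<lambda>j. tuple_app c (t j \<odot>\<^bsub>F c\<^esub> \<phi> (unit_vec E b j)) m) b"
    unfolding \<phi>t
    by (rule tuple_app_psum[OF right_module.smult_closed[OF rmodule.axioms[OF rmodule_F] t is_linearD(1)[OF assms(1) u]] assms(3)])
  also have "\<dots> = matrix_map b c \<phi> (tuple_app b t m)"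
    unfolding matrix_map_def
  proof (rule psum_cong)
    fix j assume j: "j < b"
    show "tuple_app c (t j \<odot>\<^bsub>F c\<^esub> \<phi> (unit_vec E b j)) m = tuple_app c (\<phi> (unit_vec E b j)) (tuple_app b t m j)"
    proof -
      have "tuple_app b t m j = t j m" using j by (simp add: tuple_app_def)
      then show ?thesis by (simp only: tuple_app_smult[OF t[OF j] is_linearD(1)[OF assms(1) u] assms(3)])
    qed
  qed
  finally show ?thesis .
qed

text \<open>An element of M^a is the sum of the contributions of its coordinates, and each of these
  is a value of a column, on which the hypothesis acts through the unit vectors.\<close>

lemma matrix_map_comp_zero:
  assumes "is_linear E (F a) (F b) \<psi>" "is_linear E (F b) (F c) \<phi>"
    "\<And>t. t \<in> carrier (F a) \<Longrightarrow> \<phi> (\<psi> t) = \<zero>\<^bsub>F c\<^esub>" "m \<in> carrier (pow_module M a)"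
  shows "matrix_map b c \<phi> (matrix_map a b \<psi> m) = \<zero>\<^bsub>pow_module M c\<^esub>"
proof -
  interpret Mc: rmodule R "pow_module M c" by (rule rmodule_Mb)
  have m: "m j \<in> carrier M" if "j < a" for j using assms(4) that by (auto simp: PiE_iff)
  note u = unit_vec_closed[OF E_ring, of a]
  note pu = is_linearD(1)[OF assms(1) u]
  have cl: "tuple_app b (\<psi> (unit_vec E a j)) (m j) \<in> carrier (pow_module M b)" if "j < a" for j
    by (rule is_linearD(1)[OF tuple_app_linear[OF pu] m[OF that]])
  have "matrix_map b c \<phi> (matrix_map a b \<psi> m)
      = psum (pow_module M c) (\<lambda>j. matrix_map b c \<phi> (tuple_app b (\<psi> (unit_vec E a j)) (m j))) a"
    unfolding matrix_map_def[of a b]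
    by (rule linear_psum[OF rmodule_Mb rmodule_Mb matrix_map_linear[OF assms(2)] cl])
  also have "\<dots> = psum (pow_module M c) (\<lambda>j. \<zero>\<^bsub>pow_module M c\<^esub>) a"
  proof (rule psum_cong)
    fix j assume j: "j < a"
    show "matrix_map b c \<phi> (tuple_app b (\<psi> (unit_vec E a j)) (m j)) = \<zero>\<^bsub>pow_module M c\<^esub>"
      unfolding matrix_map_app[OF assms(2) pu m[OF j], symmetric] assms(3)[OF u]
      by (rule tuple_app_zero[OF m[OF j]])
  qed
  also have "\<dots> = \<zero>\<^bsub>pow_module M c\<^esub>" by (rule Mc.psum_zero)
  finally show ?thesis .
qed

text \<open>Exactness of \<open>Hom(M, -)\<close> on a complex passes to \<open>Hom(T, -)\<close> for all \<open>T\<close> in \<open>add M\<close>.\<close>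
lemma matrix_map_exact:
  assumes "is_linear E (F a) (F b) \<psi>" "is_linear E (F b) (F c) \<phi>"
    "ker_of (F b) (F c) \<phi> \<subseteq> \<psi> ` carrier (F a)"
    "rmodule R T" "in_add R M T" "is_linear R T (pow_module M b) u"
    "\<And>t. t \<in> carrier T \<Longrightarrow> matrix_map b c \<phi> (u t) = \<zero>\<^bsub>pow_module M c\<^esub>"
  shows "\<exists>w. is_linear R T (pow_module M a) w \<and> (\<forall>t \<in> carrier T. u t = matrix_map a b \<psi> (w t))"
proof -
  interpret Ma: rmodule R "pow_module M a" by (rule rmodule_Mb)
  interpret Fc: rmodule E "F c" by (rule rmodule_F)
  interpret Mb: rmodule R "pow_module M b" by (rule rmodule_Mb)
  note lin = is_linearD[OF matrix_map_linear[OF assms(1)]]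
  have "\<exists>w. is_linear R T (pow_module M a) w \<and> (\<forall>t \<in> carrier T. u (h t) = matrix_map a b \<psi> (w t))"
    if "factors_through R M T T h" for h
    using that
  proof (induction rule: factors_through.induct)
    case (through_zero h)
    have "u \<zero>\<^bsub>T\<^esub> = \<zero>\<^bsub>pow_module M b\<^esub>" by (rule rmodule.linear_zero[OF assms(4) rmodule_Mb assms(6)])
    moreover have "matrix_map a b \<psi> \<zero>\<^bsub>pow_module M a\<^esub> = \<zero>\<^bsub>pow_module M b\<^esub>"
      by (rule Ma.linear_zero[OF rmodule_Mb matrix_map_linear[OF assms(1)]])
    ultimately show ?case
      using rmodule.linear_zero_map[OF assms(4) rmodule_Mb[of a]] through_zero
      by (intro exI[of _ "\<lambda>_. \<zero>\<^bsub>pow_module M a\<^esub>"]) (simp del: pow_module_simps)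
  next
    case (through_step h f g h')
    then obtain w where w: "is_linear R T (pow_module M a) w" "\<And>t. t \<in> carrier T \<Longrightarrow> u (h t) = matrix_map a b \<psi> (w t)"
      by blast
    have ug: "is_linear R M (pow_module M b) (\<lambda>m. u (g m))"
      by (rule is_linear_comp[OF through_step(3) assms(6)])
    \<comment> \<open>The composite M -> T -> M^b, read as an element of E^b. It lies in the kernel
      of \<open>\<phi>\<close>, and a preimage under \<open>\<psi>\<close> is a map M -> M^a that
      lifts the composite.\<close>
    let ?s = "tuple_of M b (\<lambda>m. u (g m))"
    have s: "?s \<in> carrier (F b)" by (rule tuple_of_closed[OF ug])
    have "\<phi> ?s = \<zero>\<^bsub>F c\<^esub>"
    proof (rule tuple_app_inject[OF is_linearD(1)[OF assms(2) s]])
      show "\<zero>\<^bsub>F c\<^esub> \<in> carrier (F c)" by (rule Fc.M.zero_closed)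
      fix m assume m: "m \<in> carrier M"
      show "tuple_app c (\<phi> ?s) m = tuple_app c \<zero>\<^bsub>F c\<^esub> m"
        unfolding matrix_map_app[OF assms(2) s m] tuple_app_of[OF ug m] tuple_app_zero[OF m]
        by (rule assms(7)[OF is_linearD(1)[OF through_step(3) m]])
    qed
    then have "?s \<in> ker_of (F b) (F c) \<phi>" using s unfolding ker_of_def by blast
    then obtain t where t: "t \<in> carrier (F a)" "?s = \<psi> t" using assms(3) by blast
    have ta: "is_linear R T (pow_module M a) (\<lambda>x. tuple_app a t (f x))"
      by (rule is_linear_comp[OF through_step(2) tuple_app_linear[OF t(1)]])
    have "u (h' x) = matrix_map a b \<psi> (w x \<oplus>\<^bsub>pow_module M a\<^esub> tuple_app a t (f x))"
      if x: "x \<in> carrier T" for x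
    proof -
      have fx: "f x \<in> carrier M" by (rule is_linearD(1)[OF through_step(2) x])
      have "u (h' x) = u (h x) \<oplus>\<^bsub>pow_module M b\<^esub> u (g (f x))"
        using through_step(4) x is_linearD(2)[OF assms(6) through_closed[OF assms(4,4) through_step(1) x]
            is_linearD(1)[OF through_step(3) fx]] by (simp del: pow_module_simps)
      also have "u (g (f x)) = tuple_app b (\<psi> t) (f x)" using tuple_app_of[OF ug fx] t(2) by simp
      also have "\<dots> = matrix_map a b \<psi> (tuple_app a t (f x))" by (rule matrix_map_app[OF assms(1) t(1) fx])
      also have "u (h x) = matrix_map a b \<psi> (w x)" by (rule w(2)[OF x])
      finally show ?thesis by (simp only: lin(2)[OF is_linearD(1)[OF w(1) x] is_linearD(1)[OF ta x]])
    qed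
    moreover have "is_linear R T (pow_module M a) (\<lambda>x. w x \<oplus>\<^bsub>pow_module M a\<^esub> tuple_app a t (f x))"
      by (rule is_linearI) (simp_all add: is_linearD[OF w(1)] is_linearD[OF ta] Ma.M.a_ac Ma.smult_r_distr del: pow_module_simps)
    ultimately show ?case by blast
  qed
  from this[OF assms(5)] show ?thesis .
qed

text \<open>By left exactness the kernel of \<open>\<phi>\<close> is Hom_R(M, K) with K the kernel
  of the matrix. The functor Hom_R(M, -) turns a factorization of the identity of K through
  \<open>M\<close> into one of right modules through Hom_R(M, M) = E.\<close>

lemma matrix_kernel_in_add:
  assumes "is_linear E (F b) (F c) \<phi>"
    "in_add R M ((pow_module M b)\<lparr>carrier := ker_of (pow_module M b) (pow_module M c) (matrix_map b c \<phi>)\<rparr>)"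
  shows "in_add E (right_regular E) ((F b)\<lparr>carrier := ker_of (F b) (F c) \<phi>\<rparr>)"
proof -
  let ?K = "(pow_module M b)\<lparr>carrier := ker_of (pow_module M b) (pow_module M c) (matrix_map b c \<phi>)\<rparr>"
  let ?W = "(F b)\<lparr>carrier := ker_of (F b) (F c) \<phi>\<rparr>"
  have sK: "is_sub R (pow_module M b) (carrier ?K)"
    using rmodule.ker_sub[OF rmodule_Mb rmodule_Mb matrix_map_linear[OF assms(1)]] by simp
  have sW: "is_sub E (F b) (carrier ?W)" using rmodule.ker_sub[OF rmodule_F rmodule_F assms(1)] by simp
  note Wb = is_subD(5)[OF sW] and incl = is_linear_sub_incl[OF sK, simplified]
  interpret Fc: rmodule E "F c" by (rule rmodule_F)
  have app: "is_linear R M ?K (tuple_app b \<omega>)" if \<omega>: "\<omega> \<in> carrier ?W" for \<omega>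
  proof -
    have "tuple_app b \<omega> m \<in> carrier ?K" if m: "m \<in> carrier M" for m
    proof -
      have "matrix_map b c \<phi> (tuple_app b \<omega> m) = tuple_app c (\<phi> \<omega>) m"
        by (rule matrix_map_app[OF assms(1) Wb[OF \<omega>] m, symmetric])
      also have "\<phi> \<omega> = \<zero>\<^bsub>F c\<^esub>" using \<omega> by (simp add: ker_of_def del: pow_module_simps)
      also have "tuple_app c \<zero>\<^bsub>F c\<^esub> m = \<zero>\<^bsub>pow_module M c\<^esub>" by (rule tuple_app_zero[OF m])
      finally show ?thesis
        using is_linearD(1)[OF tuple_app_linear[OF Wb[OF \<omega>]] m]
          by (simp add: ker_of_def del: pow_module_simps)
    qed
    then show ?thesis using is_linear_sub_cod[OF tuple_app_linear[OF Wb[OF \<omega>]]]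
      by (simp add: image_subset_iff)
  qed
  have of_W: "tuple_of M b u \<in> carrier ?W" if u: "is_linear R M ?K u" for u
  proof -
    have ub: "is_linear R M (pow_module M b) u" using is_linear_comp[OF u incl] by simp
    note s = tuple_of_closed[OF ub]
    have "\<phi> (tuple_of M b u) = \<zero>\<^bsub>F c\<^esub>"
    proof (rule tuple_app_inject[OF is_linearD(1)[OF assms(1) s] Fc.M.zero_closed])
      fix m assume m: "m \<in> carrier M"
      show "tuple_app c (\<phi> (tuple_of M b u)) m = tuple_app c \<zero>\<^bsub>F c\<^esub> m"
        unfolding matrix_map_app[OF assms(1) s m] tuple_app_of[OF ub m] tuple_app_zero[OF m]
        using is_linearD(1)[OF u m] by (simp add: ker_of_def del: pow_module_simps)
    qed
    then show ?thesis using s by (simp add: ker_of_def del: pow_module_simps)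
  qed
  have "factors_through E (right_regular E) ?W ?W (\<lambda>\<omega>. tuple_of M b (\<lambda>m. h (tuple_app b \<omega> m)))"
    if "factors_through R M ?K ?K h" for h
    using that
  proof (induction rule: factors_through.induct)
    case (through_zero h)
    show ?case
    proof (rule factors_through.through_zero, rule ballI)
      fix \<omega> assume \<omega>: "\<omega> \<in> carrier ?W"
      have "h (tuple_app b \<omega> m) = \<zero>\<^bsub>pow_module M b\<^esub>" if "m \<in> carrier M" for m
        using through_zero is_linearD(1)[OF app[OF \<omega>] that] by simp
      then show "tuple_of M b (\<lambda>m. h (tuple_app b \<omega> m)) = \<zero>\<^bsub>?W\<^esub>"
        by (auto simp: tuple_of_def fun_eq_iff restrict_def)
    qed
  next
    case (through_step h f g h')
    have gb: "is_linear R M (pow_module M b) g" using is_linear_comp[OF through_step(3) incl] by simp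
    have lin1: "is_linear E ?W (right_regular E) (\<lambda>\<omega>. \<lambda>m\<in>carrier M. f (tuple_app b \<omega> m))"
    proof
      show "(\<lambda>m\<in>carrier M. f (tuple_app b \<omega> m)) \<in> carrier (right_regular E)" if "\<omega> \<in> carrier ?W" for \<omega>
        using restrict_linear[OF is_linear_comp[OF app[OF that] through_step(2)]] by simp
      show "(\<lambda>m\<in>carrier M. f (tuple_app b (\<omega> \<oplus>\<^bsub>?W\<^esub> \<omega>') m))
          = (\<lambda>m\<in>carrier M. f (tuple_app b \<omega> m)) \<oplus>\<^bsub>right_regular E\<^esub> (\<lambda>m\<in>carrier M. f (tuple_app b \<omega>' m))"
        if "\<omega> \<in> carrier ?W" "\<omega>' \<in> carrier ?W" for \<omega> \<omega>'
      proof -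
        have "f (tuple_app b (\<omega> \<oplus>\<^bsub>?W\<^esub> \<omega>') m) = f (tuple_app b \<omega> m) \<oplus>\<^bsub>M\<^esub> f (tuple_app b \<omega>' m)"
          if m: "m \<in> carrier M" for m
          using tuple_app_add[OF Wb[OF \<open>\<omega> \<in> carrier ?W\<close>] Wb[OF \<open>\<omega>' \<in> carrier ?W\<close>] m]
            is_linearD(2)[OF through_step(2) is_linearD(1)[OF app[OF \<open>\<omega> \<in> carrier ?W\<close>] m]
              is_linearD(1)[OF app[OF \<open>\<omega>' \<in> carrier ?W\<close>] m]]
          by (simp del: pow_module_simps)
        then show ?thesis by (auto simp: fun_eq_iff simp del: pow_module_simps)
      qed
      show "(\<lambda>m\<in>carrier M. f (tuple_app b (a \<odot>\<^bsub>?W\<^esub> \<omega>) m))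
          = a \<odot>\<^bsub>right_regular E\<^esub> (\<lambda>m\<in>carrier M. f (tuple_app b \<omega> m))"
        if "a \<in> carrier E" "\<omega> \<in> carrier ?W" for a \<omega>
      proof -
        have "f (tuple_app b (a \<odot>\<^bsub>?W\<^esub> \<omega>) m) = f (tuple_app b \<omega> (a m))" if m: "m \<in> carrier M" for m
          using tuple_app_smult[OF \<open>a \<in> carrier E\<close> Wb[OF \<open>\<omega> \<in> carrier ?W\<close>] m]
            by (simp del: pow_module_simps)
        then show ?thesis using that(1) linear_mapsD(1)[of a R M M]
          by (auto simp: fun_eq_iff compose_def simp del: pow_module_simps)
      qed
    qed
    have lin2: "is_linear E (right_regular E) ?W (\<lambda>a. tuple_of M b (\<lambda>m. g (a m)))"
    proof
      fix a assume "a \<in> carrier (right_regular E)"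
      then have a: "is_linear R M M a" by (simp add: linear_maps_iff)
      show "tuple_of M b (\<lambda>m. g (a m)) \<in> carrier ?W" by (rule of_W[OF is_linear_comp[OF a through_step(3)]])
    next
      fix a a' assume "a \<in> carrier (right_regular E)" "a' \<in> carrier (right_regular E)"
      then have a: "is_linear R M M a" "is_linear R M M a'" by (simp_all add: linear_maps_iff)
      show "tuple_of M b (\<lambda>m. g ((a \<oplus>\<^bsub>right_regular E\<^esub> a') m))
          = tuple_of M b (\<lambda>m. g (a m)) \<oplus>\<^bsub>?W\<^esub> tuple_of M b (\<lambda>m. g (a' m))"
        using is_linearD(1)[OF a(1)] is_linearD(1)[OF a(2)]
        by (auto simp: tuple_of_def fun_eq_iff is_linearD(2)[OF gb])
    next
      fix r a assume *: "r \<in> carrier E" "a \<in> carrier (right_regular E)"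
      show "tuple_of M b (\<lambda>m. g ((r \<odot>\<^bsub>right_regular E\<^esub> a) m)) = r \<odot>\<^bsub>?W\<^esub> tuple_of M b (\<lambda>m. g (a m))"
        using * linear_mapsD(1)[of r R M M] by (auto simp: tuple_of_def fun_eq_iff compose_def)
    qed
    show ?case
    proof (rule factors_through.through_step[OF through_step.IH lin1 lin2], rule ballI)
      fix \<omega> assume \<omega>: "\<omega> \<in> carrier ?W"
      have "h' (tuple_app b \<omega> m) = h (tuple_app b \<omega> m) \<oplus>\<^bsub>pow_module M b\<^esub> g (f (tuple_app b \<omega> m))"
        if "m \<in> carrier M" for m
        using through_step(4) is_linearD(1)[OF app[OF \<omega>] that] by (simp del: pow_module_simps)
      then show "tuple_of M b (\<lambda>m. h' (tuple_app b \<omega> m)) = tuple_of M b (\<lambda>m. h (tuple_app b \<omega> m))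
          \<oplus>\<^bsub>?W\<^esub> tuple_of M b (\<lambda>m. g ((\<lambda>m\<in>carrier M. f (tuple_app b \<omega> m)) m))"
        by (auto simp: tuple_of_def fun_eq_iff)
    qed
  qed
  from this[OF assms(2)] have "factors_through E (right_regular E) ?W ?W (\<lambda>\<omega>. tuple_of M b (tuple_app b \<omega>))" by simp
  then show ?thesis
  proof (rule through_cong)
    fix \<omega> assume \<omega>: "\<omega> \<in> carrier ?W"
    note l = tuple_app_linear[OF Wb[OF \<omega>]]
    show "\<omega> = tuple_of M b (tuple_app b \<omega>)"
      by (rule tuple_app_inject[OF Wb[OF \<omega>] tuple_of_closed[OF l]]) (rule tuple_app_of[OF l, symmetric])
  qed
qed

end

section \<open>The endomorphism ring is right Noetherian\<close>

text \<open>Evaluation at generators of \<open>M\<close> embeds \<open>E\<close> into the Noetherian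
  R-module M^l. Right ideals become R-submodules there, and generators over \<open>R\<close> lift to
  generators over \<open>E\<close>.\<close>

lemma (in endo) noeth_E:
  assumes "noeth R (right_regular R)" "fin_gen R M"
  shows "noeth E (right_regular E)"
  unfolding noeth_def
proof (intro allI impI)
  interpret ER: rmodule E "right_regular E" by (rule rmodule_E)
  fix W assume "is_sub E (right_regular E) W"
  note W = is_subD[OF this, simplified]
  obtain A where A: "finite A" "A \<subseteq> carrier M" "carrier M \<subseteq> lspan R M A"
    using assms(2) fin_gen_iff_lspan by blast
  obtain a and l :: nat where al: "A = a ` {..<l}"
    using A(1) by (auto simp: finite_conv_nat_seg_image lessThan_def)
  have ac: "a i \<in> carrier M" if "i < l" for i using that A(2) al by auto
  define ev where "ev f = (\<lambda>i\<in>{..<l}. f (a i))" for f :: "'m \<Rightarrow> 'm"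
  have inj: "f = g" if "f \<in> carrier E" "g \<in> carrier E" "ev f = ev g" for f g
  proof -
    have fg: "f \<in> linear_maps R M M" "g \<in> linear_maps R M M" using that by auto
    have "f x = g x" if "x \<in> A" for x
    proof -
      from that al obtain i where "i < l" "x = a i" by auto
      then show ?thesis using fun_cong[OF \<open>ev f = ev g\<close>, of i] by (simp add: ev_def)
    qed
    note agree = linear_ext_on_lspan[OF rmodule_axioms linear_maps_linear[OF fg(1)] linear_maps_linear[OF fg(2)] A(2) this]
    show ?thesis by (rule linear_maps_eqI[OF fg]) (rule agree, use A(3) in auto)
  qed
  have ev_add: "ev (f \<oplus>\<^bsub>E\<^esub> g) = ev f \<oplus>\<^bsub>pow_module M l\<^esub> ev g" for f g
    using ac by (auto simp: ev_def fun_eq_iff)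
  \<comment> \<open>Multiplication by \<open>r\<close> as an element of \<open>E\<close>; right
    multiplication by it realises the action of \<open>R\<close> on \<open>E\<close>, so right
    ideals are closed under \<open>R\<close>.\<close>
  define sc where "sc r = (\<lambda>x\<in>carrier M. r \<odot>\<^bsub>M\<^esub> x)" for r
  have sc: "sc r \<in> carrier E" if "r \<in> carrier R" for r
    unfolding sc_def using restrict_linear[OF smult_linear[OF that]] by simp
  have ev_smult: "ev (f \<otimes>\<^bsub>E\<^esub> sc r) = r \<odot>\<^bsub>pow_module M l\<^esub> ev f" if "r \<in> carrier R" "f \<in> carrier E" for f r
    using that ac linear_mapsD(3)[of f R M M r] by (auto simp: ev_def sc_def fun_eq_iff compose_def)
  have ev_zero: "ev \<zero>\<^bsub>E\<^esub> = \<zero>\<^bsub>pow_module M l\<^esub>" using ac by (auto simp: ev_def fun_eq_iff)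
  have ev_c: "ev f \<in> carrier (pow_module M l)" if "f \<in> carrier E" for f
    using that ac linear_mapsD(1)[of f R M M] by (auto simp: ev_def)
  have "noeth R (pow_module M l)"
    by (rule noeth_of_fin_gen[OF assms(1) rmodule_Mb in_add_fin_gen[OF rmodule_axioms rmodule_Mb in_add_pow[OF rmodule_axioms] assms(2)]])
  moreover have "is_sub R (pow_module M l) (ev ` W)"
  proof
    show "ev ` W \<subseteq> carrier (pow_module M l)"
    proof (rule image_subsetI)
      fix f assume "f \<in> W"
      then have "f \<in> carrier E" using W(5) by simp
      then show "ev f \<in> carrier (pow_module M l)" by (rule ev_c)
    qed
    show "\<zero>\<^bsub>pow_module M l\<^esub> \<in> ev ` W"
    proof -
      have "\<zero>\<^bsub>E\<^esub> \<in> W" using W(2) by simp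
      then show ?thesis unfolding ev_zero[symmetric] by (rule imageI)
    qed
  next
    fix x y assume "x \<in> ev ` W" "y \<in> ev ` W"
    then obtain f g where fg: "f \<in> W" "g \<in> W" "x = ev f" "y = ev g" by (elim imageE)
    have "f \<oplus>\<^bsub>E\<^esub> g \<in> W" using W(3)[OF fg(1,2)] by simp
    then show "x \<oplus>\<^bsub>pow_module M l\<^esub> y \<in> ev ` W" unfolding fg(3,4) ev_add[symmetric] by (rule imageI)
  next
    fix r x assume r: "r \<in> carrier R" and "x \<in> ev ` W"
    then obtain f where f: "f \<in> W" "x = ev f" by (elim imageE)
    have fE: "f \<in> carrier E" using W(5)[OF f(1)] by simp
    have "f \<otimes>\<^bsub>E\<^esub> sc r \<in> W" using W(4)[OF _ f(1), of "sc r"] sc[OF r] by simp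
    then show "r \<odot>\<^bsub>pow_module M l\<^esub> x \<in> ev ` W" unfolding f(2) ev_smult[OF r fE, symmetric] by (rule imageI)
  qed
  ultimately obtain B where B: "finite B" "B \<subseteq> ev ` W" "ev ` W \<subseteq> lspan R (pow_module M l) B"
    unfolding noeth_def by meson
  obtain B0 where B0: "B0 \<subseteq> W" "finite B0" "B = ev ` B0" using finite_subset_image[OF B(1,2)] by blast
  have B0E: "B0 \<subseteq> carrier (right_regular E)" using B0(1) W(1) by simp
  note S = ER.lspan_sub[OF B0E]
  have SE: "u \<in> carrier E" if "u \<in> lspan E (right_regular E) B0" for u using is_subD(5)[OF S that] by simp
  have lift: "\<exists>u \<in> lspan E (right_regular E) B0. y = ev u" if "y \<in> lspan R (pow_module M l) B" for y
    using that
  proof (induction rule: lspan.induct)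
    case lspan_zero
    show ?case using ev_zero lspan.lspan_zero[of "right_regular E" E B0]
      by (intro bexI[of _ "\<zero>\<^bsub>E\<^esub>"]) (simp_all del: pow_module_simps End_ring_simps)
  next
    case (lspan_base b)
    then show ?case using B0(3) by (auto intro: lspan.lspan_base)
  next
    case (lspan_add x y)
    then obtain u v where uv: "u \<in> lspan E (right_regular E) B0" "x = ev u"
      "v \<in> lspan E (right_regular E) B0" "y = ev v" by (elim bexE)
    show ?case unfolding uv(2,4) ev_add[symmetric]
      using lspan.lspan_add[OF uv(1,3)] by (intro bexI[of _ "u \<oplus>\<^bsub>E\<^esub> v"] refl) (simp del: End_ring_simps)
  next
    case (lspan_smult r x)
    then obtain u where u: "u \<in> lspan E (right_regular E) B0" "x = ev u" by (elim bexE)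
    show ?case unfolding u(2) ev_smult[OF lspan_smult(1) SE[OF u(1)], symmetric]
      using lspan.lspan_smult[OF sc[OF lspan_smult(1)] u(1)]
      by (intro bexI[of _ "u \<otimes>\<^bsub>E\<^esub> sc r"] refl) (simp del: End_ring_simps)
  qed
  have "W \<subseteq> lspan E (right_regular E) B0"
  proof
    fix w assume w: "w \<in> W"
    then have "ev w \<in> lspan R (pow_module M l) B" using B(3) by (intro subsetD[OF B(3)] imageI)
    from lift[OF this] obtain u where u: "u \<in> lspan E (right_regular E) B0" "ev w = ev u" by (elim bexE)
    have wE: "w \<in> carrier E" using W(5)[OF w] by simp
    show "w \<in> lspan E (right_regular E) B0" using inj[OF wE SE[OF u(1)] u(2)] u(1) by simp
  qed
  then show "\<exists>A. finite A \<and> A \<subseteq> W \<and> W \<subseteq> lspan E (right_regular E) A" using B0(1,2) by blast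
qed

section \<open>The syzygy in degree max d 2 lies in add E\<close>

context cm_setting
begin

text \<open>By \<open>matrix_kernel_in_add\<close> it is enough to put the kernel of the matrix
  \<open>f n\<close> into add M. The terms \<open>N i\<close> carry \<open>d\<close> regular
  elements each; the count is how many of them reach the syzygies \<open>L i\<close>.\<close>

lemma syzygy_kernel_in_add:
  fixes b :: "nat \<Rightarrow> nat"
  defines "E \<equiv> End_ring R M"
  assumes n: "d \<le> Suc (Suc n)"
    and lin: "\<And>i. is_linear E (free_module E (b (Suc i))) (free_module E (b i)) (\<phi> i)"
    and exact: "\<And>i. \<phi> (Suc i) ` carrier (free_module E (b (Suc (Suc i))))
      = ker_of (free_module E (b (Suc i))) (free_module E (b i)) (\<phi> i)"
  shows "in_add E (right_regular E)
    ((free_module E (b (Suc n)))\<lparr>carrier := ker_of (free_module E (b (Suc n))) (free_module E (b n)) (\<phi> n)\<rparr>)"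
proof -
  interpret EM: endo R M unfolding endo_def by (rule cmodule_restrict[OF M_S])
  note lin' = lin[unfolded E_def] and exact' = exact[unfolded E_def]
  let ?Mb = "\<lambda>i. pow_module M (b i)"
  define f where "f i = EM.matrix_map (b (Suc i)) (b i) (\<phi> i)" for i
  have f: "is_linear R (?Mb (Suc i)) (?Mb i) (f i)" for i unfolding f_def
    by (rule EM.matrix_map_linear[OF lin'])
  define N where "N i = source_hom R S (?Mb i)" for i
  define \<Phi> where "\<Phi> i u = (\<lambda>t\<in>carrier S. f i (u t))" for i u
  have NS: "rmodule S (N i)" for i unfolding N_def by (rule rmodule_source_hom[OF EM.rmodule_Mb])
  have NR: "cmodule R (N i)" for i by (rule cmodule_restrict[OF NS])
  have Nr: "rmodule R (N i)" for i using NR[of i] by (simp add: cmodule_def)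
  have \<Phi>_def': "\<Phi> i = (\<lambda>u. \<lambda>t\<in>carrier S. f i (u t))" for i by (simp add: fun_eq_iff \<Phi>_def)
  have \<Phi>: "is_linear R (N (Suc i)) (N i) (\<Phi> i)" for i
    unfolding \<Phi>_def' N_def
    by (rule linear_restrict[OF source_hom_linear[OF EM.rmodule_Mb EM.rmodule_Mb f]])
  have ff: "f i (f (Suc i) m) = \<zero>\<^bsub>?Mb i\<^esub>" if "m \<in> carrier (?Mb (Suc (Suc i)))" for i m
    unfolding f_def
  proof (rule EM.matrix_map_comp_zero[OF lin' lin' _ that])
    fix t assume "t \<in> carrier (free_module (End_ring R M) (b (Suc (Suc i))))"
    then have "\<phi> (Suc i) t \<in> ker_of (free_module (End_ring R M) (b (Suc i))) (free_module (End_ring R M) (b i)) (\<phi> i)"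
      unfolding exact'[symmetric] by (rule imageI)
    then show "\<phi> i (\<phi> (Suc i) t) = \<zero>\<^bsub>free_module (End_ring R M) (b i)\<^esub>" unfolding ker_of_def by blast
  qed
  note app = linear_mapsD(1)[where N = "regular_module S", simplified]
  have ker: "ker_of (N (Suc i)) (N i) (\<Phi> i) = \<Phi> (Suc i) ` carrier (N (Suc (Suc i)))" for i
  proof
    show "\<Phi> (Suc i) ` carrier (N (Suc (Suc i))) \<subseteq> ker_of (N (Suc i)) (N i) (\<Phi> i)"
    proof (rule image_subsetI)
      fix w assume w: "w \<in> carrier (N (Suc (Suc i)))"
      have wt: "w t \<in> carrier (?Mb (Suc (Suc i)))" if "t \<in> carrier S" for t
        using w that app[of w] unfolding N_def source_hom_simps(1) by blast
      have "\<Phi> i (\<Phi> (Suc i) w) = \<zero>\<^bsub>N i\<^esub>"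
        unfolding \<Phi>_def N_def source_hom_simps(2)
        by (rule restrict_ext) (simp add: ff[OF wt] del: pow_module_simps)
      then show "\<Phi> (Suc i) w \<in> ker_of (N (Suc i)) (N i) (\<Phi> i)"
        using is_linearD(1)[OF \<Phi> w] unfolding ker_of_def by simp
    qed
    show "ker_of (N (Suc i)) (N i) (\<Phi> i) \<subseteq> \<Phi> (Suc i) ` carrier (N (Suc (Suc i)))"
    proof
      fix u assume "u \<in> ker_of (N (Suc i)) (N i) (\<Phi> i)"
      then have u: "u \<in> linear_maps R (regular_module S) (?Mb (Suc i))" and u0: "\<Phi> i u = \<zero>\<^bsub>N i\<^esub>"
        by (auto simp: ker_of_def N_def)
      have fu: "f i (u t) = \<zero>\<^bsub>?Mb i\<^esub>" if "t \<in> carrier S" for t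
        using fun_cong[OF u0, of t] that by (simp add: \<Phi>_def N_def del: pow_module_simps)
      obtain w where w: "is_linear R (regular_module S) (?Mb (Suc (Suc i))) w"
        "\<And>t. t \<in> carrier S \<Longrightarrow> u t = f (Suc i) (w t)"
        using EM.matrix_map_exact[OF lin'[of "Suc i"] lin'[of i] _ _ S_in_add linear_maps_linear[OF u]]
          exact'[of i] rmodule_mono[OF rmodule_regular ext] fu unfolding f_def by auto
      let ?w = "\<lambda>t\<in>carrier S. w t"
      have w': "?w \<in> linear_maps R (regular_module S) (?Mb (Suc (Suc i)))"
        using rmodule.restrict_linear[OF rmodule_mono[OF rmodule_regular ext] w(1)] by simp
      have "u = \<Phi> (Suc i) ?w"
        unfolding \<Phi>_def
        using w(2) linear_mapsD(4)[OF u] by (auto simp: fun_eq_iff restrict_def)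
      then show "u \<in> \<Phi> (Suc i) ` carrier (N (Suc (Suc i)))" using w' by (simp add: N_def)
    qed
  qed
  \<comment> \<open>An image at stage 0 and kernels afterwards. By \<open>ker\<close> each
    \<open>L i\<close> is also the image of \<open>\<Phi> i\<close>, so \<open>L (Suc i)\<close> is
    the kernel of a surjection from \<open>N (Suc i)\<close> onto \<open>L i\<close>.\<close>
  define L where "L i = (case i of 0 \<Rightarrow> (N 0)\<lparr>carrier := \<Phi> 0 ` carrier (N 1)\<rparr>
    | Suc k \<Rightarrow> (N (Suc k))\<lparr>carrier := ker_of (N (Suc k)) (N k) (\<Phi> k)\<rparr>)" for i
  have L: "L i = (N i)\<lparr>carrier := \<Phi> i ` carrier (N (Suc i))\<rparr>" for i
    by (simp add: L_def ker split: nat.split)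
  have L_Suc: "L (Suc i) = (N (Suc i))\<lparr>carrier := ker_of (N (Suc i)) (L i) (\<Phi> i)\<rparr>" for i
    by (simp add: L[of i]) (simp add: L_def ker_of_def)
  have sub: "is_sub R (N i) (\<Phi> i ` carrier (N (Suc i)))" for i
    by (rule rmodule.linear_image_sub[OF Nr Nr \<Phi> rmodule.sub_carrier[OF Nr]])
  obtain x where x: "x \<in> UNIV \<rightarrow> carrier R" "\<forall>i < d. x i \<in> \<mm>" "weakly_regular M x d"
    using M_MCM unfolding MCM_iff by blast
  have N_add: "in_add R M (N i)" for i unfolding N_def by (rule source_hom_pow_in_add)
  have wN: "weakly_regular (N i) x d" for i
    by (rule weakly_regular_in_add[OF EM.cmodule_axioms NR N_add _ x(3)]) (use x(1) in auto)
  have cL: "cmodule R (L i)" for i unfolding L by (rule cmodule.cmodule_sub[OF NR sub])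
  have syz: "syzygy R (N (Suc i)) (L i) (\<Phi> i) x" for i
    unfolding syzygy_def syzygy_axioms_def
    using NR cL x(1) is_linear_sub_cod[OF \<Phi>[of i] order_refl] by (simp add: L)
  \<comment> \<open>A submodule of \<open>N 0\<close> inherits the first regular element, as the
    condition for index 0 only says that \<open>x 0\<close> kills nothing but zero. For d = 0 there
    is none to claim.\<close>
  have "weakly_regular (L 0) x (min d 1)"
    unfolding weakly_regular_def
  proof (intro allI impI ballI)
    fix i y assume i: "i < min d 1" and y: "y \<in> carrier (L 0)" and xy: "x i \<odot>\<^bsub>L 0\<^esub> y \<in> seq_mult (L 0) x i"
    have "y \<in> carrier (N 0)" using y is_subD(5)[OF sub] by (simp add: L)
    then show "y \<in> seq_mult (L 0) x i" using weakly_regularD[OF wN[of 0], of 0 y] i xy by (simp add: L)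
  qed
  \<comment> \<open>After n + 1 kernels the count is min d (n + 1 + min d 1), and this is
    \<open>d\<close> because d \<le> n + 2.\<close>
  from syzygies_weakly_regular[where N = "\<lambda>i. N (Suc i)" and L = L and f = \<Phi>, OF syz L_Suc wN this, of "Suc n"]
  have wL: "weakly_regular (L (Suc n)) x d" by (rule weakly_regular_mono) (use n in auto)
  have "noeth R (N (Suc n))"
    using noeth_of_fin_gen[OF noeth_R Nr in_add_fin_gen[OF M_R Nr N_add]] M_MCM MCM_iff by blast
  then have "fin_gen R (L (Suc n))" unfolding L by (rule noeth_imp_fin_gen_sub[OF Nr _ sub])
  then have mcm: "MCM R (L (Suc n))" unfolding MCM_iff using cL x(1,2) wL by blast
  let ?K = "(?Mb (Suc n))\<lparr>carrier := ker_of (?Mb (Suc n)) (?Mb n) (f n)\<rparr>"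
  have sK: "is_sub R (?Mb (Suc n)) (carrier ?K)"
    using rmodule.ker_sub[OF EM.rmodule_Mb EM.rmodule_Mb f] by simp
  have rK: "rmodule R ?K" using rmodule.rmodule_sub[OF EM.rmodule_Mb sK] by simp
  \<comment> \<open>Left exactness of Hom_R(S, -): maps from \<open>S\<close> into \<open>?K\<close>
    are the kernel of the induced map. Hence \<open>L (Suc n)\<close> is Hom_R(S, K).\<close>
  have car: "linear_maps R (regular_module S) ?K = ker_of (N (Suc n)) (N n) (\<Phi> n)"
  proof (intro Set.set_eqI iffI)
    fix u assume u: "u \<in> linear_maps R (regular_module S) ?K"
    have uk: "u t \<in> carrier ?K" if "t \<in> carrier S" for t using app[OF u that] .
    have "u \<in> linear_maps R (regular_module S) (?Mb (Suc n))"
      using is_linear_comp[OF linear_maps_linear[OF u] is_linear_sub_incl[OF sK, simplified]] u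
      by (simp add: linear_maps_iff)
    moreover have "\<Phi> n u = \<zero>\<^bsub>N n\<^esub>"
      unfolding \<Phi>_def N_def source_hom_simps(2)
      by (rule restrict_ext) (use uk in \<open>simp add: ker_of_def del: pow_module_simps\<close>)
    ultimately show "u \<in> ker_of (N (Suc n)) (N n) (\<Phi> n)" by (simp add: ker_of_def N_def)
  next
    fix u assume "u \<in> ker_of (N (Suc n)) (N n) (\<Phi> n)"
    then have u: "u \<in> linear_maps R (regular_module S) (?Mb (Suc n))" and u0: "\<Phi> n u = \<zero>\<^bsub>N n\<^esub>"
      by (auto simp: ker_of_def N_def)
    have "u t \<in> carrier ?K" if "t \<in> carrier S" for t
      using fun_cong[OF u0, of t] that app[OF u that]
        by (simp add: \<Phi>_def N_def ker_of_def del: pow_module_simps)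
    then show "u \<in> linear_maps R (regular_module S) ?K"
      using is_linear_sub_cod[OF linear_maps_linear[OF u], of "carrier ?K"] u
      by (simp add: linear_maps_iff image_subset_iff)
  qed
  have "L (Suc n) = source_hom R S ?K"
    by (simp only: L_def nat.case car[symmetric]) (simp add: source_hom_def N_def)
  then have "in_add R M ?K" using in_add_of_source_hom_MCM[OF rK] mcm by simp
  then show ?thesis unfolding E_def f_def by (rule EM.matrix_kernel_in_add[OF lin'])
qed

end

section \<open>Projective modules and free resolutions\<close>

lemma fg_right_module_iff: "fg_right_module \<Lambda> N \<longleftrightarrow> rmodule \<Lambda> N \<and> fin_gen \<Lambda> N"
  by (simp add: fg_right_module_def rmodule_def)

lemma is_linear_smult_right:
  assumes "rmodule \<Lambda> N" "n \<in> carrier N"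
  shows "is_linear \<Lambda> (right_regular \<Lambda>) N (\<lambda>c. c \<odot>\<^bsub>N\<^esub> n)"
proof -
  interpret N: rmodule \<Lambda> N by fact
  show ?thesis by (rule is_linearI) (use assms(2) in \<open>auto simp: N.smult_l_distr N.smult_assoc\<close>)
qed

text \<open>A map out of the ring is determined by the image of 1, so lifting one composite P ->
  ring -> P -> L only takes a preimage of one element. The lifts of the composites add up to a lift
  for the identity.\<close>

lemma projective_of_in_add:
  assumes "rmodule \<Lambda> P" "fin_gen \<Lambda> P" "in_add \<Lambda> (right_regular \<Lambda>) P"
  shows "projective \<Lambda> P"
  unfolding projective_def
proof (intro conjI allI ballI impI)
  interpret P: rmodule \<Lambda> P by fact
  show "fg_right_module \<Lambda> P" using assms(1,2) by (simp add: fg_right_module_iff)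
  fix N L :: "('a, 'a coset_type) module" and g f
  assume "g \<in> linear_maps \<Lambda> N L" "f \<in> linear_maps \<Lambda> P L"
    and NL: "fg_right_module \<Lambda> N \<and> fg_right_module \<Lambda> L \<and> g ` carrier N = carrier L"
  then have g: "is_linear \<Lambda> N L g" and f: "is_linear \<Lambda> P L f" by (simp_all add: linear_maps_linear)
  have N: "rmodule \<Lambda> N" and L: "rmodule \<Lambda> L" and surj: "g ` carrier N = carrier L"
    using NL by (auto simp: fg_right_module_iff)
  interpret N: rmodule \<Lambda> N by (rule N)
  interpret L: rmodule \<Lambda> L by (rule L)
  have "\<exists>k. is_linear \<Lambda> P N k \<and> (\<forall>x \<in> carrier P. g (k x) = f (h x))"
    if "factors_through \<Lambda> (right_regular \<Lambda>) P P h" for h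
    using that
  proof (induction rule: factors_through.induct)
    case (through_zero h)
    then show ?case
      using P.linear_zero_map[OF N] N.linear_zero[OF L g] P.linear_zero[OF L f]
      by (intro exI[of _ "\<lambda>_. \<zero>\<^bsub>N\<^esub>"]) simp
  next
    case (through_step h f' g' h')
    then obtain k where k: "is_linear \<Lambda> P N k" "\<And>x. x \<in> carrier P \<Longrightarrow> g (k x) = f (h x)" by blast
    have one: "\<one>\<^bsub>\<Lambda>\<^esub> \<in> carrier (right_regular \<Lambda>)" by simp
    note g1 = is_linearD(1)[OF through_step(3) one]
    have "f (g' \<one>\<^bsub>\<Lambda>\<^esub>) \<in> g ` carrier N" unfolding surj by (rule is_linearD(1)[OF f g1])
    then obtain n where n: "n \<in> carrier N" "g n = f (g' \<one>\<^bsub>\<Lambda>\<^esub>)" by auto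
    have lin: "is_linear \<Lambda> P N (\<lambda>x. f' x \<odot>\<^bsub>N\<^esub> n)"
      by (rule is_linear_comp[OF through_step(2) is_linear_smult_right[OF N n(1)]])
    have eq: "g (k x \<oplus>\<^bsub>N\<^esub> f' x \<odot>\<^bsub>N\<^esub> n) = f (h' x)" if x: "x \<in> carrier P" for x
    proof -
      have c: "f' x \<in> carrier \<Lambda>" using is_linearD(1)[OF through_step(2) x] by simp
      have "g' (f' x \<odot>\<^bsub>right_regular \<Lambda>\<^esub> \<one>\<^bsub>\<Lambda>\<^esub>) = f' x \<odot>\<^bsub>P\<^esub> g' \<one>\<^bsub>\<Lambda>\<^esub>"
        by (rule is_linearD(3)[OF through_step(3) c one])
      then have g'f': "g' (f' x) = f' x \<odot>\<^bsub>P\<^esub> g' \<one>\<^bsub>\<Lambda>\<^esub>" using c by simp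
      have "g (k x \<oplus>\<^bsub>N\<^esub> f' x \<odot>\<^bsub>N\<^esub> n) = f (h x) \<oplus>\<^bsub>L\<^esub> f' x \<odot>\<^bsub>L\<^esub> f (g' \<one>\<^bsub>\<Lambda>\<^esub>)"
        using n c x k by (simp add: is_linearD[OF g] is_linearD(1)[OF k(1)])
      also have "f' x \<odot>\<^bsub>L\<^esub> f (g' \<one>\<^bsub>\<Lambda>\<^esub>) = f (g' (f' x))" unfolding g'f'
        by (rule is_linearD(3)[OF f c g1, symmetric])
      also have "f (h x) \<oplus>\<^bsub>L\<^esub> f (g' (f' x)) = f (h' x)"
      proof -
        have "h' x = h x \<oplus>\<^bsub>P\<^esub> g' (f' x)" using through_step(4) x by blast
        moreover have "h x \<in> carrier P" by (rule through_closed[OF assms(1,1) through_step(1) x])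
        moreover have "g' (f' x) \<in> carrier P" using is_linearD(1)[OF through_step(3), of "f' x"] c by simp
        ultimately show ?thesis by (simp add: is_linearD(2)[OF f])
      qed
      finally show ?thesis .
    qed
    have "is_linear \<Lambda> P N (\<lambda>x. k x \<oplus>\<^bsub>N\<^esub> f' x \<odot>\<^bsub>N\<^esub> n)"
      by (rule is_linearI)
        (auto simp: is_linearD[OF k(1)] is_linearD[OF lin] is_linearD(1)[OF lin] N.M.a_ac N.smult_r_distr
          simp del: N.smult_closed)
    then show ?case using eq by blast
  qed
  from this[OF assms(3)] obtain k where k: "is_linear \<Lambda> P N k" "\<And>x. x \<in> carrier P \<Longrightarrow> g (k x) = f x" by blast
  show "\<exists>h \<in> linear_maps \<Lambda> P N. \<forall>x \<in> carrier P. g (h x) = f x"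
    using P.restrict_linear[OF k(1)] k(2) by (intro bexI[of _ "\<lambda>x\<in>carrier P. k x"]) auto
qed

lemma fin_gen_right_regular:
  assumes "ring \<Lambda>"
  shows "fin_gen \<Lambda> (right_regular \<Lambda>)"
proof -
  interpret L: rmodule \<Lambda> "right_regular \<Lambda>" by (rule rmodule_right_regular[OF assms])
  have "x \<in> lspan \<Lambda> (right_regular \<Lambda>) {\<one>\<^bsub>\<Lambda>\<^esub>}" if "x \<in> carrier \<Lambda>" for x
    using lspan_smult[OF that lspan_base[of "\<one>\<^bsub>\<Lambda>\<^esub>" "{\<one>\<^bsub>\<Lambda>\<^esub>}" \<Lambda> "right_regular \<Lambda>"]] that by simp
  then show ?thesis unfolding L.fin_gen_iff_lspan by (intro exI[of _ "{\<one>\<^bsub>\<Lambda>\<^esub>}"]) auto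
qed

lemma free_cover:
  assumes "rmodule \<Lambda> K" "fin_gen \<Lambda> K"
  shows "\<exists>b p. is_linear \<Lambda> (free_module \<Lambda> b) K p \<and> p ` carrier (free_module \<Lambda> b) = carrier K"
proof -
  interpret K: rmodule \<Lambda> K by fact
  have L: "rmodule \<Lambda> (right_regular \<Lambda>)" by (rule rmodule_right_regular[OF K.R.ring_axioms])
  obtain A where A: "finite A" "A \<subseteq> carrier K" "carrier K \<subseteq> lspan \<Lambda> K A"
    using assms(2) K.fin_gen_iff_lspan by blast
  obtain a and b :: nat where ab: "A = a ` {..<b}"
    using A(1) by (auto simp: finite_conv_nat_seg_image lessThan_def)
  have ac: "a i \<in> carrier K" if "i < b" for i using that A(2) ab by auto
  have F: "rmodule \<Lambda> (free_module \<Lambda> b)" by (rule rmodule_pow[OF L])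
  let ?p = "\<lambda>t. psum K (\<lambda>j. t j \<odot>\<^bsub>K\<^esub> a j) b"
  have p: "is_linear \<Lambda> (free_module \<Lambda> b) K ?p"
  proof (rule psum_linear[OF F assms(1)])
    fix j assume j: "j < b"
    show "is_linear \<Lambda> (free_module \<Lambda> b) K (\<lambda>t. t j \<odot>\<^bsub>K\<^esub> a j)"
      by (rule is_linear_comp[OF pow_proj_linear[OF j] is_linear_smult_right[OF assms(1) ac[OF j]]])
  qed
  note S = rmodule.linear_image_sub[OF F assms(1) p rmodule.sub_carrier[OF F]]
  have "a i = ?p (unit_vec \<Lambda> b i)" if i: "i < b" for i
  proof -
    have "?p (unit_vec \<Lambda> b i) = psum K (\<lambda>j. if i = j then a j else \<zero>\<^bsub>K\<^esub>) b"
      by (rule psum_cong) (use ac in \<open>auto simp: unit_vec_def\<close>)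
    then show ?thesis using K.psum_single[of a i b] ac[OF i] i by simp
  qed
  then have "A \<subseteq> ?p ` carrier (free_module \<Lambda> b)"
    using ab unit_vec_closed[OF K.R.ring_axioms, of b] by (auto simp del: pow_module_simps)
  from K.lspan_subset[OF S this] have "?p ` carrier (free_module \<Lambda> b) = carrier K"
    using A(3) is_subD(1)[OF S] by blast
  with p show ?thesis by blast
qed

text \<open>The free module of rank \<open>b\<close>, realised on \<open>coset_type\<close> by singletons.\<close>
definition free_coset :: "('a, 'c) ring_scheme \<Rightarrow> nat \<Rightarrow> ('a, 'a coset_type) module" where
  "free_coset \<Lambda> b = img_module (free_module \<Lambda> b) (\<lambda>t. {t})"

section \<open>Free resolutions on the coset type and bounds on global dimension\<close>

context ring
begin

lemma rmodule_reg: "rmodule R (right_regular R)" by (rule rmodule_right_regular) (rule ring_axioms)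

lemma rmodule_free: "rmodule R (free_module R b)" by (rule rmodule_pow[OF rmodule_reg])

lemma free_coset:
  "rmodule R (free_coset R b)" "is_linear R (free_module R b) (free_coset R b) (\<lambda>t. {t})"
  "is_linear R (free_coset R b) (free_module R b) the_elem"
  "carrier (free_coset R b) = (\<lambda>t. {t}) ` carrier (free_module R b)"
proof -
  have inj: "inj_on (\<lambda>t. {t}) (carrier (free_module R b))" by (simp add: inj_on_def)
  note I = img_module_inj[OF rmodule_free inj]
  show "rmodule R (free_coset R b)" "is_linear R (free_module R b) (free_coset R b) (\<lambda>t. {t})"
    unfolding free_coset_def by (rule I)+
  show car: "carrier (free_coset R b) = (\<lambda>t. {t}) ` carrier (free_module R b)"
    by (simp add: free_coset_def del: pow_module_simps)
  have inv: "inv_into (carrier (free_module R b)) (\<lambda>t. {t}) u = the_elem u"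
    if "u \<in> carrier (free_coset R b)" for u
  proof -
    from that car obtain t where t: "t \<in> carrier (free_module R b)" "u = {t}" by blast
    show ?thesis unfolding t(2) inv_into_f_f[OF inj t(1)] by simp
  qed
  interpret C: rmodule R "free_coset R b" unfolding free_coset_def by (rule I)
  note J = is_linearD[OF I(3)[folded free_coset_def]]
  show "is_linear R (free_coset R b) (free_module R b) the_elem"
  proof
    fix u v assume uv: "u \<in> carrier (free_coset R b)" "v \<in> carrier (free_coset R b)"
    show "the_elem u \<in> carrier (free_module R b)" using J(1)[OF uv(1)] unfolding inv[OF uv(1)] .
    show "the_elem (u \<oplus>\<^bsub>free_coset R b\<^esub> v) = the_elem u \<oplus>\<^bsub>free_module R b\<^esub> the_elem v"
      using J(2)[OF uv] unfolding inv[OF uv(1)] inv[OF uv(2)] inv[OF C.M.a_closed[OF uv]] .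
  next
    fix c u assume cu: "c \<in> carrier R" "u \<in> carrier (free_coset R b)"
    show "the_elem (c \<odot>\<^bsub>free_coset R b\<^esub> u) = c \<odot>\<^bsub>free_module R b\<^esub> the_elem u"
      using J(3)[OF cu] unfolding inv[OF cu(2)] inv[OF C.smult_closed[OF cu]] .
  qed
qed

lemma free_coset_in_add: "in_add R (right_regular R) (free_coset R b)"
  by (rule in_add_retract[OF free_coset(1) rmodule_free in_add_pow[OF rmodule_reg] free_coset(3,2)])
    (auto simp: free_coset(4) simp del: pow_module_simps)

lemma free_coset_fin_gen: "fin_gen R (free_coset R b)"
  by (rule in_add_fin_gen[OF rmodule_reg free_coset(1) free_coset_in_add fin_gen_right_regular]) (rule ring_axioms)

lemma free_coset_projective: "projective R (free_coset R b)"
  by (rule projective_of_in_add[OF free_coset(1) free_coset_fin_gen free_coset_in_add])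

lemma free_coset_0: "carrier (free_coset R 0) = {\<zero>\<^bsub>free_coset R 0\<^esub>}"
  by (simp add: free_coset(4)) (simp add: free_coset_def img_module_def fun_eq_iff)

lemma free_coset_cover:
  assumes "rmodule R K" "fin_gen R K"
  shows "\<exists>b p. is_linear R (free_coset R b) K p \<and> p ` carrier (free_coset R b) = carrier K"
proof -
  obtain b p where p: "is_linear R (free_module R b) K p" "p ` carrier (free_module R b) = carrier K"
    using free_cover[OF assms] by blast
  have "(\<lambda>u. p (the_elem u)) ` carrier (free_coset R b) = carrier K"
    unfolding free_coset(4) image_image using p(2) by simp
  then show ?thesis using is_linear_comp[OF free_coset(3) p(1)] by blast
qed

text \<open>The test modules in \<open>projective\<close> live on \<open>coset_type\<close>. So do
  \<open>free_coset R b\<close> and \<open>P\<close>, hence the identity of \<open>P\<close> lifts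
  along a free cover.\<close>

lemma in_add_of_projective:
  fixes P :: "('a, 'a coset_type) module"
  assumes "projective R P"
  shows "in_add R (right_regular R) P"
proof -
  have P: "rmodule R P" "fin_gen R P" using assms by (auto simp: projective_def fg_right_module_iff)
  interpret P: rmodule R P by (rule P(1))
  obtain b p where p: "is_linear R (free_coset R b) P p" "p ` carrier (free_coset R b) = carrier P"
    using free_coset_cover[OF P] by blast
  let ?p = "\<lambda>x\<in>carrier (free_coset R b). p x"
  have p': "?p \<in> linear_maps R (free_coset R b) P" by (rule rmodule.restrict_linear[OF free_coset(1) p(1)])
  have id: "(\<lambda>x\<in>carrier P. x) \<in> linear_maps R P P" by (rule P.restrict_linear[OF is_linear_id])
  have fg: "fg_right_module R (free_coset R b)" "fg_right_module R P"
    using P free_coset(1) free_coset_fin_gen by (simp_all add: fg_right_module_iff)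
  have "?p ` carrier (free_coset R b) = carrier P" using p(2) by simp
  then have "\<exists>h \<in> linear_maps R P (free_coset R b). \<forall>x \<in> carrier P. ?p (h x) = (\<lambda>x\<in>carrier P. x) x"
    using assms[unfolded projective_def, THEN conjunct2, rule_format, OF p' id] fg by blast
  then obtain h where h: "h \<in> linear_maps R P (free_coset R b)" "\<And>x. x \<in> carrier P \<Longrightarrow> ?p (h x) = x" by auto
  show ?thesis
  proof (rule in_add_retract[OF P(1) free_coset(1) free_coset_in_add linear_maps_linear[OF h(1)] p(1)])
    fix x assume x: "x \<in> carrier P"
    show "p (h x) = x" using h(2)[OF x] linear_mapsD(1)[OF h(1) x] by simp
  qed
qed

text \<open>Dependent choice on triples of a syzygy, a rank and a free cover. Noetherianity keeps
  the next kernel finitely generated, and \<open>coset_type\<close> keeps all syzygies on one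
  type.\<close>

lemma free_resolution:
  fixes K0 :: "('a, 'a coset_type) module"
  assumes "noeth R (right_regular R)" "rmodule R K0" "fin_gen R K0"
  obtains K b p where "K 0 = K0" "\<And>i. rmodule R (K i)" "\<And>i. fin_gen R (K i)"
    "\<And>i. is_linear R (free_coset R (b i)) (K i) (p i)" "\<And>i. p i ` carrier (free_coset R (b i)) = carrier (K i)"
    "\<And>i. K (Suc i) = (free_coset R (b i))\<lparr>carrier := ker_of (free_coset R (b i)) (K i) (p i)\<rparr>"
proof -
  let ?P = "\<lambda>(n::nat) (K, b, p). rmodule R K \<and> fin_gen R K \<and> is_linear R (free_coset R b) K p \<and>
    p ` carrier (free_coset R b) = carrier K \<and> (n = 0 \<longrightarrow> K = K0)"
  let ?Q = "\<lambda>(n::nat) (K, b, p) (K', b', p'). K' = (free_coset R b)\<lparr>carrier := ker_of (free_coset R b) K p\<rparr>"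
  have "\<exists>f. \<forall>n. ?P n (f n) \<and> ?Q n (f n) (f (Suc n))"
  proof (rule dependent_nat_choice)
    show "\<exists>x. ?P 0 x" using assms(2,3) free_coset_cover[OF assms(2,3)] by auto
    fix x n assume "?P n x"
    then obtain K b p where x: "x = (K, b, p)" "rmodule R K" "is_linear R (free_coset R b) K p"
      by (cases x) auto
    let ?K = "(free_coset R b)\<lparr>carrier := ker_of (free_coset R b) K p\<rparr>"
    have S: "is_sub R (free_coset R b) (ker_of (free_coset R b) K p)"
      by (rule rmodule.ker_sub[OF free_coset(1) x(2,3)])
    have K: "rmodule R ?K" by (rule rmodule.rmodule_sub[OF free_coset(1) S])
    have fg: "fin_gen R ?K"
      by (rule noeth_imp_fin_gen_sub[OF free_coset(1) noeth_of_fin_gen[OF assms(1) free_coset(1) free_coset_fin_gen] S])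
    obtain b' p' where "is_linear R (free_coset R b') ?K p'" "p' ` carrier (free_coset R b') = carrier ?K"
      using free_coset_cover[OF K fg] by blast
    then show "\<exists>y. ?P (Suc n) y \<and> ?Q n x y" using K fg x(1) by (intro exI[of _ "(?K, b', p')"]) simp
  qed
  then obtain f where "\<forall>n. ?P n (f n) \<and> ?Q n (f n) (f (Suc n))" by (elim exE)
  then have f: "?P n (f n)" "?Q n (f n) (f (Suc n))" for n by simp_all
  show ?thesis
  proof (rule that[of "\<lambda>i. fst (f i)" "\<lambda>i. fst (snd (f i))" "\<lambda>i. snd (snd (f i))"])
    show "fst (f 0) = K0" using f(1)[of 0] by (simp add: split_beta)
    fix i
    show "rmodule R (fst (f i))" "fin_gen R (fst (f i))"
      "is_linear R (free_coset R (fst (snd (f i)))) (fst (f i)) (snd (snd (f i)))"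
      "snd (snd (f i)) ` carrier (free_coset R (fst (snd (f i)))) = carrier (fst (f i))"
      using f(1)[of i] by (simp_all add: split_beta)
    show "fst (f (Suc i)) = (free_coset R (fst (snd (f i))))
        \<lparr>carrier := ker_of (free_coset R (fst (snd (f i)))) (fst (f i)) (snd (snd (f i)))\<rparr>"
      using f(2)[of i] by (simp add: split_beta)
  qed
qed

text \<open>The free resolution is broken off at a syzygy in the add of the ring: being projective,
  \<open>K (Suc n)\<close> itself can serve as the last term, with its inclusion as
  differential.\<close>

lemma proj_dim_le:
  fixes K :: "nat \<Rightarrow> ('a, 'a coset_type) module"
  assumes "\<And>i. rmodule R (K i)" "\<And>i. fin_gen R (K i)"
    "\<And>i. is_linear R (free_coset R (b i)) (K i) (p i)" "\<And>i. p i ` carrier (free_coset R (b i)) = carrier (K i)"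
    "\<And>i. K (Suc i) = (free_coset R (b i))\<lparr>carrier := ker_of (free_coset R (b i)) (K i) (p i)\<rparr>"
    "in_add R (right_regular R) (K (Suc n))"
  shows "proj_dim R (K 0) \<le> enat (Suc n)"
proof -
  let ?F = "free_coset R"
  have zero: "\<zero>\<^bsub>K (Suc i)\<^esub> = \<zero>\<^bsub>?F (b i)\<^esub>" for i by (simp add: assms(5))
  have carK: "carrier (K (Suc i)) = ker_of (?F (b i)) (K i) (p i)" for i by (simp add: assms(5))
  have sub: "is_sub R (?F (b i)) (carrier (K (Suc i)))" for i
    unfolding carK by (rule rmodule.ker_sub[OF free_coset(1) assms(1,3)])
  have incl: "is_linear R (K (Suc i)) (?F (b i)) (\<lambda>x. x)" for i
    using is_linear_sub_incl[OF sub[of i]] by (simp add: assms(5))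
  have pF: "is_linear R (?F (b (Suc i))) (?F (b i)) (p (Suc i))" for i
    using is_linear_comp[OF assms(3) incl] by simp
  \<comment> \<open>Free terms up to degree n, the projective syzygy in degree n + 1, and then the
    free module of rank 0 as zero module.\<close>
  define P where "P i = (if i \<le> n then ?F (b i) else if i = Suc n then K (Suc n) else ?F 0)" for i
  define \<delta> where "\<delta> i = (if i < n then (\<lambda>x\<in>carrier (?F (b (Suc i))). p (Suc i) x)
    else if i = n then (\<lambda>x\<in>carrier (K (Suc n)). x) else (\<lambda>x\<in>carrier (?F 0). \<zero>\<^bsub>P i\<^esub>))" for i
  have rP: "rmodule R (P i)" for i using assms(1) free_coset(1) by (simp add: P_def)
  have proj: "projective R (P i)" for i
    using free_coset_projective projective_of_in_add[OF assms(1,2,6)] by (simp add: P_def)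
  have \<delta>: "\<delta> i \<in> linear_maps R (P (Suc i)) (P i)" for i
  proof -
    consider "i < n" | "i = n" | "i > n" by linarith
    then show ?thesis
    proof cases
      case 1
      then show ?thesis using rmodule.restrict_linear[OF free_coset(1) pF] by (simp add: \<delta>_def P_def)
    next
      case 2
      then show ?thesis using rmodule.restrict_linear[OF assms(1) incl] by (simp add: \<delta>_def P_def)
    next
      case 3
      have "(\<lambda>x\<in>carrier (?F 0). \<zero>\<^bsub>P i\<^esub>) \<in> linear_maps R (?F 0) (P i)"
        by (rule rmodule.restrict_linear[OF free_coset(1) rmodule.linear_zero_map[OF free_coset(1) rP]])
      then show ?thesis using 3 by (simp add: \<delta>_def P_def)
    qed
  qed
  let ?\<epsilon> = "\<lambda>x\<in>carrier (?F (b 0)). p 0 x"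
  have eps: "?\<epsilon> \<in> linear_maps R (P 0) (K 0)" "?\<epsilon> ` carrier (P 0) = carrier (K 0)"
    using rmodule.restrict_linear[OF free_coset(1) assms(3)[of 0]] assms(4)[of 0] by (simp_all add: P_def)
  have im: "\<delta> i ` carrier (P (Suc i)) = carrier (K (Suc i))" if "i \<le> n" for i
    using that assms(4)[of "Suc i"] by (cases "i = n") (simp_all add: \<delta>_def P_def)
  have im0: "\<delta> i ` carrier (P (Suc i)) = {\<zero>\<^bsub>P i\<^esub>}" if "i > n" for i
    using that free_coset_0 by (simp add: \<delta>_def P_def)
  have k0: "carrier (K (Suc 0)) = ker_of (P 0) (K 0) ?\<epsilon>"
    unfolding carK by (auto simp: ker_of_def P_def)
  have kS: "\<delta> (Suc i) ` carrier (P (Suc (Suc i))) = ker_of (P (Suc i)) (P i) (\<delta> i)" for i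
  proof -
    consider "i < n" | "i = n" | "i > n" by linarith
    then show ?thesis
    proof cases
      case 1
      have "carrier (K (Suc (Suc i))) = ker_of (P (Suc i)) (P i) (\<delta> i)"
        unfolding carK using 1 by (auto simp: ker_of_def P_def \<delta>_def zero)
      then show ?thesis using im[of "Suc i"] 1 by simp
    next
      case 2
      have "\<zero>\<^bsub>K (Suc n)\<^esub> \<in> carrier (K (Suc n))" using rmodule.sub_carrier[OF assms(1)] is_subD(2) by metis
      then have "ker_of (P (Suc i)) (P i) (\<delta> i) = {\<zero>\<^bsub>P (Suc i)\<^esub>}"
        using 2 by (auto simp: ker_of_def P_def \<delta>_def zero)
      then show ?thesis using im0[of "Suc i"] 2 by simp
    next
      case 3
      have "ker_of (P (Suc i)) (P i) (\<delta> i) = carrier (?F 0)" using 3 by (auto simp: ker_of_def P_def \<delta>_def)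
      moreover have "\<delta> (Suc i) ` carrier (P (Suc (Suc i))) = {\<zero>\<^bsub>?F 0\<^esub>}"
        using im0[of "Suc i"] 3 by (simp add: P_def)
      ultimately show ?thesis using free_coset_0 by simp
    qed
  qed
  have "\<delta> 0 ` carrier (P 1) = ker_of (P 0) (K 0) ?\<epsilon>" using im[of 0] k0 by simp
  then have "projective_resolution R (K 0) P \<delta> ?\<epsilon>"
    unfolding projective_resolution_def using proj eps \<delta> kS by blast
  moreover have "\<forall>i > Suc n. is_zero (P i)" using free_coset_0 by (simp add: P_def is_zero_def)
  ultimately show ?thesis unfolding proj_dim_def by (intro Inf_lower) blast
qed

text \<open>Reduces the bound to exact sequences of maps between free modules of tuples, where
  augmentation and coding as singletons have disappeared. The kernel of \<open>\<phi> n\<close> is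
  the syzygy \<open>K (Suc (Suc n))\<close> up to this coding, whence the bound n + 2.\<close>

lemma gl_dim_le:
  assumes "noeth R (right_regular R)"
    and "\<And>b \<phi>. \<lbrakk>\<And>i. is_linear R (free_module R (b (Suc i))) (free_module R (b i)) (\<phi> i);
      \<And>i. \<phi> (Suc i) ` carrier (free_module R (b (Suc (Suc i))))
        = ker_of (free_module R (b (Suc i))) (free_module R (b i)) (\<phi> i)\<rbrakk> \<Longrightarrow>
      in_add R (right_regular R)
        ((free_module R (b (Suc n)))\<lparr>carrier := ker_of (free_module R (b (Suc n))) (free_module R (b n)) (\<phi> n)\<rparr>)"
  shows "gl_dim R \<le> enat (Suc (Suc n))"
  unfolding gl_dim_def
proof (rule Sup_least)
  fix e assume "e \<in> {proj_dim R N | N :: ('a, 'a coset_type) module. fg_right_module R N}"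
  then obtain K0 :: "('a, 'a coset_type) module" where K0: "e = proj_dim R K0" "rmodule R K0" "fin_gen R K0"
    by (auto simp: fg_right_module_iff)
  obtain K b p where K: "K 0 = K0" "\<And>i. rmodule R (K i)" "\<And>i. fin_gen R (K i)"
    "\<And>i. is_linear R (free_coset R (b i)) (K i) (p i)" "\<And>i. p i ` carrier (free_coset R (b i)) = carrier (K i)"
    "\<And>i. K (Suc i) = (free_coset R (b i))\<lparr>carrier := ker_of (free_coset R (b i)) (K i) (p i)\<rparr>"
    using free_resolution[OF assms(1) K0(2,3)] by metis
  let ?F = "free_coset R" and ?G = "free_module R"
  \<comment> \<open>\<open>p (Suc i)\<close> maps onto the kernel of \<open>p i\<close>, which sits
    inside the free module of rank \<open>b i\<close>; so it yields a map of free modules, read here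
    without the singletons.\<close>
  define \<phi> where "\<phi> i t = the_elem (p (Suc i) {t})" for i t
  have zero: "\<zero>\<^bsub>K (Suc i)\<^esub> = \<zero>\<^bsub>?F (b i)\<^esub>" for i by (simp add: K(6))
  have carK: "carrier (K (Suc i)) = ker_of (?F (b i)) (K i) (p i)" for i by (simp add: K(6))
  have sub: "is_sub R (?F (b i)) (carrier (K (Suc i)))" for i
    unfolding carK by (rule rmodule.ker_sub[OF free_coset(1) K(2,4)])
  have incl: "is_linear R (K (Suc i)) (?F (b i)) (\<lambda>x. x)" for i
    using is_linear_sub_incl[OF sub[of i]] by (simp add: K(6))
  have pF: "is_linear R (?F (b (Suc i))) (?F (b i)) (p (Suc i))" for i
    using is_linear_comp[OF K(4) incl] by simp
  have \<phi>_def': "\<phi> i = (\<lambda>t. the_elem (p (Suc i) {t}))" for i by (simp add: fun_eq_iff \<phi>_def)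
  have \<phi>: "is_linear R (?G (b (Suc i))) (?G (b i)) (\<phi> i)" for i
    unfolding \<phi>_def' by (rule is_linear_comp[OF is_linear_comp[OF free_coset(2) pF] free_coset(3)])
  have z: "\<zero>\<^bsub>?F c\<^esub> = {\<zero>\<^bsub>?G c\<^esub>}" for c by (simp add: free_coset_def img_module_def)
  have ker: "t \<in> ker_of (?G (b (Suc i))) (?G (b i)) (\<phi> i) \<longleftrightarrow> {t} \<in> carrier (K (Suc (Suc i)))" for i t
  proof (cases "t \<in> carrier (?G (b (Suc i)))")
    case True
    then have t: "{t} \<in> carrier (?F (b (Suc i)))" by (simp add: free_coset(4) del: pow_module_simps)
    obtain s where s: "s \<in> carrier (?G (b i))" "p (Suc i) {t} = {s}"
      using is_linearD(1)[OF pF t] unfolding free_coset(4) by blast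
    have "t \<in> ker_of (?G (b (Suc i))) (?G (b i)) (\<phi> i) \<longleftrightarrow> s = \<zero>\<^bsub>?G (b i)\<^esub>"
      unfolding ker_of_def \<phi>_def using True s(2) by simp
    also have "\<dots> \<longleftrightarrow> {t} \<in> carrier (K (Suc (Suc i)))"
      unfolding carK ker_of_def zero z using t s(2) by simp
    finally show ?thesis .
  next
    case False
    then have "{t} \<notin> carrier (?F (b (Suc i)))" unfolding free_coset(4) by blast
    then show ?thesis using False unfolding carK ker_of_def by blast
  qed
  have exact: "\<phi> (Suc i) ` carrier (?G (b (Suc (Suc i)))) = ker_of (?G (b (Suc i))) (?G (b i)) (\<phi> i)" for i
  proof (intro Set.set_eqI iffI)
    fix t assume "t \<in> \<phi> (Suc i) ` carrier (?G (b (Suc (Suc i))))"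
    then obtain s where s: "s \<in> carrier (?G (b (Suc (Suc i))))" "t = the_elem (p (Suc (Suc i)) {s})"
      unfolding \<phi>_def by blast
    then have ps: "p (Suc (Suc i)) {s} \<in> carrier (K (Suc (Suc i)))"
      using is_linearD(1)[OF K(4)] free_coset(4) by blast
    then obtain t' where "p (Suc (Suc i)) {s} = {t'}" using is_subD(5)[OF sub ps] unfolding free_coset(4)
      by blast
    then show "t \<in> ker_of (?G (b (Suc i))) (?G (b i)) (\<phi> i)" unfolding ker using ps s(2) by simp
  next
    fix t assume "t \<in> ker_of (?G (b (Suc i))) (?G (b i)) (\<phi> i)"
    then have "{t} \<in> p (Suc (Suc i)) ` carrier (?F (b (Suc (Suc i))))" unfolding ker K(5) .
    then obtain s where "s \<in> carrier (?G (b (Suc (Suc i))))" "{t} = p (Suc (Suc i)) {s}"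
      unfolding free_coset(4) by blast
    then show "t \<in> \<phi> (Suc i) ` carrier (?G (b (Suc (Suc i))))"
      unfolding \<phi>_def by (intro image_eqI[of _ _ s]) (metis the_elem_eq)
  qed
  let ?W = "ker_of (?G (b (Suc n))) (?G (b n)) (\<phi> n)"
  have W: "is_sub R (?G (b (Suc n))) ?W" by (rule rmodule.ker_sub[OF rmodule_free rmodule_free \<phi>])
  have WK: "carrier (K (Suc (Suc n))) = (\<lambda>t. {t}) ` ?W"
  proof (intro Set.set_eqI iffI)
    fix u assume u: "u \<in> carrier (K (Suc (Suc n)))"
    then obtain t where "u = {t}" using is_subD(5)[OF sub u] unfolding free_coset(4) by blast
    then show "u \<in> (\<lambda>t. {t}) ` ?W" using u ker by blast
  next
    fix u assume "u \<in> (\<lambda>t. {t}) ` ?W"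
    then show "u \<in> carrier (K (Suc (Suc n)))" using ker by blast
  qed
  have l1: "is_linear R (K (Suc (Suc n))) ((?G (b (Suc n)))\<lparr>carrier := ?W\<rparr>) the_elem"
    by (rule is_linear_sub_cod)
      (use is_linear_comp[OF incl free_coset(3)] in \<open>auto simp: WK\<close>)
  have l2: "is_linear R ((?G (b (Suc n)))\<lparr>carrier := ?W\<rparr>) (K (Suc (Suc n))) (\<lambda>t. {t})"
    unfolding K(6)[of "Suc n"]
    by (rule is_linear_sub_cod[OF is_linear_sub_dom[OF free_coset(2) is_subD(1)[OF W]]])
      (use WK carK in simp)
  have "in_add R (right_regular R) (K (Suc (Suc n)))"
    by (rule in_add_retract[OF K(2) rmodule.rmodule_sub[OF rmodule_free W] assms(2)[of b \<phi>, OF \<phi> exact] l1 l2])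
      (auto simp: WK)
  from proj_dim_le[where K = K and b = b and p = p, OF K(2-6) this] show "e \<le> enat (Suc (Suc n))"
    by (simp add: K(1) K0(1))
qed

end

section \<open>The corner functor\<close>

text \<open>A linear form \<open>q\<close> on \<open>M\<close> with \<open>q m\<^sub>0 = 1\<close> splits off a copy of \<open>R\<close> from \<open>M\<close>, with projection
  \<open>idem\<close>. For a right module \<open>P\<close> over \<open>E = End(M)\<close>, \<open>corner P\<close> is \<open>P e\<close>, a module over \<open>e E e = R\<close>.\<close>
locale corner = endo R M for R :: "('a, 'c) ring_scheme" (structure)
  and M :: "('a, 'm) module" (structure) +
  fixes q and m0
  assumes q: "is_linear R M (right_regular R) q" and m0: "m0 \<in> carrier M" and qm0: "q m0 = \<one>"
begin

definition scalar :: "'a \<Rightarrow> 'm \<Rightarrow> 'm" where "scalar r = (\<lambda>m\<in>carrier M. r \<odot>\<^bsub>M\<^esub> m)"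

definition idem :: "'m \<Rightarrow> 'm" where "idem = (\<lambda>m\<in>carrier M. q m \<odot>\<^bsub>M\<^esub> m0)"

definition corner :: "('m \<Rightarrow> 'm, 'p) module \<Rightarrow> ('a, 'p) module" where
  "corner P = \<lparr>carrier = {y \<in> carrier P. idem \<odot>\<^bsub>P\<^esub> y = y}, monoid.mult = undefined, one = undefined,
     ring.zero = \<zero>\<^bsub>P\<^esub>, ring.add = ring.add P, smult = (\<lambda>r y. scalar r \<odot>\<^bsub>P\<^esub> y)\<rparr>"

lemma corner_simps [simp]:
  "carrier (corner P) = {y \<in> carrier P. idem \<odot>\<^bsub>P\<^esub> y = y}" "\<zero>\<^bsub>corner P\<^esub> = \<zero>\<^bsub>P\<^esub>"
  "x \<oplus>\<^bsub>corner P\<^esub> y = x \<oplus>\<^bsub>P\<^esub> y" "r \<odot>\<^bsub>corner P\<^esub> y = scalar r \<odot>\<^bsub>P\<^esub> y"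
  by (simp_all add: corner_def)

lemma q_simps:
  "m \<in> carrier M \<Longrightarrow> q m \<in> carrier R"
  "m \<in> carrier M \<Longrightarrow> m' \<in> carrier M \<Longrightarrow> q (m \<oplus>\<^bsub>M\<^esub> m') = q m \<oplus> q m'"
  "r \<in> carrier R \<Longrightarrow> m \<in> carrier M \<Longrightarrow> q (r \<odot>\<^bsub>M\<^esub> m) = q m \<otimes> r"
  using is_linearD[OF q] by simp_all

lemma scalar_closed: "r \<in> carrier R \<Longrightarrow> scalar r \<in> carrier E"
  unfolding scalar_def using restrict_linear[OF smult_linear] by simp

lemma smult_q_linear: "m \<in> carrier M \<Longrightarrow> is_linear R M M (\<lambda>m'. q m' \<odot>\<^bsub>M\<^esub> m)"
  by (rule is_linearI) (auto simp: q_simps smult_l_distr smult_assoc)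

lemma idem_closed: "idem \<in> carrier E"
  unfolding idem_def using restrict_linear[OF smult_q_linear[OF m0]] by simp

lemma idem_idem: "idem \<otimes>\<^bsub>E\<^esub> idem = idem"
  using m0 by (auto simp: idem_def compose_def fun_eq_iff q_simps qm0)

lemma scalar_central: "r \<in> carrier R \<Longrightarrow> f \<in> carrier E \<Longrightarrow> scalar r \<otimes>\<^bsub>E\<^esub> f = f \<otimes>\<^bsub>E\<^esub> scalar r"
  using linear_mapsD(1,3)[of f R M M] by (auto simp: scalar_def compose_def fun_eq_iff)

lemma scalar_ring_hom:
  "r \<in> carrier R \<Longrightarrow> s \<in> carrier R \<Longrightarrow> scalar (r \<oplus> s) = scalar r \<oplus>\<^bsub>E\<^esub> scalar s"
  "r \<in> carrier R \<Longrightarrow> s \<in> carrier R \<Longrightarrow> scalar (r \<otimes> s) = scalar r \<otimes>\<^bsub>E\<^esub> scalar s"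
  "scalar \<one> = \<one>\<^bsub>E\<^esub>"
  by (auto simp: scalar_def compose_def fun_eq_iff smult_l_distr smult_assoc smult_smult)

text \<open>Scalars are central in \<open>E\<close>, so they preserve the elements fixed by
  \<open>idem\<close>.\<close>

lemma rmodule_corner:
  assumes "rmodule E P"
  shows "rmodule R (corner P)"
proof -
  interpret P: rmodule E P by fact
  have sub: "is_sub R (corner P) (carrier (corner P))"
  proof
    show "\<zero>\<^bsub>corner P\<^esub> \<in> carrier (corner P)" using idem_closed by simp
    show "x \<oplus>\<^bsub>corner P\<^esub> y \<in> carrier (corner P)" if "x \<in> carrier (corner P)" "y \<in> carrier (corner P)" for x y
      using that by (simp add: P.smult_r_distr[OF idem_closed])
    show "r \<odot>\<^bsub>corner P\<^esub> x \<in> carrier (corner P)" if r: "r \<in> carrier R"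
      and x: "x \<in> carrier (corner P)" for r x
    proof -
      have xc: "x \<in> carrier P" and ex: "idem \<odot>\<^bsub>P\<^esub> x = x" using x by auto
      have "idem \<odot>\<^bsub>P\<^esub> (scalar r \<odot>\<^bsub>P\<^esub> x) = (scalar r \<otimes>\<^bsub>E\<^esub> idem) \<odot>\<^bsub>P\<^esub> x"
        by (rule P.smult_assoc[OF scalar_closed[OF r] idem_closed xc, symmetric])
      also have "\<dots> = (idem \<otimes>\<^bsub>E\<^esub> scalar r) \<odot>\<^bsub>P\<^esub> x" unfolding scalar_central[OF r idem_closed] ..
      also have "\<dots> = scalar r \<odot>\<^bsub>P\<^esub> x" unfolding P.smult_assoc[OF idem_closed scalar_closed[OF r] xc] ex ..
      finally show ?thesis using P.smult_closed[OF scalar_closed[OF r] xc] by simp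
    qed
  qed simp
  note D = is_subD[OF sub]
  have "abelian_group (corner P)"
  proof (rule abelian_groupI)
    fix x assume x: "x \<in> carrier (corner P)"
    then have "\<ominus>\<^bsub>P\<^esub> x \<in> carrier (corner P)" using P.smult_r_minus[OF idem_closed, of x] by simp
    moreover have "\<ominus>\<^bsub>P\<^esub> x \<oplus>\<^bsub>corner P\<^esub> x = \<zero>\<^bsub>corner P\<^esub>" using x by (simp add: P.M.l_neg)
    ultimately show "\<exists>y \<in> carrier (corner P). y \<oplus>\<^bsub>corner P\<^esub> x = \<zero>\<^bsub>corner P\<^esub>" by (intro bexI)
  qed (use D(2,3) in \<open>auto simp: P.M.a_ac\<close>)
  then show ?thesis
  proof (intro rmodule.intro right_module.intro right_module_axioms.intro ring_axioms)
    note sc = scalar_closed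
    show "r \<odot>\<^bsub>corner P\<^esub> x \<in> carrier (corner P)" if "r \<in> carrier R" "x \<in> carrier (corner P)" for r x
      using D(4)[OF that] .
    show "(r \<oplus> s) \<odot>\<^bsub>corner P\<^esub> x = r \<odot>\<^bsub>corner P\<^esub> x \<oplus>\<^bsub>corner P\<^esub> s \<odot>\<^bsub>corner P\<^esub> x"
      if "r \<in> carrier R" "s \<in> carrier R" "x \<in> carrier (corner P)" for r s x
      using that P.smult_l_distr[OF sc sc, of r s x] by (simp add: scalar_ring_hom(1) del: End_ring_simps)
    show "r \<odot>\<^bsub>corner P\<^esub> (x \<oplus>\<^bsub>corner P\<^esub> y) = r \<odot>\<^bsub>corner P\<^esub> x \<oplus>\<^bsub>corner P\<^esub> r \<odot>\<^bsub>corner P\<^esub> y"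
      if "r \<in> carrier R" "x \<in> carrier (corner P)" "y \<in> carrier (corner P)" for r x y
      using that P.smult_r_distr[OF sc, of r x y] by simp
    show "(r \<otimes> s) \<odot>\<^bsub>corner P\<^esub> x = s \<odot>\<^bsub>corner P\<^esub> (r \<odot>\<^bsub>corner P\<^esub> x)"
      if "r \<in> carrier R" "s \<in> carrier R" "x \<in> carrier (corner P)" for r s x
      using that P.smult_assoc[OF sc sc, of r s x] by (simp add: scalar_ring_hom(2) del: End_ring_simps)
    show "\<one> \<odot>\<^bsub>corner P\<^esub> x = x" if "x \<in> carrier (corner P)" for x
      using that by (simp add: scalar_ring_hom(3) del: End_ring_simps)
  qed
qed

lemma corner_linear:
  assumes "is_linear E P P' f"
  shows "is_linear R (corner P) (corner P') f"
proof
  note f = is_linearD[OF assms]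
  show "f x \<in> carrier (corner P')" if "x \<in> carrier (corner P)" for x
    using that f(1)[of x] f(3)[OF idem_closed, of x] by simp
  show "f (r \<odot>\<^bsub>corner P\<^esub> x) = r \<odot>\<^bsub>corner P'\<^esub> f x" if "r \<in> carrier R" "x \<in> carrier (corner P)" for r x
    using that f(3)[OF scalar_closed, of r x] by simp
qed (use is_linearD(2)[OF assms] in simp)

lemma corner_factors:
  "factors_through E K P P' h \<Longrightarrow> factors_through R (corner K) (corner P) (corner P') h"
proof (induction rule: factors_through.induct)
  case (through_zero h)
  then show ?case by (intro factors_through.through_zero) simp
next
  case (through_step h f g h')
  show ?case
    by (rule factors_through.through_step[OF through_step.IH corner_linear[OF through_step(2)] corner_linear[OF through_step(3)]])
      (use through_step(4) in simp)
qed

text \<open>An element f of this corner satisfies f m = (q m) (f m0). It is thus determined by f m0,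
  which may be any element of \<open>M\<close>: the corner of \<open>E\<close> is \<open>M\<close>,
  and the corner functor carries add E into add M.\<close>

lemma corner_E_in_add: "in_add R M (corner (right_regular E))"
proof -
  let ?C = "corner (right_regular E)"
  have f: "f \<in> linear_maps R M M" "compose (carrier M) f idem = f" if "f \<in> carrier ?C" for f
    using that by auto
  have fm: "f m = q m \<odot>\<^bsub>M\<^esub> f m0" if "f \<in> carrier ?C" "m \<in> carrier M" for f m
  proof -
    have "f m = compose (carrier M) f idem m" using f(2)[OF that(1)] by simp
    also have "\<dots> = f (q m \<odot>\<^bsub>M\<^esub> m0)" using that(2) by (simp add: compose_def idem_def)
    also have "\<dots> = q m \<odot>\<^bsub>M\<^esub> f m0" by (rule linear_mapsD(3)[OF f(1)[OF that(1)] q_simps(1)[OF that(2)] m0])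
    finally show ?thesis .
  qed
  have l1: "is_linear R ?C M (\<lambda>f. f m0)"
  proof
    show "f m0 \<in> carrier M" if "f \<in> carrier ?C" for f by (rule linear_mapsD(1)[OF f(1)[OF that] m0])
    show "(r \<odot>\<^bsub>?C\<^esub> f) m0 = r \<odot>\<^bsub>M\<^esub> f m0" if "r \<in> carrier R" "f \<in> carrier ?C" for r f
      using linear_mapsD(3)[OF f(1)[OF that(2)] that(1) m0] m0 by (simp add: compose_def scalar_def)
  qed (use m0 in simp)
  have l2: "is_linear R M ?C (\<lambda>m. \<lambda>m'\<in>carrier M. q m' \<odot>\<^bsub>M\<^esub> m)"
  proof
    show "(\<lambda>m'\<in>carrier M. q m' \<odot>\<^bsub>M\<^esub> m) \<in> carrier ?C" if "m \<in> carrier M" for m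
      using restrict_linear[OF smult_q_linear[OF that]] m0
      by (auto simp: compose_def fun_eq_iff idem_def q_simps qm0)
    show "(\<lambda>m'\<in>carrier M. q m' \<odot>\<^bsub>M\<^esub> (m \<oplus>\<^bsub>M\<^esub> n))
        = (\<lambda>m'\<in>carrier M. q m' \<odot>\<^bsub>M\<^esub> m) \<oplus>\<^bsub>?C\<^esub> (\<lambda>m'\<in>carrier M. q m' \<odot>\<^bsub>M\<^esub> n)"
      if "m \<in> carrier M" "n \<in> carrier M" for m n
      using that by (auto simp: fun_eq_iff q_simps smult_r_distr)
    show "(\<lambda>m'\<in>carrier M. q m' \<odot>\<^bsub>M\<^esub> (r \<odot>\<^bsub>M\<^esub> m)) = r \<odot>\<^bsub>?C\<^esub> (\<lambda>m'\<in>carrier M. q m' \<odot>\<^bsub>M\<^esub> m)"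
      if "r \<in> carrier R" "m \<in> carrier M" for r m
      using that by (auto simp: fun_eq_iff compose_def scalar_def q_simps smult_assoc smult_smult[of r])
  qed
  show ?thesis
  proof (rule in_add_retract[OF rmodule_corner[OF rmodule_E] rmodule_axioms through_cong[OF through_single[OF rmodule_axioms is_linear_id is_linear_id]] l1 l2])
    fix f assume fC: "f \<in> carrier ?C"
    show "(\<lambda>m'\<in>carrier M. q m' \<odot>\<^bsub>M\<^esub> f m0) = f"
      using fm[OF fC] linear_mapsD(4)[OF f(1)[OF fC]] by (auto simp: fun_eq_iff restrict_def)
  qed simp
qed

text \<open>The module is \<open>E\<close> modulo the right ideal of all \<open>f\<close> with \<open>q f M \<subseteq> I\<close>; the classes are turned
  into elements of \<open>coset_type\<close> by means of constant functions.\<close>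
lemma corner_torsion:
  assumes "ideal I R" "\<one> \<notin> I"
  shows "\<exists>(Q :: ('m \<Rightarrow> 'm, ('m \<Rightarrow> 'm) coset_type) module) c. rmodule E Q \<and> fin_gen E Q \<and>
    c \<in> carrier (corner Q) \<and> c \<noteq> \<zero>\<^bsub>corner Q\<^esub> \<and> (\<forall>r \<in> I. r \<odot>\<^bsub>corner Q\<^esub> c = \<zero>\<^bsub>corner Q\<^esub>)"
proof -
  interpret I: ideal I R by fact
  interpret ER: rmodule E "right_regular E" by (rule rmodule_E)
  \<comment> \<open>The values of \<open>q\<close> after \<open>f\<close>, modulo \<open>I\<close>.
    Two endomorphisms are identified in the quotient exactly when these data agree.\<close>
  define \<kappa> where "\<kappa> f = (\<lambda>m\<in>carrier M. I +> q (f m))" for f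
  define \<pi> :: "('m \<Rightarrow> 'm) \<Rightarrow> ('m \<Rightarrow> 'm) coset_type" where "\<pi> f = (\<lambda>g _. g) ` {g \<in> carrier E. \<kappa> g = \<kappa> f}" for f
  have \<pi>_eq: "\<pi> f = \<pi> g \<longleftrightarrow> \<kappa> f = \<kappa> g" if "f \<in> carrier E" "g \<in> carrier E" for f g
  proof
    assume "\<pi> f = \<pi> g"
    moreover have "(\<lambda>_. f) \<in> \<pi> f" using that unfolding \<pi>_def by (intro image_eqI[of _ _ f]) simp_all
    ultimately have "(\<lambda>_. f) \<in> \<pi> g" by simp
    then obtain h where "(\<lambda>_::nat. f) = (\<lambda>_. h)" "\<kappa> h = \<kappa> g" unfolding \<pi>_def by blast
    then show "\<kappa> f = \<kappa> g" by (metis (full_types))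
  qed (simp add: \<pi>_def)
  have \<kappa>_add: "\<kappa> (f \<oplus>\<^bsub>E\<^esub> g) = (\<lambda>m\<in>carrier M. \<kappa> f m <+> \<kappa> g m)" if "f \<in> carrier E" "g \<in> carrier E" for f g
    unfolding \<kappa>_def
  proof (rule restrict_ext)
    fix m assume m: "m \<in> carrier M"
    have "f m \<in> carrier M" "g m \<in> carrier M" using that m linear_mapsD(1)[of _ R M M m] by simp_all
    then show "I +> q ((f \<oplus>\<^bsub>E\<^esub> g) m)
        = (\<lambda>m\<in>carrier M. I +> q (f m)) m <+> (\<lambda>m\<in>carrier M. I +> q (g m)) m"
      using m by (simp add: q_simps I.a_rcos_sum)
  qed
  have \<kappa>_mult: "\<kappa> (f \<otimes>\<^bsub>E\<^esub> a) = (\<lambda>m\<in>carrier M. \<kappa> f (a m))" if "a \<in> carrier E" for f a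
    using that linear_mapsD(1)[of a R M M] by (auto simp: \<kappa>_def compose_def fun_eq_iff)
  note EA = ER.M.a_closed[simplified right_regular_simps] and EM = ER.R.m_closed
  let ?X = "img_module (right_regular E) \<pi>"
  have X: "rmodule E ?X" "is_linear E (right_regular E) ?X \<pi>"
  proof (rule_tac [!] img_module[OF rmodule_E])
    fix f f' g assume "f \<in> carrier (right_regular E)" "f' \<in> carrier (right_regular E)" "g \<in> carrier (right_regular E)" "\<pi> f = \<pi> f'"
    then show "\<pi> (f \<oplus>\<^bsub>right_regular E\<^esub> g) = \<pi> (f' \<oplus>\<^bsub>right_regular E\<^esub> g)"
      "\<pi> (f \<oplus>\<^bsub>right_regular E\<^esub> g) = \<pi> (f' \<oplus>\<^bsub>right_regular E\<^esub> g)"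
      by (simp_all only: right_regular_simps \<pi>_eq \<kappa>_add EA)
  next
    fix a f f' assume "a \<in> carrier E" "f \<in> carrier (right_regular E)" "f' \<in> carrier (right_regular E)" "\<pi> f = \<pi> f'"
    then show "\<pi> (a \<odot>\<^bsub>right_regular E\<^esub> f) = \<pi> (a \<odot>\<^bsub>right_regular E\<^esub> f')"
      "\<pi> (a \<odot>\<^bsub>right_regular E\<^esub> f) = \<pi> (a \<odot>\<^bsub>right_regular E\<^esub> f')"
      by (simp_all only: right_regular_simps \<pi>_eq \<kappa>_mult EM)
  qed
  interpret X: rmodule E ?X by (rule X(1))
  note \<pi> = is_linearD[OF X(2), unfolded right_regular_simps]
  have zero: "\<zero>\<^bsub>?X\<^esub> = \<pi> \<zero>\<^bsub>E\<^esub>" by (simp add: img_module_def)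
  have "carrier ?X \<subseteq> lspan E ?X {\<pi> \<one>\<^bsub>E\<^esub>}"
  proof
    fix u assume "u \<in> carrier ?X"
    then obtain f where f: "f \<in> carrier E" "u = \<pi> f" unfolding carrier_img_module right_regular_simps
      by blast
    have "\<pi> (\<one>\<^bsub>E\<^esub> \<otimes>\<^bsub>E\<^esub> f) = f \<odot>\<^bsub>?X\<^esub> \<pi> \<one>\<^bsub>E\<^esub>" by (rule \<pi>(3)[OF f(1) ER.R.one_closed])
    then have "u = f \<odot>\<^bsub>?X\<^esub> \<pi> \<one>\<^bsub>E\<^esub>" using f by (simp only: ER.R.l_one)
    then show "u \<in> lspan E ?X {\<pi> \<one>\<^bsub>E\<^esub>}" using lspan_smult[OF f(1) lspan_base[OF singletonI]] by (simp only:)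
  qed
  moreover have "\<pi> \<one>\<^bsub>E\<^esub> \<in> carrier ?X" by (rule \<pi>(1)[OF ER.R.one_closed])
  ultimately have fg: "fin_gen E ?X"
    unfolding X.fin_gen_iff_lspan by (intro exI[of _ "{\<pi> \<one>\<^bsub>E\<^esub>}"]) simp
  \<comment> \<open>The element sought is the class of \<open>idem\<close>: at \<open>m0\<close> the
    form \<open>q\<close> gives 1, which is outside \<open>I\<close>, while multiplying by
    \<open>r\<close> in \<open>I\<close> moves all values of \<open>q\<close> into
    \<open>I\<close>.\<close>
  have "idem \<odot>\<^bsub>?X\<^esub> \<pi> idem = \<pi> idem" using \<pi>(3)[OF idem_closed idem_closed] by (simp only: idem_idem)
  then have c: "\<pi> idem \<in> carrier (corner ?X)"
    using \<pi>(1)[OF idem_closed] by (simp only: corner_simps mem_Collect_eq)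
  have E0: "\<zero>\<^bsub>E\<^esub> \<in> carrier E" by (rule ER.R.zero_closed)
  have q0: "q \<zero>\<^bsub>M\<^esub> = \<zero>" using linear_zero[OF rmodule_right_regular[OF ring_axioms] q] by simp
  have coset0: "I +> a = I +> \<zero> \<longleftrightarrow> a \<in> I" if "a \<in> carrier R" for a
    using quotient_eq_iff_same_a_r_cos[OF assms(1) that R.zero_closed] that by (simp add: R.minus_eq)
  have "\<pi> idem \<noteq> \<zero>\<^bsub>corner ?X\<^esub>"
  proof
    assume "\<pi> idem = \<zero>\<^bsub>corner ?X\<^esub>"
    then have "\<kappa> idem = \<kappa> \<zero>\<^bsub>E\<^esub>" using \<pi>_eq[OF idem_closed E0] zero by (simp only: corner_simps)
    from fun_cong[OF this, of m0] have "I +> \<one> = I +> \<zero>"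
      using m0 by (simp add: \<kappa>_def idem_def qm0 q0)
    then show False using coset0 assms(2) by simp
  qed
  moreover have "r \<odot>\<^bsub>corner ?X\<^esub> \<pi> idem = \<zero>\<^bsub>corner ?X\<^esub>" if r: "r \<in> I" for r
  proof -
    have rc: "r \<in> carrier R" using r I.Icarr by blast
    have "\<kappa> (idem \<otimes>\<^bsub>E\<^esub> scalar r) = \<kappa> \<zero>\<^bsub>E\<^esub>"
      unfolding \<kappa>_def
    proof (rule restrict_ext)
      fix m assume m: "m \<in> carrier M"
      have "q ((idem \<otimes>\<^bsub>E\<^esub> scalar r) m) = q m \<otimes> r"
        using m m0 rc by (simp add: compose_def idem_def scalar_def q_simps qm0)
      moreover have "q m \<otimes> r \<in> I" using I.I_l_closed[OF r q_simps(1)[OF m]] .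
      ultimately show "I +> q ((idem \<otimes>\<^bsub>E\<^esub> scalar r) m) = I +> q (\<zero>\<^bsub>E\<^esub> m)"
        using coset0[of "q m \<otimes> r"] q_simps(1)[OF m] rc m q0 by simp
    qed
    then have "\<pi> (idem \<otimes>\<^bsub>E\<^esub> scalar r) = \<pi> \<zero>\<^bsub>E\<^esub>"
      by (simp only: \<pi>_eq[OF EM[OF idem_closed scalar_closed[OF rc]] E0])
    then show ?thesis using \<pi>(3)[OF scalar_closed[OF rc] idem_closed] by (simp only: corner_simps zero)
  qed
  ultimately show ?thesis using X(1) fg c by blast
qed

text \<open>The corner functor is exact on images: if f x is fixed by \<open>idem\<close>, replace x
  by its product with \<open>idem\<close>.\<close>

lemma corner_image:
  assumes "rmodule E P" "is_linear E P P' f"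
  shows "f ` carrier (corner P) = {y \<in> f ` carrier P. idem \<odot>\<^bsub>P'\<^esub> y = y}"
proof -
  interpret P: rmodule E P by fact
  note f = is_linearD[OF assms(2)]
  show ?thesis
  proof (intro Set.set_eqI iffI)
    fix y assume "y \<in> f ` carrier (corner P)"
    then obtain x where x: "x \<in> carrier P" "idem \<odot>\<^bsub>P\<^esub> x = x" "y = f x" by auto
    have "idem \<odot>\<^bsub>P'\<^esub> y = y" using f(3)[OF idem_closed x(1)] x(2,3) by simp
    then show "y \<in> {y \<in> f ` carrier P. idem \<odot>\<^bsub>P'\<^esub> y = y}" using x(1,3) by blast
  next
    fix y assume "y \<in> {y \<in> f ` carrier P. idem \<odot>\<^bsub>P'\<^esub> y = y}"
    then obtain x where x: "x \<in> carrier P" "y = f x" "idem \<odot>\<^bsub>P'\<^esub> y = y" by blast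
    have "idem \<odot>\<^bsub>P\<^esub> (idem \<odot>\<^bsub>P\<^esub> x) = idem \<odot>\<^bsub>P\<^esub> x"
      using P.smult_assoc[OF idem_closed idem_closed x(1)] by (simp only: idem_idem)
    then have "idem \<odot>\<^bsub>P\<^esub> x \<in> carrier (corner P)"
      using P.smult_closed[OF idem_closed x(1)] by (simp only: corner_simps mem_Collect_eq)
    moreover have "y = f (idem \<odot>\<^bsub>P\<^esub> x)" using f(3)[OF idem_closed x(1)] x(2,3) by simp
    ultimately show "y \<in> f ` carrier (corner P)" by blast
  qed
qed

end

section \<open>Global dimension of the endomorphism ring\<close>

context cm_setting
begin

text \<open>By purity \<open>R\<close> is a retract of \<open>S\<close>, and \<open>S\<close> is in
  add M.\<close>

lemma R_in_add: "in_add R M (right_regular R)"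
proof -
  have rr: "rmodule R (right_regular R)" by (rule rmodule_right_regular) (rule ring_axioms)
  obtain \<rho> where \<rho>: "\<rho> \<in> linear_maps R (regular_module S) (regular_module R)" "\<And>r. r \<in> carrier R \<Longrightarrow> \<rho> r = r"
    using pure by (auto simp: pure_extension_def)
  note D = linear_mapsD[OF \<rho>(1), simplified]
  have 1: "is_linear R (right_regular R) (regular_module S) (\<lambda>r. r)"
    by (rule is_linearI) (use carrier_subset m_comm in \<open>auto simp: ring_ops[symmetric]\<close>)
  have 2: "is_linear R (regular_module S) (right_regular R) \<rho>"
    by (rule is_linearI) (auto simp: D m_comm)
  show ?thesis
    by (rule in_add_retract[OF rr rmodule_mono[OF rmodule_regular ext] S_in_add 1 2]) (simp add: \<rho>(2))
qed

text \<open>As \<open>R\<close> is local, it is a direct summand of \<open>M\<close> itself and not just of a sum of copies of \<open>M\<close>.\<close>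
lemma exists_unimodular:
  "\<exists>q m0. is_linear R M (right_regular R) q \<and> m0 \<in> carrier M \<and> q m0 = \<one>"
proof (rule ccontr)
  assume no: "\<not> ?thesis"
  interpret M: rmodule R M by (rule M_R)
  interpret I: ideal \<mm> R by (rule max_ideal_ideal)
  \<comment> \<open>A value outside the maximal ideal is a unit and could be rescaled to 1. If all
    linear forms on \<open>M\<close> have values in the maximal ideal, so has every sum of
    composites through \<open>M\<close> at 1, which the identity of \<open>R\<close> has
    not.\<close>
  have m: "g m \<in> \<mm>" if g: "is_linear R M (right_regular R) g" "m \<in> carrier M" for g m
  proof (rule ccontr)
    assume "g m \<notin> \<mm>"
    moreover have "g m \<in> carrier R" using is_linearD(1)[OF g] by simp
    ultimately have u: "g m \<in> Units R" using unit_of_notin_max_ideal by blast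
    have "g (inv (g m) \<odot>\<^bsub>M\<^esub> m) = \<one>" using is_linearD(3)[OF g(1) Units_inv_closed[OF u] g(2)] u by simp
    then show False using no g(1) M.smult_closed[OF Units_inv_closed[OF u] g(2)] by blast
  qed
  have "h \<one> \<in> \<mm>" if "factors_through R M (right_regular R) (right_regular R) h" for h
    using that
  proof (induction rule: factors_through.induct)
    case (through_zero h)
    then show ?case by simp
  next
    case (through_step h f g h')
    have "f \<one> \<in> carrier M" using is_linearD(1)[OF through_step(2)] by simp
    then show ?case using through_step(4) through_step.IH m[OF through_step(3)] I.a_closed by simp
  qed
  from this[OF R_in_add] show False using one_notin_max_ideal by simp
qed

text \<open>The corner of a resolution of length n < d would resolve, by modules in add M, a module
  with a nonzero element killed by the sequence. \<open>syzygies_socle\<close> keeps a nonzero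
  element in the syzygy of degree n + 1, although that syzygy is the image of a zero module.\<close>

lemma proj_dim_ge:
  "\<exists>Q :: ('m \<Rightarrow> 'm, ('m \<Rightarrow> 'm) coset_type) module.
    fg_right_module (End_ring R M) Q \<and> enat d \<le> proj_dim (End_ring R M) Q"
proof -
  obtain q m0 where q: "is_linear R M (right_regular R) q" "m0 \<in> carrier M" "q m0 = \<one>"
    using exists_unimodular by blast
  have "corner R M q m0"
    unfolding corner_def corner_axioms_def endo_def using cmodule_restrict[OF M_S] q by blast
  then interpret C: corner R M q m0 .
  interpret ER: ring "End_ring R M" by (rule C.E_ring)
  obtain Q :: "('m \<Rightarrow> 'm, ('m \<Rightarrow> 'm) coset_type) module" and c
    where Q: "rmodule (End_ring R M) Q" "fin_gen (End_ring R M) Q"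
    and c: "c \<in> carrier (C.corner Q)" "c \<noteq> \<zero>\<^bsub>C.corner Q\<^esub>" "\<And>r. r \<in> \<mm> \<Longrightarrow> r \<odot>\<^bsub>C.corner Q\<^esub> c = \<zero>\<^bsub>C.corner Q\<^esub>"
    using C.corner_torsion[OF max_ideal_ideal one_notin_max_ideal] by blast
  obtain x where x: "x \<in> UNIV \<rightarrow> carrier R" "\<forall>i < d. x i \<in> \<mm>" "weakly_regular M x d"
    using M_MCM unfolding MCM_iff by blast
  have "d \<le> n" if res: "projective_resolution (End_ring R M) Q P \<delta> \<epsilon>" and z: "\<forall>i > n. is_zero (P i)"
    for n \<delta> \<epsilon> and P :: "nat \<Rightarrow> ('m \<Rightarrow> 'm, ('m \<Rightarrow> 'm) coset_type) module"
  proof (rule ccontr)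
    assume "\<not> d \<le> n"
    then have n: "Suc n \<le> d" by simp
    have P: "rmodule (End_ring R M) (P i)" "in_add (End_ring R M) (right_regular (End_ring R M)) (P i)" for i
      using res ER.in_add_of_projective[of "P i"]
      by (auto simp: projective_resolution_def projective_def fg_right_module_iff)
    have \<epsilon>: "is_linear (End_ring R M) (P 0) Q \<epsilon>" "\<epsilon> ` carrier (P 0) = carrier Q"
      and \<delta>: "is_linear (End_ring R M) (P (Suc i)) (P i) (\<delta> i)"
      and ex0: "\<delta> 0 ` carrier (P 1) = ker_of (P 0) Q \<epsilon>"
      and ex: "\<delta> (Suc i) ` carrier (P (Suc (Suc i))) = ker_of (P (Suc i)) (P i) (\<delta> i)" for i
      using res by (simp_all add: projective_resolution_def linear_maps_linear)
    define N where "N i = C.corner (P i)" for i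
    define f where "f i = (case i of 0 \<Rightarrow> \<epsilon> | Suc k \<Rightarrow> \<delta> k)" for i
    define T where "T i = (case i of 0 \<Rightarrow> C.corner Q | Suc k \<Rightarrow> N k)" for i
    \<comment> \<open>The augmentation counts as \<open>f 0\<close>, so \<open>L 0\<close> is the
      whole corner of \<open>Q\<close> and \<open>L (Suc i)\<close> is the image of a differential,
      by exactness the kernel of the surjection from \<open>N i\<close> onto
      \<open>L i\<close>.\<close>
    define L where "L i = (T i)\<lparr>carrier := f i ` carrier (N i)\<rparr>" for i
    have NT: "cmodule R (N i)" "cmodule R (T i)" for i
      using C.rmodule_corner[OF P(1)] C.rmodule_corner[OF Q(1)] cring_axioms
      by (auto simp: cmodule_def N_def T_def split: nat.split)
    have f: "is_linear R (N i) (T i) (f i)" for i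
      using C.corner_linear[OF \<epsilon>(1)] C.corner_linear[OF \<delta>] by (simp add: N_def T_def f_def split: nat.split)
    have rm: "rmodule R (N i)" "rmodule R (T i)" for i using NT[of i] by (simp_all add: cmodule_def)
    have sub: "is_sub R (T i) (f i ` carrier (N i))" for i
      by (rule rmodule.linear_image_sub[OF rm f rmodule.sub_carrier[OF rm(1)]])
    have syz: "syzygy R (N i) (L i) (f i) x" for i
      unfolding syzygy_def syzygy_axioms_def
      using NT(1) cmodule.cmodule_sub[OF NT(2) sub] is_linear_sub_cod[OF f[of i] order_refl] x(1)
      by (simp add: L_def)
    have car: "f (Suc i) ` carrier (N (Suc i)) = ker_of (N i) (T i) (f i)" for i
    proof -
      have "f (Suc i) ` carrier (P (Suc i)) = {y \<in> carrier (P i). f i y = \<zero>\<^bsub>T i\<^esub>}"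
        using ex0 ex by (cases i) (simp_all add: f_def T_def N_def ker_of_def)
      then show ?thesis
        using C.corner_image[OF P(1) \<delta>[of i]] by (auto simp: N_def f_def ker_of_def)
    qed
    have L_Suc: "L (Suc i) = (N i)\<lparr>carrier := ker_of (N i) (L i) (f i)\<rparr>" for i
    proof -
      have "ker_of (N i) (L i) (f i) = ker_of (N i) (T i) (f i)" by (simp add: ker_of_def L_def)
      then show ?thesis by (simp add: L_def[of "Suc i"] car) (simp add: T_def)
    qed
    have w: "weakly_regular (N i) x d" for i
    proof (rule weakly_regular_in_add[OF C.cmodule_axioms NT(1) _ _ x(3)])
      show "in_add R M (N i)"
        unfolding N_def
        by (rule through_trans[OF C.rmodule_corner[OF P(1)] C.rmodule_corner[OF P(1)]
              C.rmodule_corner[OF C.rmodule_E] C.corner_factors[OF P(2)] C.corner_E_in_add])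
    qed (use x(1) in auto)
    have "carrier (L 0) = carrier (C.corner Q)"
      using C.corner_image[OF P(1) \<epsilon>(1)] \<epsilon>(2) by (simp add: L_def f_def N_def)
    then have L0: "L 0 = C.corner Q" by (simp add: L_def T_def)
    obtain z' where z': "z' \<in> carrier (L (Suc n))" "z' \<notin> seq_mult (L (Suc n)) x (Suc n)"
      using syzygies_socle[where N = N and L = L and f = f and c = c, OF syz L_Suc w _ _ _ n] c x(2)
      unfolding L0 by auto
    \<comment> \<open>Term n + 1 of the resolution is zero, hence so is its image; but zero lies in
      every submodule, which \<open>z'\<close> was to avoid.\<close>
    have "z' = \<zero>\<^bsub>L (Suc n)\<^esub>"
    proof -
      have "carrier (N (Suc n)) \<subseteq> {\<zero>\<^bsub>N (Suc n)\<^esub>}" using z by (auto simp: N_def is_zero_def)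
      then have "z' = f (Suc n) \<zero>\<^bsub>N (Suc n)\<^esub>" using z'(1) by (auto simp: L_def)
      also have "\<dots> = \<zero>\<^bsub>T (Suc n)\<^esub>" by (rule rmodule.linear_zero[OF rm f])
      finally show ?thesis by (simp add: L_def)
    qed
    moreover have "cmodule R (L (Suc n))" using syz[of "Suc n"] by (simp add: syzygy_def)
    then have "is_sub R (L (Suc n)) (seq_mult (L (Suc n)) x (Suc n))"
      by (rule cmodule.seq_mult_sub) (use x(1) in auto)
    ultimately show False using z'(2) is_subD(2) by metis
  qed
  then have "enat d \<le> proj_dim (End_ring R M) Q"
    unfolding proj_dim_def by (intro Inf_greatest) auto
  then show ?thesis using Q fg_right_module_iff by blast
qed

lemma gl_dim_End_ge: "enat d \<le> gl_dim (End_ring R M)"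
proof -
  obtain Q :: "('m \<Rightarrow> 'm, ('m \<Rightarrow> 'm) coset_type) module"
    where Q: "fg_right_module (End_ring R M) Q" "enat d \<le> proj_dim (End_ring R M) Q"
    using proj_dim_ge by blast
  have "proj_dim (End_ring R M) Q \<le> gl_dim (End_ring R M)"
    unfolding gl_dim_def by (rule Sup_upper) (use Q(1) in blast)
  with Q(2) show ?thesis by (rule order_trans)
qed

lemma gl_dim_End_le: "gl_dim (End_ring R M) \<le> enat (max d 2)"
proof -
  interpret EM: endo R M unfolding endo_def by (rule cmodule_restrict[OF M_S])
  \<comment> \<open>The subtraction is exact because the maximum is at least 2; thus d \<le> n + 2,
    as \<open>syzygy_kernel_in_add\<close> demands.\<close>
  define n where "n = max d 2 - 2"
  have n: "max d 2 = Suc (Suc n)" by (simp add: n_def)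
  have "noeth (End_ring R M) (right_regular (End_ring R M))"
    using EM.noeth_E[OF noeth_R] M_MCM MCM_iff by blast
  then show ?thesis unfolding n
    by (rule ring.gl_dim_le[OF EM.E_ring]) (rule syzygy_kernel_in_add, use n in auto)
qed

end

theorem theorem2p6:
  fixes R S :: "'s ring" and M :: "('s, 'm) module" and d :: nat
  assumes "noetherian_domain R"
    and "complete_local_ring R"
    and "krull_dim R = enat d"
    and "ring_extension R S"
    and "fin_gen R (regular_module S)"
    and "torsion_free R (regular_module S)"
    and "MCM R (regular_module S)"
    and "finite_CM_type R S"
    and "CM_generator R S M"
    and "pure_extension R S"
    and "MCM R (hom_module R (regular_module S) M)"
  shows "gl_dim (End_ring R M) \<le> enat (max d 2) \<and>
         is_NCR R M \<and>
         (d \<ge> 2 \<longrightarrow> gl_dim (End_ring R M) = enat d)"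
proof -
  have "cm_setting R d S M"
    using assms
    unfolding cm_setting_def cm_generator_def noeth_local_dim_def noeth_local_def cm_setting_axioms_def
      cm_generator_axioms_def noeth_local_dim_axioms_def noeth_local_axioms_def complete_local_ring_def
    by blast
  then interpret cm_setting R d S M .
  have "is_NCR R M"
    unfolding is_NCR_def
  proof (intro conjI)
    show "module R M" "fin_gen R M" using M_MCM by (auto simp: MCM_def)
    show "torsion_free R M" by (rule MCM_torsion_free[OF M_MCM])
    show "gl_dim (End_ring R M) < \<infinity>" using gl_dim_End_le by (metis enat_ord_code(4) order_le_less_trans)
  qed
  moreover have "gl_dim (End_ring R M) = enat d" if "d \<ge> 2"
    using gl_dim_End_le gl_dim_End_ge that by (simp add: antisym)
  ultimately show ?thesis using gl_dim_End_le by blast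
qed

end
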